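(* Let $E\subseteq\mathbb{N}$ be a set of upper density $\delta>0$. Then for any $\varepsilon>0$, $$\limsup_{N\to\infty}\limsup_{M\to\infty}\frac{|\{(n,m)\in[1,N]\times[1,M]: m,\,m+n,\,m+\Omega(n)\in E\}|}{NM}\geq\delta^3-\varepsilon.$$ In particular, there exists $n\in\mathbb{N}$ such that $\{m,m+n,m+\Omega(n)\}\subseteq E$ holds for all $m$ in a set of positive upper density.
   Context: $\mathbb{N}=\{1,2,\dots\}$; in the displayed set $n,m$ are positive integers. $\Omega(n)$ is the number of prime factors of $n$ counted with multiplicity. The upper density of $E\subseteq\mathbb{N}$ is $\overline d(E)=\limsup_{N\to\infty}\frac{|E\cap[1,N]|}{N}$. *)

theory Defs
  imports "HOL-Analysis.Analysis" "HOL-Computational_Algebra.Primes"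
begin

text \<open>Sets of positive integers are sets of type \<^typ>\<open>nat set\<close> not containing 0.
  Limits superior are taken in \<^typ>\<open>ereal\<close>, since \<^typ>\<open>real\<close> is not a complete lattice.
  The term at \<open>N = 0\<close> (where division by zero gives 0) does not affect them.\<close>

definition upper_density :: "nat set \<Rightarrow> ereal" where
  "upper_density E = limsup (\<lambda>N. ereal (real (card (E \<inter> {1..N})) / real N))"

definition num_prime_factors :: "nat \<Rightarrow> nat" where
  "num_prime_factors n = size (prime_factorization n)"

end

theory Submission
  imports Defs "HOL-Number_Theory.Number_Theory" "HOL-Computational_Algebra.Squarefree"
begin

text \<open>Let \<open>\<Lambda>\<close> be a shift-invariant mean along intervals \<open>[1, M\<^sub>j]\<close> on which \<open>E\<close> has density tending to \<open>\<delta>\<close>,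
  and write \<open>f\<close> for the indicator of \<open>E\<close> and \<open>T\<close> for the shift. Since a Cesaro limit superior dominates the
  logarithmic one, it suffices that the logarithmic mean over \<open>n\<close> of \<open>\<Lambda>(f \<cdot> T\<^sup>n f \<cdot> T\<^bsup>\<Omega>(n)\<^esup> f)\<close> is at least \<open>\<delta>\<^sup>3\<close>.
  Logarithmic means are unaffected by dilations, so the Turan-Kubilius inequality replaces \<open>n\<close> by \<open>p n\<close>
  on average over a finite set of primes \<open>p\<close>. As \<open>\<Omega>(p n) = \<Omega>(n) + 1\<close> does not depend on \<open>p\<close>, the
  factor \<open>T\<^sup>n f\<close> may be replaced by a nearly \<open>T\<^sup>r\<close>-invariant convex combination of its shifts, where \<open>r\<close> is a
  multiple of all differences of these primes. What remains depends on \<open>n\<close> only through \<open>n mod r\<close> and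
  \<open>\<Omega>(n)\<close>, and these are independent in logarithmic mean. By the same dilation argument, independence can
  only fail if some nonprincipal Dirichlet character is constant on primes up to a set with convergent
  reciprocal sum; this is excluded by Mertens' theorems for characters and by \<open>L(1, \<chi>) \<noteq> 0\<close> for real \<open>\<chi>\<close>.
  Finally \<open>\<Omega>(n)\<close> is invariant in distribution under adding 1, so \<open>f\<close> becomes nearly invariant in all three
  factors, and convexity gives \<open>\<delta>\<^sup>3\<close>.\<close>

section \<open>Invariant means\<close>

text \<open>The two averages have different duties. In \<open>m\<close> only shift invariance is
  used, so \<open>m\<close> may run along any intervals that attain the upper density. The average
  over \<open>n\<close> must survive passing from \<open>n\<close> to \<open>p * n\<close>: weights
  \<open>1/n\<close> do, since \<open>1/(p n)\<close> is \<open>1/p\<close> times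
  \<open>1/n\<close>, whereas a uniform mean would shorten its range of summation. Limits along a
  fixed ultrafilter turn both into exact linear functionals, so convergence never has to be
  discussed. The obstacle is that both shifts depend on the same \<open>n\<close>. Multiplication by
  primes separates them: it stretches \<open>n\<close> by different factors while moving the number
  of prime factors by the same amount. Cauchy-Schwarz then removes the factor with that number, and
  only correlations along \<open>(p - q) * n\<close> remain. The nearly invariant combination comes
  from von Neumann's proof of the mean ergodic theorem: an element of nearly minimal norm in a
  convex hull of shifts. Of a residue class only the divergence of the reciprocals of its primes is
  asked, so estimates for characters with error terms small against \<open>ln N\<close> are precise
  enough.\<close>

definition bdd :: "(nat \<Rightarrow> real) \<Rightarrow> bool" where
  "bdd x \<longleftrightarrow> (\<exists>B. \<forall>n. \<bar>x n\<bar> \<le> B)"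

lemma bddI: "(\<And>n. \<bar>x n\<bar> \<le> B) \<Longrightarrow> bdd x"
  by (auto simp: bdd_def)

lemma bdd_const [simp]: "bdd (\<lambda>_. c)"
  by (auto simp: bdd_def)

lemma bdd_add [simp]: "bdd x \<Longrightarrow> bdd y \<Longrightarrow> bdd (\<lambda>n. x n + y n)"
  unfolding bdd_def by (metis abs_triangle_ineq add_mono order_trans)

lemma bdd_mult [simp]:
  assumes "bdd x" "bdd y" shows "bdd (\<lambda>n. x n * y n)"
proof -
  obtain A B where "\<And>n. \<bar>x n\<bar> \<le> A" "\<And>n. \<bar>y n\<bar> \<le> B"
    using assms by (auto simp: bdd_def)
  then have "\<bar>x n * y n\<bar> \<le> A * B" for n
    unfolding abs_mult by (meson abs_ge_zero mult_mono order_trans)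
  then show ?thesis by (rule bddI)
qed

lemma bdd_uminus [simp]: "bdd x \<Longrightarrow> bdd (\<lambda>n. - x n)"
  by (simp add: bdd_def)

lemma bdd_diff [simp]: "bdd x \<Longrightarrow> bdd y \<Longrightarrow> bdd (\<lambda>n. x n - y n)"
  using bdd_add[of x "\<lambda>n. - y n"] by auto

lemma bdd_divide [simp]: "bdd x \<Longrightarrow> bdd (\<lambda>n. x n / c)"
  using bdd_mult[of x "\<lambda>_. 1 / c"] by simp

lemma bdd_power [simp]: "bdd x \<Longrightarrow> bdd (\<lambda>n. x n ^ k)"
  by (induction k) auto

lemma bdd_sum [simp]: "(\<And>i. i \<in> I \<Longrightarrow> bdd (x i)) \<Longrightarrow> bdd (\<lambda>n. \<Sum>i\<in>I. x i n)"
  by (induction I rule: infinite_finite_induct) auto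

lemma bdd_of_bool [simp]: "bdd (\<lambda>n. of_bool (Q n))"
  by (rule bddI[of _ 1]) auto

lemma bdd_comp: "bdd x \<Longrightarrow> bdd (\<lambda>n. x (g n))"
  by (auto simp: bdd_def)

text \<open>The same axioms serve the average over \<open>m\<close> (uniform weights along chosen
  intervals) and the one over \<open>n\<close> (weights \<open>1/n\<close>).\<close>

locale mean =
  fixes L :: "(nat \<Rightarrow> real) \<Rightarrow> real"
  assumes add: "bdd x \<Longrightarrow> bdd y \<Longrightarrow> L (\<lambda>n. x n + y n) = L x + L y"
    and cmult: "bdd x \<Longrightarrow> L (\<lambda>n. c * x n) = c * L x"
    and mono: "bdd x \<Longrightarrow> bdd y \<Longrightarrow> (\<And>n. x n \<le> y n) \<Longrightarrow> L x \<le> L y"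
    and one: "L (\<lambda>_. 1) = 1"
    and shift1: "bdd x \<Longrightarrow> L (\<lambda>n. x (Suc n)) = L x"
begin

lemma const [simp]: "L (\<lambda>_. c) = c"
  using cmult[of "\<lambda>_. 1" c] one by simp

lemma diff: "bdd x \<Longrightarrow> bdd y \<Longrightarrow> L (\<lambda>n. x n - y n) = L x - L y"
  using add[of x "\<lambda>n. (-1) * y n"] cmult[of y "-1"] by (auto simp: bdd_uminus)

lemma divide: "bdd x \<Longrightarrow> L (\<lambda>n. x n / c) = L x / c"
  using cmult[of x "1 / c"] by simp

lemma sum:
  "(\<And>i. i \<in> I \<Longrightarrow> bdd (x i)) \<Longrightarrow> L (\<lambda>n. \<Sum>i\<in>I. x i n) = (\<Sum>i\<in>I. L (x i))"
  by (induction I rule: infinite_finite_induct) (auto simp: add bdd_sum)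

lemma shift: "bdd x \<Longrightarrow> L (\<lambda>n. x (n + k)) = L x"
proof (induction k)
  case (Suc k)
  then show ?case using shift1[of "\<lambda>n. x (n + k)"] bdd_comp[of x] by simp
qed simp

lemma le_const: "bdd x \<Longrightarrow> (\<And>n. x n \<le> c) \<Longrightarrow> L x \<le> c"
  using mono[of x "\<lambda>_. c"] by simp

lemma ge_const: "bdd x \<Longrightarrow> (\<And>n. c \<le> x n) \<Longrightarrow> c \<le> L x"
  using mono[of "\<lambda>_. c" x] by simp

lemma abs_le:
  assumes "\<And>n. \<bar>x n\<bar> \<le> c" shows "\<bar>L x\<bar> \<le> c"
  using le_const[of x c] ge_const[of x "-c"] bddI[of x c] assms
  by (smt (verit) abs_le_iff)

lemma square_le: 
  assumes "bdd x" shows "(L x)\<^sup>2 \<le> L (\<lambda>n. (x n)\<^sup>2)"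
proof -
  have b: "bdd (\<lambda>n. (x n)\<^sup>2)" using assms by auto
  have "0 \<le> L (\<lambda>n. (x n - L x)\<^sup>2)"
    by (intro ge_const bdd_power bdd_diff assms bdd_const zero_le_power2)
  also have "(\<lambda>n. (x n - L x)\<^sup>2) = (\<lambda>n. (x n)\<^sup>2 - (2 * L x) * x n + (L x)\<^sup>2)"
    by (simp add: power2_diff algebra_simps)
  also have "L \<dots> = L (\<lambda>n. (x n)\<^sup>2) - (2 * L x) * L x + (L x)\<^sup>2"
    using assms cmult[OF assms, of "2 * L x"] by (simp add: add diff)
  finally show ?thesis by (simp add: power2_eq_square)
qed

text \<open>Cauchy-Schwarz in the form used throughout: a factor bounded by 1 is discarded at the
  price of squaring the rest.\<close>

lemma square_mult_le:
  assumes "bdd y" "\<And>n. \<bar>x n\<bar> \<le> 1"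
  shows "(L (\<lambda>n. x n * y n))\<^sup>2 \<le> L (\<lambda>n. (y n)\<^sup>2)"
proof -
  have b: "bdd x" using assms(2) by (rule bddI)
  have "(L (\<lambda>n. x n * y n))\<^sup>2 \<le> L (\<lambda>n. (x n * y n)\<^sup>2)"
    using b assms by (intro square_le) auto
  also have "\<dots> \<le> L (\<lambda>n. (y n)\<^sup>2)"
  proof (rule mono)
    fix n
    have "(x n)\<^sup>2 \<le> 1" using assms(2)[of n] by (simp add: abs_square_le_1)
    then show "(x n * y n)\<^sup>2 \<le> (y n)\<^sup>2"
      by (simp add: power_mult_distrib mult_left_le_one_le)
  qed (use b assms in auto)
  finally show ?thesis .
qed

lemma abs_mult_le:
  assumes "bdd y" "\<And>n. \<bar>x n\<bar> \<le> 1"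
  shows "\<bar>L (\<lambda>n. x n * y n)\<bar> \<le> sqrt (L (\<lambda>n. (y n)\<^sup>2))"
  using square_mult_le[OF assms] by (simp add: real_le_rsqrt)

end

text \<open>\<open>dilate\<close> is what sets the weights \<open>1/n\<close> apart: the terms at
  multiples of \<open>p\<close> are a copy of the whole sum scaled by \<open>1/p\<close>.
  \<open>pos_cong\<close> is there because \<open>num_prime_factors (p * n)\<close> obeys its
  addition rule only for \<open>n \<ge> 1\<close>.\<close>

locale log_mean = mean +
  assumes dilate: "bdd x \<Longrightarrow> p \<ge> 1 \<Longrightarrow> L (\<lambda>n. of_bool (p dvd n) * x n) = L (\<lambda>n. x (p * n)) / real p"
    and pos_cong: "(\<And>n. n \<ge> 1 \<Longrightarrow> x n = y n) \<Longrightarrow> L x = L y"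
begin

lemma dvd: "p \<ge> 1 \<Longrightarrow> L (\<lambda>n. of_bool (p dvd n)) = 1 / real p"
  using dilate[of "\<lambda>_. 1" p] by simp

lemma dvd_dvd:
  assumes "prime p" "prime q"
  shows "L (\<lambda>n. of_bool (p dvd n) * of_bool (q dvd n)) = (if p = q then 1 / real p else 1 / (real p * real q))"
proof (cases "p = q")
  case True
  have "(\<lambda>n. of_bool (p dvd n) * of_bool (q dvd n)) = (\<lambda>n. of_bool (p dvd n) :: real)"
    using True by auto
  then show ?thesis using dvd[OF prime_ge_1_nat[OF assms(1)]] True by simp
next
  case False
  have "L (\<lambda>n. of_bool (p dvd n) * of_bool (q dvd n)) = L (\<lambda>n. of_bool (q dvd p * n)) / real p"
    using assms by (intro dilate prime_ge_1_nat bdd_of_bool)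
  also have "(\<lambda>n. of_bool (q dvd p * n)) = (\<lambda>n. of_bool (q dvd n) :: real)"
    using False assms primes_dvd_imp_eq[of q p] by (auto simp: prime_dvd_mult_iff fun_eq_iff)
  finally show ?thesis using dvd[OF prime_ge_1_nat[OF assms(2)]] False by simp
qed

text \<open>Correlate \<open>a\<close> with \<open>X\<close>, the number of divisors in
  \<open>P\<close> minus its mean \<open>S\<close>. Distinct primes are exactly uncorrelated by
  \<open>dvd_dvd\<close>, so the variance of \<open>X\<close> is at most \<open>S\<close>, and
  \<open>dilate\<close> turns the mean of \<open>a\<close> over multiples of \<open>p\<close> into
  that of \<open>a (p * n)\<close>. Against a main term of size \<open>S\<close>, the error
  \<open>sqrt S\<close> is negligible once \<open>S\<close> is large.\<close>

lemma turan_kubilius: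
  assumes P: "finite P" "\<And>p. p \<in> P \<Longrightarrow> prime p" and a: "\<And>n. \<bar>a n\<bar> \<le> 1"
  defines "S \<equiv> (\<Sum>p\<in>P. 1 / real p)"
  shows "\<bar>S * L a - (\<Sum>p\<in>P. L (\<lambda>n. a (p * n)) / real p)\<bar> \<le> sqrt S"
proof -
  define Y where "Y = (\<lambda>p n. of_bool (p dvd n) - 1 / real p :: real)"
  define X where "X = (\<lambda>n. \<Sum>p\<in>P. Y p n)"
  have ba: "bdd a" using a by (rule bddI)
  have bY: "bdd (Y p)" for p unfolding Y_def by auto
  have bX: "bdd X" unfolding X_def using bY by auto
  have YY: "L (\<lambda>n. Y p n * Y q n) \<le> (if p = q then 1 / real p else 0)" if "p \<in> P" "q \<in> P" for p q
  proof -
    have pq: "prime p" "prime q" "p \<ge> 1" "q \<ge> 1" using P(2) that prime_ge_1_nat by blast+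
    have eq: "(\<lambda>n. Y p n * Y q n) = (\<lambda>n. (of_bool (p dvd n) * of_bool (q dvd n) - of_bool (p dvd n) / real q)
          - (of_bool (q dvd n) / real p - 1 / (real p * real q)))"
      by (simp add: Y_def algebra_simps)
    have "L (\<lambda>n. Y p n * Y q n) = (L (\<lambda>n. of_bool (p dvd n) * of_bool (q dvd n)) - L (\<lambda>n. of_bool (p dvd n)) / real q)
          - (L (\<lambda>n. of_bool (q dvd n)) / real p - 1 / (real p * real q))"
      unfolding eq by (simp add: diff divide)
    also have "\<dots> \<le> (if p = q then 1 / real p else 0)"
      using pq by (simp add: dvd_dvd dvd)
    finally show ?thesis .
  qed
  have "L (\<lambda>n. (X n)\<^sup>2) = L (\<lambda>n. \<Sum>p\<in>P. \<Sum>q\<in>P. Y p n * Y q n)"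
    by (simp add: X_def power2_eq_square sum_product)
  also have "\<dots> = (\<Sum>p\<in>P. \<Sum>q\<in>P. L (\<lambda>n. Y p n * Y q n))"
    using bY by (subst sum; auto)+
  also have "\<dots> \<le> (\<Sum>p\<in>P. \<Sum>q\<in>P. if p = q then 1 / real p else 0)"
    by (intro sum_mono YY)
  also have "\<dots> = S" using P by (simp add: S_def)
  finally have X2: "L (\<lambda>n. (X n)\<^sup>2) \<le> S" .
  have "L (\<lambda>n. a n * X n) = L (\<lambda>n. \<Sum>p\<in>P. of_bool (p dvd n) * a n - a n / real p)"
    by (simp add: X_def Y_def sum_distrib_left algebra_simps)
  also have "\<dots> = (\<Sum>p\<in>P. L (\<lambda>n. of_bool (p dvd n) * a n - a n / real p))"
    using ba by (intro sum) auto
  also have "\<dots> = (\<Sum>p\<in>P. L (\<lambda>n. a (p * n)) / real p - L a / real p)"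
  proof (intro sum.cong refl)
    fix p assume "p \<in> P"
    then have "p \<ge> 1" using P(2) prime_ge_1_nat by blast
    then show "L (\<lambda>n. of_bool (p dvd n) * a n - a n / real p) = L (\<lambda>n. a (p * n)) / real p - L a / real p"
      using ba by (subst diff) (auto simp: dilate divide)
  qed
  also have "\<dots> = (\<Sum>p\<in>P. L (\<lambda>n. a (p * n)) / real p) - S * L a"
    by (simp add: sum_subtractf S_def sum_distrib_right)
  finally have "\<bar>S * L a - (\<Sum>p\<in>P. L (\<lambda>n. a (p * n)) / real p)\<bar> = \<bar>L (\<lambda>n. a n * X n)\<bar>"
    by simp
  also have "\<dots> \<le> sqrt (L (\<lambda>n. (X n)\<^sup>2))"
    by (intro abs_mult_le bX a)
  also have "\<dots> \<le> sqrt S" using X2 by simp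
  finally show ?thesis .
qed

end

section \<open>Limits along an ultrafilter\<close>

lemma exists_ultrafilter:
  "\<exists>F. F \<noteq> bot \<and> F \<le> sequentially \<and> (\<forall>Q. eventually Q F \<or> eventually (\<lambda>n. \<not> Q n) F)"
proof -
  define A where "A = {F. F \<noteq> bot \<and> F \<le> sequentially}"
  \<comment> \<open>An ultrafilter is a minimal proper filter, so Zorn's lemma is applied to the
    reversed order. The infimum of a chain stays proper because an event holding eventually in it
    holds eventually in some member.\<close>
  have "\<exists>m\<in>A. \<forall>a\<in>A. a \<le> m \<longrightarrow> a = m"
  proof (rule predicate_Zorn)
    show "partial_order_on A (relation_of (\<lambda>x y. y \<le> x) A)"
      by (rule partial_order_on_relation_ofI) auto
  next
    fix C assume C: "C \<in> Chains (relation_of (\<lambda>x y. y \<le> x) A)"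
    show "\<exists>u\<in>A. \<forall>a\<in>C. u \<le> a"
    proof (cases "C = {}")
      case True
      then show ?thesis by (auto simp: A_def intro!: exI[of _ sequentially])
    next
      case False
      have CA: "C \<subseteq> A" and lin: "\<And>a b. a \<in> C \<Longrightarrow> b \<in> C \<Longrightarrow> a \<le> b \<or> b \<le> a"
        using C by (auto simp: Chains_def relation_of_def)
      have "eventually (\<lambda>_. False) (Inf C) \<longleftrightarrow> (\<exists>b\<in>C. eventually (\<lambda>_. False) b)"
      proof (rule eventually_Inf_base[OF False])
        fix F G assume "F \<in> C" "G \<in> C"
        then show "\<exists>x\<in>C. x \<le> inf F G" using lin[of F G] by (metis inf.absorb1 inf.absorb2 order_refl)
      qed
      then have "Inf C \<noteq> bot" using CA by (auto simp: A_def trivial_limit_def)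
      moreover have "Inf C \<le> sequentially"
        using False CA by (auto simp: A_def intro: Inf_lower2)
      ultimately show ?thesis by (auto simp: A_def intro!: bexI[of _ "Inf C"] Inf_lower)
    qed
  qed
  then obtain F where F: "F \<noteq> bot" "F \<le> sequentially"
    and min: "\<And>G. G \<noteq> bot \<Longrightarrow> G \<le> F \<Longrightarrow> G = F"
    by (auto simp: A_def)
  \<comment> \<open>Adding \<open>Q\<close> to \<open>F\<close> either collapses the filter or, by
    minimality, changes nothing.\<close>
  have "eventually Q F \<or> eventually (\<lambda>n. \<not> Q n) F" for Q
  proof (cases "inf F (principal {n. Q n}) = bot")
    case True
    then show ?thesis by (simp add: trivial_limit_def eventually_inf_principal)
  next
    case False
    then have "inf F (principal {n. Q n}) = F" using min by simp
    moreover have "eventually Q (inf F (principal {n. Q n}))"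
      by (simp add: eventually_inf_principal)
    ultimately show ?thesis by simp
  qed
  with F show ?thesis by blast
qed

definition ultra :: "nat filter" where
  "ultra = (SOME F. F \<noteq> bot \<and> F \<le> sequentially \<and> (\<forall>Q. eventually Q F \<or> eventually (\<lambda>n. \<not> Q n) F))"

lemma ultra_neq_bot [simp]: "ultra \<noteq> bot"
  and ultra_le: "ultra \<le> sequentially"
  and ultra_cases: "eventually Q ultra \<or> eventually (\<lambda>n. \<not> Q n) ultra"
  using someI_ex[OF exists_ultrafilter] unfolding ultra_def by blast+

definition glim :: "(nat \<Rightarrow> real) \<Rightarrow> real" where
  "glim x = Lim ultra x"

text \<open>Compactness of an interval gives a cluster point. For an ultrafilter it is a limit:
  lying in a given neighbourhood or lying outside it holds eventually, and a cluster point excludes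
  the latter.\<close>

lemma tendsto_glim:
  assumes "bdd x" shows "(x \<longlongrightarrow> glim x) ultra"
proof -
  obtain B where B: "\<And>n. \<bar>x n\<bar> \<le> B" using assms by (auto simp: bdd_def)
  have "x n \<in> {-B..B}" for n using B[of n] by auto
  then have "eventually (\<lambda>y. y \<in> {-B..B}) (filtermap x ultra)"
    by (simp add: eventually_filtermap)
  moreover have "filtermap x ultra \<noteq> bot" by (simp add: filtermap_bot_iff)
  ultimately obtain c where c: "inf (nhds c) (filtermap x ultra) \<noteq> bot"
    using compact_Icc[of "-B" B] unfolding compact_filter by blast
  have "(x \<longlongrightarrow> c) ultra"
  proof (rule topological_tendstoI)
    fix S assume S: "open S" "c \<in> S"
    have "\<not> eventually (\<lambda>n. \<not> x n \<in> S) ultra"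
    proof
      assume "eventually (\<lambda>n. \<not> x n \<in> S) ultra"
      then have "eventually (\<lambda>y. y \<notin> S) (filtermap x ultra)" by (simp add: eventually_filtermap)
      moreover have "eventually (\<lambda>y. y \<in> S) (nhds c)" using S by (auto simp: eventually_nhds)
      ultimately have "eventually (\<lambda>_. False) (inf (nhds c) (filtermap x ultra))"
        unfolding eventually_inf by (metis (no_types, lifting))
      then show False using c by (simp add: trivial_limit_def)
    qed
    then show "eventually (\<lambda>n. x n \<in> S) ultra" using ultra_cases[of "\<lambda>n. x n \<in> S"] by blast
  qed
  then show ?thesis using tendsto_Lim[OF ultra_neq_bot] unfolding glim_def by metis
qed

lemma glim_eqI: "(x \<longlongrightarrow> c) ultra \<Longrightarrow> glim x = c"
  unfolding glim_def by (rule tendsto_Lim[OF ultra_neq_bot])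

lemma glim_tendsto: "x \<longlonglongrightarrow> c \<Longrightarrow> glim x = c"
  by (rule glim_eqI) (rule tendsto_mono[OF ultra_le])

lemma glim_diff_eqI:
  assumes "bdd x" "bdd y" "(\<lambda>n. x n - y n) \<longlonglongrightarrow> 0" shows "glim x = glim y"
proof -
  have "((\<lambda>n. x n - y n) \<longlongrightarrow> glim x - glim y) ultra"
    by (intro tendsto_diff tendsto_glim assms)
  then have "glim (\<lambda>n. x n - y n) = glim x - glim y" by (rule glim_eqI)
  then show ?thesis using glim_tendsto[OF assms(3)] by simp
qed

lemma glim_le:
  assumes "bdd x" "bdd y" "eventually (\<lambda>n. x n \<le> y n) sequentially" shows "glim x \<le> glim y"
  using tendsto_le[OF ultra_neq_bot tendsto_glim[OF assms(2)] tendsto_glim[OF assms(1)]]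
    filter_leD[OF ultra_le assms(3)] by blast

section \<open>Weighted averages as shift-invariant means\<close>

definition wavg :: "(nat \<Rightarrow> real) \<Rightarrow> nat \<Rightarrow> (nat \<Rightarrow> real) \<Rightarrow> real" where
  "wavg w N x = (\<Sum>n=1..N. w n * x n) / (\<Sum>n=1..N. w n)"

text \<open>Weights \<open>1/n\<close> with \<open>M j = j\<close> give the logarithmic mean;
  constant weights give the uniform mean along the intervals \<open>[1, M j]\<close>.\<close>

definition wmean :: "(nat \<Rightarrow> real) \<Rightarrow> (nat \<Rightarrow> nat) \<Rightarrow> (nat \<Rightarrow> real) \<Rightarrow> real" where
  "wmean w M x = glim (\<lambda>j. wavg w (M j) x)"

text \<open>Decreasing weights of divergent sum make the average asymptotically shift invariant.
  \<open>w_decr\<close> starts at 1 because \<open>1 / real 0 = 0\<close> breaks monotonicity at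
  0.\<close>

locale weight =
  fixes w :: "nat \<Rightarrow> real" and M :: "nat \<Rightarrow> nat"
  assumes w_nonneg: "\<And>n. 0 \<le> w n" 
    and w_decr: "\<And>n. n \<ge> 1 \<Longrightarrow> w (Suc n) \<le> w n"
    and w_div: "filterlim (\<lambda>N. \<Sum>n=1..N. w n) at_top sequentially"
    and M_div: "filterlim M sequentially sequentially"
begin

lemma wavg_bound:
  assumes "\<And>n. \<bar>x n\<bar> \<le> B" shows "\<bar>wavg w N x\<bar> \<le> B"
proof -
  have B: "0 \<le> B" using assms[of 0] by simp
  have W: "0 \<le> (\<Sum>n=1..N. w n)" by (simp add: sum_nonneg w_nonneg)
  have "\<bar>\<Sum>n=1..N. w n * x n\<bar> \<le> (\<Sum>n=1..N. w n * B)"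
    by (intro order_trans[OF sum_abs] sum_mono) (simp add: abs_mult w_nonneg assms mult_left_mono)
  then have "\<bar>\<Sum>n=1..N. w n * x n\<bar> \<le> B * (\<Sum>n=1..N. w n)"
    by (simp add: sum_distrib_left mult.commute)
  then show ?thesis using B W unfolding wavg_def
    by (cases "(\<Sum>n=1..N. w n) = 0") (auto simp: abs_divide divide_le_eq)
qed

lemma bdd_wavg [simp]: "bdd x \<Longrightarrow> bdd (\<lambda>j. wavg w (M j) x)"
  unfolding bdd_def using wavg_bound by meson

lemma quotient_null: "(\<lambda>j. c / (\<Sum>n=1..M j. w n)) \<longlonglongrightarrow> 0"
  by (rule tendsto_divide_0[OF tendsto_const])
    (rule filterlim_at_top_imp_at_infinity[OF filterlim_compose[OF w_div M_div]])

text \<open>A bounded difference of numerators is lost against the divergent total weight.\<close>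

lemma wmean_eqI:
  assumes "bdd x" "bdd y"
    and "\<And>N. \<bar>(\<Sum>n=1..N. w n * x n) - (\<Sum>n=1..N. w n * y n)\<bar> \<le> c"
  shows "wmean w M x = wmean w M y"
  unfolding wmean_def
proof (rule glim_diff_eqI)
  show "(\<lambda>j. wavg w (M j) x - wavg w (M j) y) \<longlonglongrightarrow> 0"
  proof (rule Lim_null_comparison[OF _ quotient_null[of c]], rule always_eventually, rule allI)
    fix j
    have W: "0 \<le> (\<Sum>n=1..M j. w n)" by (simp add: sum_nonneg w_nonneg)
    show "norm (wavg w (M j) x - wavg w (M j) y) \<le> c / (\<Sum>n=1..M j. w n)"
      unfolding wavg_def diff_divide_distrib[symmetric] real_norm_def abs_divide abs_of_nonneg[OF W]
      by (rule divide_right_mono[OF assms(3) W])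
  qed
qed (use assms in auto)

lemma shift_bound:
  assumes B: "\<And>n. \<bar>x n\<bar> \<le> B"
  shows "\<bar>(\<Sum>n=1..N. w n * x (Suc n)) - (\<Sum>n=1..N. w n * x n)\<bar> \<le> 2 * B * w 1"
proof -
  have B0: "0 \<le> B" using B[of 0] by simp
  \<comment> \<open>With the boundary term removed, each induction step adds exactly
    \<open>(w N - w (Suc N)) * x (Suc N)\<close>, so the bound telescopes.\<close>
  have "\<bar>(\<Sum>n=1..N. w n * x (Suc n)) - (\<Sum>n=1..N. w n * x n) - w N * x (Suc N)\<bar> \<le> B * (2 * w 1 - w N)" if "N \<ge> 1"
    using that
  proof (induction N rule: dec_induct)
    case base
    show ?case using mult_left_mono[OF B[of 1] w_nonneg[of 1]]
      by (simp add: abs_mult w_nonneg mult.commute)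
  next
    case (step N)
    have "\<bar>(w N - w (Suc N)) * x (Suc N)\<bar> \<le> (w N - w (Suc N)) * B"
      using w_decr[of N] step.hyps B by (simp add: abs_mult mult_left_mono)
    with step.IH show ?case by (simp add: algebra_simps)
  qed
  moreover have "\<bar>w N * x (Suc N)\<bar> \<le> B * w N"
    using mult_left_mono[OF B[of "Suc N"] w_nonneg[of N]] by (simp add: abs_mult w_nonneg mult.commute)
  ultimately show ?thesis using B0 w_nonneg[of 1] 
    by (cases "N \<ge> 1") (auto simp: algebra_simps)
qed

sublocale mean "wmean w M"
proof
  fix x y :: "nat \<Rightarrow> real" and c :: real
  assume x: "bdd x"
  have lim: "((\<lambda>j. wavg w (M j) z) \<longlongrightarrow> wmean w M z) ultra" if "bdd z" for z
    unfolding wmean_def using that by (intro tendsto_glim) simp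
  show "wmean w M (\<lambda>n. c * x n) = c * wmean w M x"
  proof -
    have "(\<lambda>j. wavg w (M j) (\<lambda>n. c * x n)) = (\<lambda>j. c * wavg w (M j) x)"
      by (simp add: wavg_def sum_distrib_left mult.left_commute)
    then show ?thesis
      using tendsto_mult_left[OF lim[OF x], of c] by (simp add: wmean_def glim_eqI)
  qed
  show "wmean w M (\<lambda>n. x (Suc n)) = wmean w M x"
  proof -
    obtain B where "\<And>n. \<bar>x n\<bar> \<le> B" using x by (auto simp: bdd_def)
    then show ?thesis
      using x by (intro wmean_eqI[where c = "2 * B * w 1"] shift_bound bdd_comp[OF x])
  qed
  assume y: "bdd y"
  show "wmean w M (\<lambda>n. x n + y n) = wmean w M x + wmean w M y"
  proof -
    have "(\<lambda>j. wavg w (M j) (\<lambda>n. x n + y n)) = (\<lambda>j. wavg w (M j) x + wavg w (M j) y)"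
      by (simp add: wavg_def sum.distrib distrib_left add_divide_distrib)
    then show ?thesis
      using tendsto_add[OF lim[OF x] lim[OF y]] by (simp add: wmean_def glim_eqI)
  qed
  assume "\<And>n. x n \<le> y n"
  then have "wavg w N x \<le> wavg w N y" for N
    by (auto simp: wavg_def intro!: divide_right_mono sum_mono mult_left_mono sum_nonneg w_nonneg)
  then show "wmean w M x \<le> wmean w M y"
    unfolding wmean_def using x y by (intro glim_le always_eventually allI bdd_wavg)
next
  have "filterlim (\<lambda>j. \<Sum>n=1..M j. w n) at_top sequentially"
    by (rule filterlim_compose[OF w_div M_div])
  then have "eventually (\<lambda>j. (\<Sum>n=1..M j. w n) > 0) sequentially"
    by (simp add: filterlim_at_top_dense)
  then have "(\<lambda>j. wavg w (M j) (\<lambda>_. 1)) \<longlonglongrightarrow> 1"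
    by (intro tendsto_eventually) (auto elim!: eventually_mono simp: wavg_def)
  then show "wmean w M (\<lambda>_. 1) = 1" unfolding wmean_def by (rule glim_tendsto)
qed

text \<open>A bound for almost all \<open>N\<close> holds along \<open>M j\<close> too. Read
  backwards, a mean above \<open>c\<close> forces a limit superior of at least
  \<open>c\<close>.\<close>

lemma wmean_le:
  assumes "bdd x" "eventually (\<lambda>N. wavg w N x \<le> c) sequentially"
  shows "wmean w M x \<le> c"
proof -
  have "eventually (\<lambda>j. wavg w (M j) x \<le> c) sequentially"
    using eventually_compose_filterlim[OF assms(2) M_div] .
  then have "wmean w M x \<le> glim (\<lambda>_::nat. c)"
    unfolding wmean_def using assms(1) by (intro glim_le) auto
  then show ?thesis by (simp add: glim_tendsto[OF tendsto_const])
qed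

end

lemma harmonic_at_top: "filterlim (\<lambda>N. \<Sum>n=1..N. 1 / real n) at_top sequentially"
proof -
  have "(\<lambda>N. \<Sum>n=1..N. 1 / real n) = harm"
    by (simp add: fun_eq_iff harm_def inverse_eq_divide)
  then show ?thesis using harm_at_top by metis
qed

interpretation logmean: weight "\<lambda>n. 1 / real n" "\<lambda>j. j"
proof
  show "filterlim (\<lambda>N. \<Sum>n=1..N. 1 / real n) at_top sequentially"
    by (rule harmonic_at_top)
  show "filterlim (\<lambda>j. j) sequentially sequentially"
    by (rule filterlim_ident)
qed (auto simp: frac_le)

abbreviation logmean :: "(nat \<Rightarrow> real) \<Rightarrow> real" where
  "logmean \<equiv> wmean (\<lambda>n. 1 / real n) (\<lambda>j. j)"

text \<open>For dilation, write the multiples of \<open>p\<close> up to \<open>N\<close> as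
  \<open>p * k\<close> with \<open>k \<le> N div p\<close>. The terms with
  \<open>N div p < n \<le> N\<close> are missing; each is at most \<open>B / N\<close> because
  \<open>N < n * p\<close>, and there are at most \<open>N\<close> of them.\<close>

interpretation logmean: log_mean logmean
proof
  fix x y :: "nat \<Rightarrow> real" and p :: nat
  show "logmean x = logmean y" if "\<And>n. n \<ge> 1 \<Longrightarrow> x n = y n"
    using that by (simp add: wmean_def wavg_def)
  assume x: "bdd x" and p: "p \<ge> 1"
  obtain B where B: "\<And>n. \<bar>x n\<bar> \<le> B" using x by (auto simp: bdd_def)
  have B0: "0 \<le> B" using B[of 0] by simp
  have "\<bar>(\<Sum>n=1..N. 1 / real n * (of_bool (p dvd n) * x n)) -
         (\<Sum>n=1..N. 1 / real n * (x (p * n) / real p))\<bar> \<le> B" for N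
  proof -
    let ?g = "\<lambda>n. 1 / real n * (x (p * n) / real p)"
    have "(\<Sum>n=1..N. 1 / real n * (of_bool (p dvd n) * x n)) =
          (\<Sum>n\<in>{n\<in>{1..N}. p dvd n}. 1 / real n * x n)"
      by (rule sum.mono_neutral_cong_right) auto
    also have "\<dots> = (\<Sum>k=1..N div p. ?g k)"
    proof (rule sum.reindex_bij_witness[of _ "\<lambda>k. p * k" "\<lambda>n. n div p"])
      show "p * k \<in> {n \<in> {1..N}. p dvd n}" if "k \<in> {1..N div p}" for k
      proof -
        have "p * k \<le> p * (N div p)" using that by simp
        also have "\<dots> \<le> N" by simp
        finally show ?thesis using that p by auto
      qed
    qed (use p in \<open>auto elim!: dvdE intro: div_le_mono simp: Suc_le_eq\<close>)
    finally have eq: "(\<Sum>n=1..N. 1 / real n * (of_bool (p dvd n) * x n)) = (\<Sum>k=1..N div p. ?g k)" .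
    have "{1..N} = {1..N div p} \<union> {N div p<..N}"
      using div_le_dividend[of N p] by (auto simp del: div_le_dividend)
    moreover have dj: "{1..N div p} \<inter> {N div p<..N} = {}" by auto
    ultimately have "sum ?g {1..N} = (\<Sum>k=1..N div p. ?g k) + sum ?g {N div p<..N}"
      by (simp add: sum.union_disjoint)
    then have "\<bar>(\<Sum>n=1..N. 1 / real n * (of_bool (p dvd n) * x n)) - sum ?g {1..N}\<bar>
        = \<bar>sum ?g {N div p<..N}\<bar>" using eq by simp
    also have "\<dots> \<le> (\<Sum>n\<in>{N div p<..N}. B / real N)"
    proof (intro order_trans[OF sum_abs] sum_mono)
      fix n assume n: "n \<in> {N div p<..N}"
      then have "N < n * p" using p by (simp add: div_less_iff_less_mult)
      then have "real N \<le> real n * real p" by (metis less_imp_le of_nat_le_iff of_nat_mult)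
      moreover have "N > 0" using n by simp
      ultimately have "\<bar>x (p * n)\<bar> / (real n * real p) \<le> B / real N"
        by (intro frac_le B B0 abs_ge_zero) auto
      then show "\<bar>?g n\<bar> \<le> B / real N" by (simp add: abs_mult abs_divide)
    qed
    also have "\<dots> = real (N - N div p) * (B / real N)" by simp
    also have "\<dots> \<le> B"
    proof (cases "N = 0")
      case False
      have "real (N - N div p) * (B / real N) \<le> real N * (B / real N)"
        using B0 by (intro mult_right_mono) auto
      with False show ?thesis by simp
    qed (simp add: B0)
    finally show ?thesis .
  qed
  moreover have xp: "bdd (\<lambda>n. x (p * n))" by (rule bdd_comp[OF x])
  ultimately have "logmean (\<lambda>n. of_bool (p dvd n) * x n) = logmean (\<lambda>n. x (p * n) / real p)"
    using x by (intro logmean.wmean_eqI[where c = B]) simp_all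
  also have "\<dots> = logmean (\<lambda>n. x (p * n)) / real p"
    by (rule logmean.divide[OF xp])
  finally show "logmean (\<lambda>n. of_bool (p dvd n) * x n) = logmean (\<lambda>n. x (p * n)) / real p" .
qed

text \<open>Abel summation writes the logarithmic sum as a nonnegative combination of the partial
  sums \<open>C n\<close>. These are nonpositive from some point on, and the finitely many others
  contribute a constant, negligible against the harmonic sum.\<close>

lemma logmean_le_cesaro:
  assumes a: "bdd a" and ev: "eventually (\<lambda>N. (\<Sum>n=1..N. a n) / real N \<le> c) sequentially"
  shows "logmean a \<le> c"
proof -
  define x where "x = (\<lambda>n. a n - c)"
  define C where "C = (\<lambda>N. \<Sum>n=1..N. x n)"
  have bx: "bdd x" unfolding x_def using a by simp
  obtain n0 where n0: "\<And>N. N \<ge> n0 \<Longrightarrow> (\<Sum>n=1..N. a n) / real N \<le> c"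
    using ev by (auto simp: eventually_sequentially)
  have C: "C N \<le> 0" if "N > n0" for N
    using n0[of N] that by (simp add: C_def x_def sum_subtractf divide_le_eq mult.commute)
  have abel: "(\<Sum>n=1..N. 1 / real n * x n) = (\<Sum>n=1..N. C n / (real n * real (Suc n))) + C N / real (Suc N)" for N
  proof (induction N)
    case (Suc N)
    have "C N / real (Suc N) + x (Suc N) / real (Suc N) = C (Suc N) / real (Suc N)"
      by (simp add: C_def add_divide_distrib)
    also have "\<dots> = C (Suc N) / (real (Suc N) * real (Suc (Suc N))) + C (Suc N) / real (Suc (Suc N))"
    proof -
      have "y / m = y / (m * (m + 1)) + y / (m + 1)" if "m > 0" for y m :: real
        using that by (simp add: divide_simps) (simp add: algebra_simps)
      from this[of "real (Suc N)" "C (Suc N)"] show ?thesis by (simp add: add.commute)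
    qed
    finally show ?case using Suc by simp
  qed (simp add: C_def)
  define K where "K = (\<Sum>n=1..n0. \<bar>C n\<bar>)"
  have bound: "(\<Sum>n=1..N. 1 / real n * x n) \<le> K" if N: "N > n0" for N
  proof -
    have "(\<Sum>n=1..N. C n / (real n * real (Suc n))) \<le> (\<Sum>n=1..N. if n \<le> n0 then \<bar>C n\<bar> else 0)"
    proof (intro sum_mono)
      fix n assume n: "n \<in> {1..N}"
      have "C n / (real n * real (Suc n)) \<le> 0" if "n > n0"
        using C[OF that] by (intro divide_nonpos_nonneg) auto
      moreover have "C n / (real n * real (Suc n)) \<le> \<bar>C n\<bar>"
      proof -
        have "1 * 1 \<le> real n * real (Suc n)" using n by (intro mult_mono) auto
        then have "\<bar>C n\<bar> * 1 \<le> \<bar>C n\<bar> * (real n * real (Suc n))" by (intro mult_left_mono) auto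
        then have "C n \<le> \<bar>C n\<bar> * (real n * real (Suc n))" by linarith
        moreover have "0 < real n * real (Suc n)" using n by simp
        ultimately show ?thesis by (subst pos_divide_le_eq)
      qed
      ultimately show "C n / (real n * real (Suc n)) \<le> (if n \<le> n0 then \<bar>C n\<bar> else 0)" by auto
    qed
    also have "\<dots> = K"
      unfolding K_def using N by (intro sum.mono_neutral_cong_right) auto
    finally have "(\<Sum>n=1..N. C n / (real n * real (Suc n))) \<le> K" .
    moreover have "C N / real (Suc N) \<le> 0" using C[OF N] by (simp add: divide_nonpos_nonneg)
    ultimately show ?thesis unfolding abel by linarith
  qed
  have "logmean x \<le> 0 + e" if "e > 0" for e
  proof (simp, rule logmean.wmean_le[OF bx])
    have "eventually (\<lambda>N. K / (\<Sum>n=1..N. 1 / real n) < e) sequentially"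
      using logmean.quotient_null[of K] that by (auto simp: order_tendsto_iff)
    then show "eventually (\<lambda>N. wavg (\<lambda>n. 1 / real n) N x \<le> e) sequentially"
      using eventually_gt_at_top[of n0]
    proof eventually_elim
      case (elim N)
      have "wavg (\<lambda>n. 1 / real n) N x \<le> K / (\<Sum>n=1..N. 1 / real n)"
        unfolding wavg_def using bound[OF elim(2)] by (intro divide_right_mono sum_nonneg) auto
      then show ?case using elim(1) by linarith
    qed
  qed
  then have "logmean x \<le> 0" by (rule field_le_epsilon)
  moreover have "logmean x = logmean a - c" unfolding x_def using a by (subst logmean.diff) auto
  ultimately show ?thesis by simp
qed

section \<open>Mertens estimates\<close>

text \<open>Summation of a Dirichlet convolution, through the bijection
  \<open>n = d * k\<close>.\<close>

lemma sum_divisors_swap: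
  fixes F :: "nat \<Rightarrow> nat \<Rightarrow> 'a::comm_monoid_add"
  shows "(\<Sum>n=1..N. \<Sum>d | d dvd n. F d (n div d)) = (\<Sum>d=1..N. \<Sum>k=1..N div d. F d k)"
proof -
  have "(\<Sum>n=1..N. \<Sum>d | d dvd n. F d (n div d)) =
      (\<Sum>(n, d)\<in>Sigma {1..N} (\<lambda>n. {d. d dvd n}). F d (n div d))"
    by (rule sum.Sigma) (auto simp: Suc_le_eq)
  also have "\<dots> = (\<Sum>(d, k)\<in>Sigma {1..N} (\<lambda>d. {1..N div d}). F d k)"
  proof (rule sum.reindex_bij_witness[of _ "\<lambda>(d, k). (d * k, d)" "\<lambda>(n, d). (d, n div d)"])
    fix x assume x: "x \<in> Sigma {1..N} (\<lambda>n. {d. d dvd n})"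
    obtain n d where nd: "x = (n, d)" by (cases x)
    have h: "1 \<le> n" "n \<le> N" "d dvd n" using x nd by auto
    then have "d > 0" "d \<le> n" by (auto dest: dvd_imp_le intro: Nat.gr0I)
    moreover have "n div d \<le> N div d" by (intro div_le_mono h)
    moreover have "1 \<le> n div d" using \<open>d > 0\<close> \<open>d \<le> n\<close> by (simp add: Suc_le_eq div_greater_zero_iff)
    ultimately show "(case x of (n, d) \<Rightarrow> (d, n div d)) \<in> Sigma {1..N} (\<lambda>d. {1..N div d})"
      using h nd by auto
    show "(case (case x of (n, d) \<Rightarrow> (d, n div d)) of (d, k) \<Rightarrow> (d * k, d)) = x"
      using h nd by auto
    show "(case (case x of (n, d) \<Rightarrow> (d, n div d)) of (d, k) \<Rightarrow> F d k) = (case x of (n, d) \<Rightarrow> F d (n div d))"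
      using nd by simp
  next
    fix x assume x: "x \<in> Sigma {1..N} (\<lambda>d. {1..N div d})"
    obtain d k where dk: "x = (d, k)" by (cases x)
    have h: "1 \<le> d" "1 \<le> k" "k \<le> N div d" using x dk by auto
    have "d * k \<le> d * (N div d)" using h(3) by simp
    also have "\<dots> \<le> N" by simp
    finally show "(case x of (d, k) \<Rightarrow> (d * k, d)) \<in> Sigma {1..N} (\<lambda>n. {d. d dvd n})"
      using h dk by auto
    show "(case (case x of (d, k) \<Rightarrow> (d * k, d)) of (n, d) \<Rightarrow> (d, n div d)) = x"
      using h dk by auto
  qed
  also have "\<dots> = (\<Sum>d=1..N. \<Sum>k=1..N div d. F d k)"
    by (rule sum.Sigma[symmetric]) auto
  finally show ?thesis .
qed

abbreviation vm :: "nat \<Rightarrow> real" where "vm \<equiv> mangoldt"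

text \<open>Legendre's formula, the link between factorials and sums over prime powers.\<close>

lemma ln_fact_eq: "ln (fact N :: real) = (\<Sum>d=1..N. vm d * real (N div d))"
proof -
  have "ln (fact N :: real) = (\<Sum>n=1..N. ln (real n))"
    unfolding fact_prod of_nat_prod by (rule ln_prod) auto
  also have "\<dots> = (\<Sum>n=1..N. \<Sum>d | d dvd n. vm d)"
    by (intro sum.cong refl) (simp add: mangoldt_sum)
  also have "\<dots> = (\<Sum>d=1..N. \<Sum>k=1..N div d. vm d)"
    by (rule sum_divisors_swap)
  finally show ?thesis by (simp add: mult.commute)
qed

text \<open>Crude Stirling: from \<open>N\<close> to \<open>Suc N\<close> the function
  \<open>N * ln N\<close> grows by \<open>ln (Suc N)\<close> plus an amount between 0 and 1.\<close>

lemma ln_fact_bounds: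
  assumes "N \<ge> 1"
  shows "real N * ln (real N) - real N \<le> ln (fact N :: real)" "ln (fact N :: real) \<le> real N * ln (real N)"
proof -
  have "real N * ln (real N) - real N \<le> ln (fact N :: real) \<and> ln (fact N :: real) \<le> real N * ln (real N)"
    using assms
  proof (induction N rule: dec_induct)
    case (step N)
    have N: "real N > 0" using step.hyps by simp
    have "real (Suc N) = real N * (1 + 1 / real N)" using N by (simp add: field_simps)
    then have "ln (real (Suc N)) = ln (real N) + ln (1 + 1 / real N)"
      using N by (simp only:) (rule ln_mult_pos, auto intro: add_pos_nonneg)
    also have "\<dots> \<le> ln (real N) + 1 / real N"
      using N by (intro add_left_mono ln_add_one_self_le_self) simp
    finally have "real N * (ln (real (Suc N)) - ln (real N)) \<le> real N * (1 / real N)"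
      by (intro mult_left_mono) auto
    then have le: "real N * ln (real (Suc N)) \<le> real N * ln (real N) + 1"
      using N by (simp add: algebra_simps)
    have ge: "real N * ln (real N) \<le> real N * ln (real (Suc N))"
      using N by (intro mult_left_mono) auto
    have f: "ln (fact (Suc N) :: real) = ln (real (Suc N)) + ln (fact N)"
      by (simp add: ln_mult fact_Suc del: of_nat_Suc)
    have e: "real (Suc N) * ln (real (Suc N)) = real N * ln (real (Suc N)) + ln (real (Suc N))"
      by (simp add: algebra_simps)
    show ?case unfolding f e using step.IH le ge by simp
  qed simp
  then show "real N * ln (real N) - real N \<le> ln (fact N :: real)" "ln (fact N :: real) \<le> real N * ln (real N)"
    by auto
qed

text \<open>Chebyshev's argument: Legendre's formula for the logarithm of the central binomial
  coefficient has nonnegative coefficients, at least 1 for \<open>n < d\<close>, while that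
  coefficient is at most \<open>2 ^ (2 * n)\<close>.\<close>

lemma mangoldt_sum_double: "(\<Sum>d=1..2*n. vm d) \<le> (\<Sum>d=1..n. vm d) + 2 * real n"
proof -
  have coeff: "of_bool (n < d) \<le> real (2 * n div d) - 2 * real (n div d)" if "d \<in> {1..2*n}" for d
  proof -
    have "2 * (n div d) \<le> 2 * n div d"
    proof -
      have "(2 * (n div d)) * d \<le> 2 * n" by (metis div_times_less_eq_dividend mult.assoc mult_le_mono2)
      then show ?thesis using that by (simp add: less_eq_div_iff_mult_less_eq)
    qed
    then have "2 * real (n div d) \<le> real (2 * n div d)" by linarith
    moreover have "1 \<le> 2 * n div d" "n div d = 0" if "n < d"
      using that \<open>d \<in> {1..2*n}\<close> by (auto simp: Suc_le_eq div_greater_zero_iff)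
    ultimately show ?thesis by auto
  qed
  have "(\<Sum>d=1..2*n. vm d) - (\<Sum>d=1..n. vm d) = (\<Sum>d=1..2*n. vm d * of_bool (n < d))"
  proof -
    have "(\<Sum>d=1..2*n. vm d) = (\<Sum>d=1..2*n. vm d * of_bool (n < d)) + (\<Sum>d=1..2*n. vm d * of_bool (d \<le> n))"
      by (subst sum.distrib[symmetric]) (auto intro!: sum.cong)
    moreover have "(\<Sum>d=1..2*n. vm d * of_bool (d \<le> n)) = (\<Sum>d=1..n. vm d)"
      by (rule sum.mono_neutral_cong_right) auto
    ultimately show ?thesis by simp
  qed
  also have "\<dots> \<le> (\<Sum>d=1..2*n. vm d * (real (2 * n div d) - 2 * real (n div d)))"
    by (intro sum_mono mult_left_mono coeff mangoldt_nonneg)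
  also have "\<dots> = ln (fact (2 * n)) - 2 * (\<Sum>d=1..2*n. vm d * real (n div d))"
    by (simp add: ln_fact_eq sum_subtractf sum_distrib_left algebra_simps)
  also have "(\<Sum>d=1..2*n. vm d * real (n div d)) = (\<Sum>d=1..n. vm d * real (n div d))"
    by (rule sum.mono_neutral_right) auto
  also have "ln (fact (2 * n)) - 2 * (\<Sum>d=1..n. vm d * real (n div d)) = ln (real (2 * n choose n))"
    using binomial_fact[of n "2 * n", where ?'a = real]
    unfolding ln_fact_eq[symmetric] by (simp add: ln_div ln_mult)
  also have "\<dots> \<le> ln (2 ^ (2 * n))"
    using binomial_le_pow2[of "2 * n" n]
    by (subst ln_le_cancel_iff) (auto simp: of_nat_le_iff[of _ "2 ^ (2 * n)", where ?'a = real, simplified] simp del: of_nat_le_iff)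
  also have "\<dots> = 2 * real n * ln 2" by (simp add: ln_realpow)
  also have "\<dots> \<le> 2 * real n * 1" using ln_2_less_1 by (intro mult_left_mono) auto
  finally show ?thesis by simp
qed

text \<open>Halving with rounding up gives the bound \<open>6 * n\<close> with
  \<open>n = (N + 1) div 2\<close>; the constant 4 leaves enough room for the rounding from
  \<open>N = 2\<close> on.\<close>

lemma chebyshev: "(\<Sum>d=1..N. vm d) \<le> 4 * real N"
proof (induction N rule: less_induct)
  case (less N)
  define n where "n = (N + 1) div 2"
  show ?case
  proof (cases "N \<le> 1")
    case True
    then show ?thesis by (cases N) auto
  next
    case False
    then have n: "n < N" "N \<le> 2 * n" "2 * n \<le> N + 1" by (auto simp: n_def)
    have "(\<Sum>d=1..N. vm d) \<le> (\<Sum>d=1..2*n. vm d)"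
      using n by (intro sum_mono2) (auto simp: mangoldt_nonneg)
    also have "\<dots> \<le> 4 * real n + 2 * real n" using mangoldt_sum_double[of n] less[OF n(1)] by simp
    also have "\<dots> = real (6 * n)" by simp
    also have "6 * n \<le> 4 * N" using n(3) False by arith
    then have "real (6 * n) \<le> 4 * real N" by linarith
    finally show ?thesis .
  qed
qed

text \<open>Replacing \<open>N div d\<close> by \<open>N / d\<close> in Legendre's formula costs
  between 0 and \<open>vm d\<close>. By \<open>chebyshev\<close> this is at most
  \<open>4 * N\<close> in total, which after division by \<open>N\<close> is the constant 4.\<close>

lemma mertens:
  assumes "N \<ge> 1" shows "\<bar>(\<Sum>d=1..N. vm d / real d) - ln (real N)\<bar> \<le> 4"
proof -
  have N: "real N > 0" using assms by simp
  have "ln (fact N) \<le> (\<Sum>d=1..N. vm d * (real N / real d))"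
    unfolding ln_fact_eq by (intro sum_mono mult_left_mono of_nat_div_le_of_nat mangoldt_nonneg)
  also have "\<dots> = real N * (\<Sum>d=1..N. vm d / real d)" by (simp add: sum_distrib_left mult_ac)
  finally have "real N * ln (real N) - real N \<le> real N * (\<Sum>d=1..N. vm d / real d)"
    using ln_fact_bounds(1)[OF assms] by simp
  then have "real N * (ln (real N) - 1) \<le> real N * (\<Sum>d=1..N. vm d / real d)"
    by (simp add: algebra_simps)
  then have 1: "ln (real N) - 1 \<le> (\<Sum>d=1..N. vm d / real d)" using N by simp
  have "real N * (\<Sum>d=1..N. vm d / real d) - (\<Sum>d=1..N. vm d) = (\<Sum>d=1..N. vm d * (real N / real d - 1))"
    by (simp add: sum_distrib_left sum_subtractf algebra_simps)
  also have "\<dots> \<le> ln (fact N)"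
    unfolding ln_fact_eq
  proof (intro sum_mono mult_left_mono mangoldt_nonneg)
    fix d show "real N / real d - 1 \<le> real (N div d)"
      using floor_divide_of_nat_eq[of N d, where ?'a = real] by linarith
  qed
  finally have "real N * (\<Sum>d=1..N. vm d / real d) \<le> real N * (ln (real N) + 4)"
    using ln_fact_bounds(2)[OF assms] chebyshev[of N] by (simp add: algebra_simps)
  then have "(\<Sum>d=1..N. vm d / real d) \<le> ln (real N) + 4" using N by simp
  with 1 show ?thesis by linarith
qed

section \<open>The Moebius function\<close>

definition mu :: "nat \<Rightarrow> real" where
  "mu n = (if squarefree n then (-1) ^ card (prime_factors n) else 0)"

lemma abs_mu_le: "\<bar>mu n\<bar> \<le> 1"
  by (simp add: mu_def)

lemma mu_prime_mult:
  assumes "prime p" "\<not> p dvd d" "d > 0" shows "mu (p * d) = - mu d"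
proof -
  have cop: "coprime p d" using assms by (simp add: prime_imp_coprime)
  have "squarefree (p * d) \<longleftrightarrow> squarefree d"
    using squarefree_mult_coprime[OF cop squarefree_prime[OF assms(1)]] squarefree_multD(2)[of p d] by blast
  moreover have "prime_factors (p * d) = insert p (prime_factors d)"
    using assms by (subst prime_factors_product) (auto simp: prime_prime_factors)
  moreover have "p \<notin> prime_factors d" using assms by auto
  ultimately show ?thesis by (simp add: mu_def)
qed

text \<open>For a prime factor \<open>p\<close> of \<open>n\<close>, the divisors not divisible by
  \<open>p\<close> cancel against their multiples by \<open>p\<close>; the remaining divisors are
  divisible by \<open>p ^ 2\<close>.\<close>

lemma sum_mu:
  assumes "n \<ge> 1" shows "(\<Sum>d | d dvd n. mu d) = of_bool (n = 1)"
proof (cases "n = 1")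
  case True
  then show ?thesis by (simp add: mu_def)
next
  case False
  then obtain p where p: "prime p" "p dvd n" using prime_factor_nat by blast
  define A where "A = {d. d dvd n \<and> \<not> p dvd d}"
  define B where "B = {d. d dvd n \<and> p dvd d}"
  have fin: "finite {d. d dvd n}" using assms by simp
  have "(\<Sum>d | d dvd n. mu d) = sum mu A + sum mu B"
    using fin by (subst sum.union_disjoint[symmetric]) (auto simp: A_def B_def intro!: sum.cong)
  also have "sum mu B = sum mu ((\<lambda>d. p * d) ` A)"
  proof (rule sum.mono_neutral_right)
    show "finite B" using fin by (simp add: B_def)
    show "(\<lambda>d. p * d) ` A \<subseteq> B"
      using p by (auto simp: A_def B_def intro!: divides_mult prime_imp_coprime)
    show "\<forall>i\<in>B - (\<lambda>d. p * d) ` A. mu i = 0"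
    proof
      fix i assume i: "i \<in> B - (\<lambda>d. p * d) ` A"
      then obtain k where k: "i = p * k" by (auto simp: B_def)
      have "k dvd n" using i k by (auto simp: B_def intro: dvd_mult_right)
      then have "p dvd k" using i k by (auto simp: A_def)
      then have "p ^ 2 dvd i" using k by (auto simp: power2_eq_square)
      then have "\<not> squarefree i" using p(1) not_prime_unit squarefreeD by blast
      then show "mu i = 0" by (simp add: mu_def)
    qed
  qed
  also have "\<dots> = (\<Sum>d\<in>A. mu (p * d))"
    using p(1) by (subst sum.reindex) (auto simp: inj_on_def)
  also have "\<dots> = (\<Sum>d\<in>A. - mu d)"
  proof (intro sum.cong refl mu_prime_mult p)
    fix d assume "d \<in> A"
    then show "\<not> p dvd d" "d > 0" using assms by (auto simp: A_def intro: Nat.gr0I)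
  qed
  also have "sum mu A + \<dots> = 0" by (simp add: sum_negf)
  finally show ?thesis using False by simp
qed

text \<open>Moebius inversion: expand \<open>ln\<close> into \<open>vm\<close>, exchange the divisor
  sums, and \<open>sum_mu\<close> leaves only the divisor \<open>n\<close> itself. It serves the
  case \<open>L1 = 0\<close>, where dividing by \<open>L1\<close> is impossible.\<close>

lemma sum_mu_ln_div:
  assumes "n \<ge> 1" shows "(\<Sum>d | d dvd n. mu d * ln (real (n div d))) = vm n"
proof -
  have pos: "n div d \<noteq> 0" "d \<noteq> 0" if "d dvd n" for d using that assms by (auto elim!: dvdE)
  have "(\<Sum>d | d dvd n. mu d * ln (real (n div d))) = (\<Sum>d | d dvd n. \<Sum>e | e dvd n div d. mu d * vm e)"
  proof (intro sum.cong refl)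
    fix d assume "d \<in> {d. d dvd n}"
    then have "ln (real (n div d)) = (\<Sum>e | e dvd n div d. vm e)"
      using pos[of d] by (subst mangoldt_sum) auto
    then show "mu d * ln (real (n div d)) = (\<Sum>e | e dvd n div d. mu d * vm e)"
      by (simp add: sum_distrib_left)
  qed
  also have "\<dots> = (\<Sum>(d, e)\<in>Sigma {d. d dvd n} (\<lambda>d. {e. e dvd n div d}). mu d * vm e)"
    using pos assms by (intro sum.Sigma) auto
  also have "\<dots> = (\<Sum>(e, d)\<in>Sigma {e. e dvd n} (\<lambda>e. {d. d dvd n div e}). mu d * vm e)"
  proof (rule sum.reindex_bij_witness[of _ "\<lambda>(e, d). (d, e)" "\<lambda>(d, e). (e, d)"])
    have sw: "e dvd n \<and> d dvd n div e" if "d dvd n" "e dvd n div d" for d e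
    proof -
      have "d * e dvd n" using that pos[of d] by (metis dvd_div_iff_mult mult.commute)
      then have "e dvd n" by (rule dvd_mult_right)
      then show ?thesis using \<open>d * e dvd n\<close> pos[of e] by (simp add: dvd_div_iff_mult)
    qed
    show "(case x of (d, e) \<Rightarrow> (e, d)) \<in> Sigma {e. e dvd n} (\<lambda>e. {d. d dvd n div e})"
      if "x \<in> Sigma {d. d dvd n} (\<lambda>d. {e. e dvd n div d})" for x using that sw by auto
    show "(case x of (e, d) \<Rightarrow> (d, e)) \<in> Sigma {d. d dvd n} (\<lambda>d. {e. e dvd n div d})"
      if "x \<in> Sigma {e. e dvd n} (\<lambda>e. {d. d dvd n div e})" for x using that sw by auto
  qed auto
  also have "\<dots> = (\<Sum>e | e dvd n. \<Sum>d | d dvd n div e. mu d * vm e)"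
    using pos assms by (intro sum.Sigma[symmetric]) auto
  also have "\<dots> = (\<Sum>e | e dvd n. of_bool (n div e = 1) * vm e)"
    using pos by (intro sum.cong refl) (auto simp: sum_distrib_right[symmetric] sum_mu Suc_le_eq)
  also have "\<dots> = (\<Sum>e\<in>{n}. vm e)"
    using assms by (intro sum.mono_neutral_cong_right) (auto elim!: dvdE)
  finally show ?thesis by simp
qed

text \<open>The base may run over all integers from 2 on: the geometric series from exponent 2 is at
  most \<open>1 / (p - 1) - 1 / p\<close>, and this telescopes to at most 1.\<close>

lemma sum_nontrivial_prime_powers:
  assumes "finite Z" "\<And>n. n \<in> Z \<Longrightarrow> primepow n \<and> \<not> prime n"
  shows "(\<Sum>n\<in>Z. 1 / real n) \<le> 1"
proof -
  define M where "M = Max (insert 2 Z)"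
  have M: "n \<le> M" if "n \<in> Z" for n using that assms(1) by (simp add: M_def)
  have M2: "2 \<le> M" using assms(1) by (simp add: M_def)
  have "Z \<subseteq> (\<lambda>(p, k). p ^ k) ` ({2..M} \<times> {2..M})"
  proof
    fix n assume n: "n \<in> Z"
    obtain p k where pk: "prime p" "k > 0" "n = p ^ k"
      using assms(2)[OF n] by (auto simp: primepow_def)
    have "k \<noteq> 1" using assms(2)[OF n] pk by auto
    then have k: "k \<ge> 2" using pk by simp
    have p: "p \<ge> 2" using prime_ge_2_nat pk by blast
    have "p \<le> p ^ k" using p pk(2) self_le_power[of p k] by simp
    moreover have "k < p ^ k" using p less_exp[of k] power_mono[of 2 p k] by linarith
    ultimately have "p \<in> {2..M}" "k \<in> {2..M}" using M[OF n] pk p k by auto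
    then show "n \<in> (\<lambda>(p, k). p ^ k) ` ({2..M} \<times> {2..M})" using pk by auto
  qed
  then have "(\<Sum>n\<in>Z. 1 / real n) \<le> (\<Sum>n\<in>(\<lambda>(p, k). p ^ k) ` ({2..M} \<times> {2..M}). 1 / real n)"
    by (intro sum_mono2) auto
  also have "\<dots> \<le> (\<Sum>x\<in>{2..M} \<times> {2..M}. 1 / real (case x of (p, k) \<Rightarrow> p ^ k))"
    by (rule sum_image_le[where g = "\<lambda>n. 1 / real n", unfolded o_def]) auto
  also have "\<dots> = (\<Sum>p=2..M. \<Sum>k=2..M. (1 / real p) ^ k)"
    by (simp add: sum.cartesian_product power_one_over case_prod_unfold)
  also have "\<dots> \<le> (\<Sum>p=2..M. 1 / real (p - 1) - 1 / real p)"
  proof (intro sum_mono)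
    fix p assume "p \<in> {2..M}"
    then have p: "p \<ge> 2" by simp
    define x where "x = 1 / real p"
    have x: "0 < x" "x < 1" using p by (auto simp: x_def)
    have "(\<Sum>k=2..M. x ^ k) = (x\<^sup>2 - x ^ Suc M) / (1 - x)"
      using x M2 by (simp add: sum_gp)
    also have "\<dots> \<le> x\<^sup>2 / (1 - x)" using x by (intro divide_right_mono) auto
    also have "\<dots> = 1 / real (p - 1) - 1 / real p"
      using p by (simp add: x_def power2_eq_square field_simps of_nat_diff)
    finally show "(\<Sum>k=2..M. (1 / real p) ^ k) \<le> 1 / real (p - 1) - 1 / real p" by (simp add: x_def)
  qed
  also have "\<dots> = 1 - 1 / real M"
    using M2 by (induction M rule: dec_induct) (auto simp: sum.atLeast_Suc_atMost)
  also have "\<dots> \<le> 1" by simp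
  finally show ?thesis .
qed

text \<open>Past some \<open>n0\<close> the reciprocals sum to at most \<open>e\<close>, and there
  \<open>vm n \<le> ln N\<close>; the terms up to \<open>n0\<close> form the constant. So a set with
  convergent reciprocal sum carries a negligible share of the Mertens sum.\<close>

lemma mangoldt_sum_sparse:
  assumes "\<And>Z. finite Z \<Longrightarrow> Z \<subseteq> Y \<Longrightarrow> (\<Sum>n\<in>Z. 1 / real n) \<le> B" and "e > 0"
  shows "\<exists>C. \<forall>N\<ge>1. (\<Sum>n\<in>{1..N} \<inter> Y. vm n / real n) \<le> e * ln (real N) + C"
proof -
  define s where "s = (\<lambda>N. \<Sum>n\<in>{1..N} \<inter> Y. 1 / real n)"
  have "incseq s" unfolding s_def by (intro incseq_SucI sum_mono2) auto
  moreover have "s N \<le> B" for N unfolding s_def by (rule assms(1)) auto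
  ultimately have "Cauchy s" using incseq_convergent[of s B] LIMSEQ_imp_Cauchy by metis
  then obtain n0 where n0: "\<And>m n. m \<ge> n0 \<Longrightarrow> n \<ge> n0 \<Longrightarrow> dist (s m) (s n) < e"
    using assms(2) unfolding Cauchy_def by metis
  have "(\<Sum>n\<in>{1..N} \<inter> Y. vm n / real n) \<le> e * ln (real N) + (\<Sum>n=1..n0. vm n / real n)" if "N \<ge> 1" for N
  proof -
    have tail: "(\<Sum>n\<in>{n0<..N} \<inter> Y. 1 / real n) \<le> e"
    proof (cases "n0 \<le> N")
      case True
      then have "{1..N} \<inter> Y = ({1..n0} \<inter> Y) \<union> ({n0<..N} \<inter> Y)" by auto
      then have "s N = s n0 + (\<Sum>n\<in>{n0<..N} \<inter> Y. 1 / real n)"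
        unfolding s_def by (simp only:) (subst sum.union_disjoint; auto)
      then show ?thesis using n0[of N n0] True by (simp add: dist_real_def)
    qed (use assms(2) in simp)
    have "(\<Sum>n\<in>{1..N} \<inter> Y. vm n / real n) \<le> (\<Sum>n\<in>{1..n0} \<union> ({n0<..N} \<inter> Y). vm n / real n)"
      by (intro sum_mono2) (auto simp: mangoldt_nonneg)
    also have "\<dots> = (\<Sum>n=1..n0. vm n / real n) + (\<Sum>n\<in>{n0<..N} \<inter> Y. vm n / real n)"
      by (intro sum.union_disjoint) auto
    also have "(\<Sum>n\<in>{n0<..N} \<inter> Y. vm n / real n) \<le> (\<Sum>n\<in>{n0<..N} \<inter> Y. ln (real N) * (1 / real n))"
    proof (intro sum_mono)
      fix n assume n: "n \<in> {n0<..N} \<inter> Y"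
      then have "vm n \<le> ln (real n)" by (intro mangoldt_le) auto
      also have "\<dots> \<le> ln (real N)" using n by simp
      finally show "vm n / real n \<le> ln (real N) * (1 / real n)" by (simp add: divide_right_mono)
    qed
    also have "\<dots> \<le> ln (real N) * e"
      unfolding sum_distrib_left[symmetric] using that by (intro mult_left_mono tail) auto
    finally show ?thesis by (simp add: mult.commute)
  qed
  then show ?thesis by blast
qed

lemma ln_unbounded: "\<exists>N\<ge>1. C < ln (real N)"
proof -
  obtain N :: nat where N: "exp (C + 1) < real N" using reals_Archimedean2 by blast
  have "N \<ge> 1" using N by (cases N) auto
  moreover have "ln (exp (C + 1)) < ln (real N)"
    using N \<open>N \<ge> 1\<close> by (subst ln_less_cancel_iff) auto
  ultimately show ?thesis by (intro exI[of _ N]) simp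
qed

text \<open>Otherwise the set of all prime powers would be sparse, and the whole Mertens sum would
  be at most half of \<open>ln N\<close> up to a constant.\<close>

lemma primes_reciprocal_unbounded:
  "\<exists>P. finite P \<and> (\<forall>p\<in>P. prime (p::nat)) \<and> B \<le> (\<Sum>p\<in>P. 1 / real p)"
proof (rule ccontr)
  assume "\<not> ?thesis"
  then have B: "(\<Sum>p\<in>P. 1 / real p) \<le> B" if "finite P" "\<And>p. p \<in> P \<Longrightarrow> prime (p::nat)" for P
    using that by (meson less_eq_real_def linorder_not_le)
  have "(\<Sum>n\<in>Z. 1 / real n) \<le> B + 1" if Z: "finite Z" "Z \<subseteq> {n. primepow n}" for Z
  proof -
    have "(\<Sum>n\<in>Z. 1 / real n) = (\<Sum>n\<in>{n\<in>Z. prime n}. 1 / real n) + (\<Sum>n\<in>{n\<in>Z. \<not> prime n}. 1 / real n)"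
      using Z(1) by (subst sum.union_disjoint[symmetric]) (auto intro!: sum.cong)
    also have "\<dots> \<le> B + 1"
      using Z by (intro add_mono B sum_nontrivial_prime_powers) auto
    finally show ?thesis .
  qed
  from mangoldt_sum_sparse[OF this, where e = "1/2"] obtain C where
    C: "\<And>N. N \<ge> 1 \<Longrightarrow> (\<Sum>n\<in>{1..N} \<inter> {n. primepow n}. vm n / real n) \<le> 1 / 2 * ln (real N) + C"
    by auto
  obtain N where N: "N \<ge> 1" "2 * C + 8 < ln (real N)" using ln_unbounded by blast
  have "(\<Sum>n=1..N. vm n / real n) = (\<Sum>n\<in>{1..N} \<inter> {n. primepow n}. vm n / real n)"
    by (rule sum.mono_neutral_right) (auto simp: mangoldt_def)
  then show False using C[OF N(1)] mertens[OF N(1)] N(2) by linarith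
qed

section \<open>Dirichlet characters\<close>

text \<open>Partial summation against a decreasing nonnegative weight, as in Dirichlet's test. The
  weight is evaluated only past \<open>M\<close>, so its default value at 0 never enters.\<close>

lemma abel_bound:
  fixes a :: "nat \<Rightarrow> complex" and g :: "nat \<Rightarrow> real"
  assumes B: "\<And>n. norm (\<Sum>k\<in>{M<..n}. a k) \<le> B"
    and g: "\<And>n. n > M \<Longrightarrow> 0 \<le> g n" "\<And>n. n > M \<Longrightarrow> g (Suc n) \<le> g n"
  shows "norm (\<Sum>n\<in>{M<..N}. a n * of_real (g n)) \<le> B * g (Suc M)"
proof (cases "Suc M \<le> N")
  case True
  define A where "A = (\<lambda>n. \<Sum>k\<in>{M<..n}. a k)"
  have ins: "{M<..Suc n} = insert (Suc n) {M<..n}" if "M \<le> n" for n using that by auto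
  have "norm ((\<Sum>n\<in>{M<..N}. a n * of_real (g n)) - A N * of_real (g N)) \<le> B * (g (Suc M) - g N)"
    using True
  proof (induction N rule: dec_induct)
    case base
    show ?case by (simp add: ins A_def)
  next
    case (step n)
    have "(\<Sum>k\<in>{M<..Suc n}. a k * of_real (g k)) - A (Suc n) * of_real (g (Suc n)) =
        ((\<Sum>k\<in>{M<..n}. a k * of_real (g k)) - A n * of_real (g n)) + A n * of_real (g n - g (Suc n))"
      using step.hyps by (simp add: ins A_def algebra_simps)
    also have "norm \<dots> \<le> B * (g (Suc M) - g n) + B * (g n - g (Suc n))"
    proof (intro norm_triangle_mono step.IH)
      show "norm (A n * of_real (g n - g (Suc n))) \<le> B * (g n - g (Suc n))"
        unfolding norm_mult norm_of_real using g(2)[of n] step.hyps B[of n]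
        by (auto simp: A_def intro: mult_right_mono)
    qed
    finally show ?case by (simp add: algebra_simps)
  qed
  moreover have "norm (A N * of_real (g N)) \<le> B * g N"
    unfolding norm_mult norm_of_real using g(1)[of N] True B[of N]
    by (auto simp: A_def intro: mult_right_mono)
  ultimately have "norm (((\<Sum>n\<in>{M<..N}. a n * of_real (g n)) - A N * of_real (g N)) + A N * of_real (g N))
      \<le> B * (g (Suc M) - g N) + B * g N"
    by (intro norm_triangle_mono)
  then show ?thesis by (simp add: algebra_simps)
next
  case False
  have "0 \<le> B" using order_trans[OF norm_ge_zero B[of 0]] .
  then show ?thesis using False g(1)[of "Suc M"] by simp
qed

text \<open>\<open>sum_zero\<close> encodes that the character is nonprincipal. With periodicity it
  bounds all partial sums by \<open>q\<close>, which drives the convergence estimates below.\<close>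

locale dchar =
  fixes chi :: "nat \<Rightarrow> complex" and q :: nat
  assumes q: "q \<ge> 1" and mult: "\<And>m n. chi (m * n) = chi m * chi n"
    and periodic: "\<And>n. chi (n + q) = chi n" and norm_le: "\<And>n. norm (chi n) \<le> 1"
    and sum_zero: "(\<Sum>n<q. chi n) = 0" and one: "chi 1 = 1"
begin

lemma norm_sum_lessThan: "norm (\<Sum>n<N. chi n) \<le> real q"
proof (induction N rule: less_induct)
  case (less N)
  have per: "(\<Sum>n<m + q. chi n) = (\<Sum>n<m. chi n)" for m
    by (induction m) (simp_all add: sum_zero periodic)
  show ?case
  proof (cases "N < q")
    case True
    have "norm (\<Sum>n<N. chi n) \<le> (\<Sum>n<N. 1)"
      by (intro order_trans[OF norm_sum] sum_mono norm_le)
    with True show ?thesis by simp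
  next
    case False
    then show ?thesis using less[of "N - q"] q per[of "N - q"] by simp
  qed
qed

lemma norm_sum_interval: "norm (\<Sum>n\<in>{M<..N}. chi n) \<le> 2 * real q"
proof (cases "M \<le> N")
  case True
  then have "{..<Suc M} \<union> {M<..N} = {..<Suc N}" by auto
  moreover have "sum chi ({..<Suc M} \<union> {M<..N}) = sum chi {..<Suc M} + sum chi {M<..N}"
    by (rule sum.union_disjoint) auto
  ultimately have "(\<Sum>n\<in>{M<..N}. chi n) = (\<Sum>n<Suc N. chi n) - (\<Sum>n<Suc M. chi n)" by simp
  also have "norm \<dots> \<le> real q + real q"
    by (intro norm_triangle_le_diff add_mono norm_sum_lessThan)
  finally show ?thesis by simp
qed simp

lemmas weighted_bound = abel_bound[where a = chi, OF norm_sum_interval]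

lemma tail_bound: "norm (\<Sum>n\<in>{M<..N}. chi n / of_nat n) \<le> 2 * real q / real (Suc M)"
  using weighted_bound[of M "\<lambda>n. 1 / real n" N] by (simp add: frac_le)

lemma tail_sqrt_bound: "norm (\<Sum>n\<in>{M<..N}. chi n / of_real (sqrt (real n))) \<le> 2 * real q / sqrt (real (Suc M))"
  using weighted_bound[of M "\<lambda>n. 1 / sqrt (real n)" N] by (simp add: frac_le)

lemma ln_sum_bound: "\<exists>C. \<forall>N. norm (\<Sum>n=1..N. chi n * of_real (ln (real n)) / of_nat n) \<le> C"
proof -
  let ?f = "\<lambda>n. chi n * of_real (ln (real n)) / of_nat n"
  \<comment> \<open>\<open>ln x / x\<close> decreases only from \<open>exp 1\<close> on, so partial
    summation starts at 3 and the first two terms are kept apart.\<close>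
  have tail: "norm (\<Sum>n\<in>{2<..N}. ?f n) \<le> 2 * real q * (ln (real (Suc 2)) / real (Suc 2))" for N
  proof -
    have "ln (real (Suc n)) / real (Suc n) \<le> ln (real n) / real n" if "n > 2" for n
      using that e_less_272 by (intro ln_x_over_x_mono) auto
    then show ?thesis
      using weighted_bound[of 2 "\<lambda>n. ln (real n) / real n" N] by simp
  qed
  have "norm (\<Sum>n=1..N. ?f n) \<le> (\<Sum>n\<in>{1,2}. norm (?f n)) + 2 * real q * (ln (real (Suc 2)) / real (Suc 2))" for N
  proof -
    have "(\<Sum>n\<in>({1..N} \<inter> {1,2}) \<union> {2<..N}. ?f n) = (\<Sum>n\<in>{1..N} \<inter> {1,2}. ?f n) + (\<Sum>n\<in>{2<..N}. ?f n)"
      by (rule sum.union_disjoint) auto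
    also have "({1..N} \<inter> {1,2}) \<union> {2<..N} = {1..N}" by auto
    finally have "(\<Sum>n=1..N. ?f n) = (\<Sum>n\<in>{1..N} \<inter> {1,2}. ?f n) + (\<Sum>n\<in>{2<..N}. ?f n)" .
    also have "norm \<dots> \<le> (\<Sum>n\<in>{1,2}. norm (?f n)) + 2 * real q * (ln (real (Suc 2)) / real (Suc 2))"
      by (intro norm_triangle_mono tail order_trans[OF norm_sum] sum_mono2) auto
    finally show ?thesis .
  qed
  then show ?thesis by blast
qed

definition S :: "nat \<Rightarrow> complex" where "S N = (\<Sum>n=1..N. chi n / of_nat n)"

lemma S_diff: 
  assumes "M \<le> N" shows "S N - S M = (\<Sum>n\<in>{M<..N}. chi n / of_nat n)"
proof -
  have "{1..M} \<union> {M<..N} = {1..N}" using assms by auto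
  moreover have "(\<Sum>n\<in>{1..M} \<union> {M<..N}. chi n / of_nat n) = S M + (\<Sum>n\<in>{M<..N}. chi n / of_nat n)"
    unfolding S_def by (rule sum.union_disjoint) auto
  ultimately show ?thesis by (simp add: S_def)
qed

text \<open>The value of the Dirichlet L-series at 1. \<open>S_bound\<close> proves that the limit
  exists, with a rate.\<close>

definition L1 :: complex where "L1 = lim S"

lemma S_bound: "norm (S M - L1) \<le> 2 * real q / real (Suc M)"
proof -
  have lim0: "(\<lambda>n. 2 * real q / real (Suc n)) \<longlonglongrightarrow> 0"
    by (intro tendsto_divide_0[OF tendsto_const] filterlim_at_top_imp_at_infinity
        filterlim_compose[OF filterlim_real_sequentially filterlim_Suc])
  have "Cauchy S"
  proof (rule CauchyI)
    fix e :: real assume "e > 0"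
    then have "eventually (\<lambda>n. 2 * real q / real (Suc n) < e) sequentially"
      using lim0 by (auto simp: order_tendsto_iff)
    then obtain n0 where n0: "\<And>n. n \<ge> n0 \<Longrightarrow> 2 * real q / real (Suc n) < e"
      by (auto simp: eventually_sequentially)
    have le: "norm (S n - S m) < e" if "n0 \<le> m" "m \<le> n" for m n
      using tail_bound[of m n] n0[of m] that by (simp add: S_diff)
    have "norm (S m - S n) < e" if "n0 \<le> m" "n0 \<le> n" for m n
      using le[of m n] le[of n m] that norm_minus_commute[of "S m" "S n"] by (cases "m \<le> n") auto
    then show "\<exists>M. \<forall>m\<ge>M. \<forall>n\<ge>M. norm (S m - S n) < e" by blast
  qed
  then have "S \<longlonglongrightarrow> L1" unfolding L1_def
    by (simp add: Cauchy_convergent_iff convergent_LIMSEQ_iff)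
  then have "(\<lambda>N. norm (S M - S N)) \<longlonglongrightarrow> norm (S M - L1)"
    by (intro tendsto_intros)
  moreover have "eventually (\<lambda>N. norm (S M - S N) \<le> 2 * real q / real (Suc M)) sequentially"
    using eventually_ge_at_top[of M]
  proof eventually_elim
    case (elim N)
    then show ?case using tail_bound[of M N] by (simp add: S_diff[symmetric] norm_minus_commute)
  qed
  ultimately show ?thesis by (rule tendsto_upperbound) simp
qed

text \<open>The error is linear in \<open>d / N\<close>, so when summed against
  \<open>vm d / d\<close> it becomes a Chebyshev sum divided by \<open>N\<close>.\<close>

lemma S_bound_div:
  assumes "d \<ge> 1" "N \<ge> 1" shows "norm (S (N div d) - L1) \<le> 2 * real q * real d / real N"
proof -
  have "N < Suc (N div d) * d" using dividend_less_times_div[of d N] assms by (simp add: mult.commute)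
  then have "real N \<le> real (Suc (N div d)) * real d" by (metis less_imp_le of_nat_le_iff of_nat_mult)
  then have "2 * real q * real N \<le> 2 * real q * (real (Suc (N div d)) * real d)"
    by (intro mult_left_mono) auto
  then have "2 * real q / real (Suc (N div d)) \<le> 2 * real q * real d / real N"
    using assms by (simp add: divide_simps mult_ac del: of_nat_Suc)
  then show ?thesis using S_bound[of "N div d"] by linarith
qed

text \<open>The Mertens sum twisted by the character; its growth reflects the values of
  \<open>chi\<close> on primes.\<close>

definition T :: "nat \<Rightarrow> complex" where "T N = (\<Sum>n=1..N. chi n * of_real (vm n) / of_nat n)"

text \<open>Expanding \<open>ln n\<close> into \<open>vm\<close> turns the bounded sum of
  \<open>chi n * ln n / n\<close> into \<open>L1 * T N\<close> plus an error. Each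
  \<open>S (N div d)\<close> is within \<open>2 * q * d / N\<close> of \<open>L1\<close>, and
  \<open>chebyshev\<close> makes the total error \<open>8 * q\<close>.\<close>

lemma T_bounded:
  assumes "L1 \<noteq> 0" shows "\<exists>C. \<forall>N\<ge>1. norm (T N) \<le> C"
proof -
  obtain C where C: "\<And>N. norm (\<Sum>n=1..N. chi n * of_real (ln (real n)) / of_nat n) \<le> C"
    using ln_sum_bound by blast
  have "norm (T N) \<le> (C + 8 * real q) / norm L1" if N: "N \<ge> 1" for N
  proof -
    let ?c = "\<lambda>d. chi d * of_real (vm d) / of_nat d"
    have "(\<Sum>n=1..N. chi n * of_real (ln (real n)) / of_nat n) =
        (\<Sum>n=1..N. \<Sum>d | d dvd n. ?c d * (chi (n div d) / of_nat (n div d)))"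
    proof (intro sum.cong refl)
      fix n assume n: "n \<in> {1..N}"
      have "chi n * of_real (ln (real n)) / of_nat n = (\<Sum>d | d dvd n. chi n * of_real (vm d) / of_nat n)"
        using n by (simp add: mangoldt_sum flip: sum_divide_distrib sum_distrib_left)
      also have "\<dots> = (\<Sum>d | d dvd n. ?c d * (chi (n div d) / of_nat (n div d)))"
      proof (intro sum.cong refl)
        fix d assume "d \<in> {d. d dvd n}"
        then obtain k where k: "n = d * k" by auto
        then have "d > 0" using n by (auto intro: Nat.gr0I)
        then show "chi n * of_real (vm d) / of_nat n = ?c d * (chi (n div d) / of_nat (n div d))"
          using k by (simp add: mult)
      qed
      finally show "chi n * of_real (ln (real n)) / of_nat n = \<dots>" .
    qed
    also have "\<dots> = (\<Sum>d=1..N. \<Sum>k=1..N div d. ?c d * (chi k / of_nat k))"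
      by (rule sum_divisors_swap[where F = "\<lambda>d k. ?c d * (chi k / of_nat k)"])
    also have "\<dots> = (\<Sum>d=1..N. ?c d * S (N div d))"
      by (simp add: S_def sum_distrib_left)
    also have "\<dots> = L1 * T N + (\<Sum>d=1..N. ?c d * (S (N div d) - L1))"
    proof -
      have "x * s = L1 * x + x * (s - L1)" for x s by (simp add: algebra_simps)
      then show ?thesis unfolding T_def sum_distrib_left sum.distrib[symmetric] by (intro sum.cong refl)
    qed
    finally have "L1 * T N = (\<Sum>n=1..N. chi n * of_real (ln (real n)) / of_nat n)
        - (\<Sum>d=1..N. ?c d * (S (N div d) - L1))" by simp
    also have "norm \<dots> \<le> C + 8 * real q"
    proof (intro norm_triangle_le_diff add_mono C)
      have "norm (\<Sum>d=1..N. ?c d * (S (N div d) - L1)) \<le> (\<Sum>d=1..N. 2 * real q / real N * vm d)"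
      proof (intro order_trans[OF norm_sum] sum_mono)
        fix d assume d: "d \<in> {1..N}"
        have "norm (?c d * (S (N div d) - L1)) = norm (chi d) * (vm d / real d) * norm (S (N div d) - L1)"
          by (simp add: norm_mult norm_divide mangoldt_nonneg del: of_real_mangoldt)
        also have "\<dots> \<le> 1 * (vm d / real d) * (2 * real q * real d / real N)"
          using d by (intro mult_mono norm_le S_bound_div) (auto simp: mangoldt_nonneg)
        also have "\<dots> = 2 * real q / real N * vm d" using d by simp
        finally show "norm (?c d * (S (N div d) - L1)) \<le> 2 * real q / real N * vm d" .
      qed
      also have "\<dots> \<le> 2 * real q / real N * (4 * real N)"
        unfolding sum_distrib_left[symmetric] by (intro mult_left_mono chebyshev) auto
      also have "\<dots> = 8 * real q" using N by simp
      finally show "norm (\<Sum>d=1..N. ?c d * (S (N div d) - L1)) \<le> 8 * real q" .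
    qed
    finally show ?thesis using assms by (simp add: norm_mult field_simps)
  qed
  then show ?thesis by blast
qed

text \<open>Moebius sums weighted by \<open>ln (N / d)\<close> produce \<open>vm n\<close>, plus
  \<open>ln N\<close> at \<open>n = 1\<close> only. On the other side each inner sum
  \<open>S (N div d)\<close> is small because \<open>L1 = 0\<close>, and the average of
  \<open>ln (N / d)\<close> over \<open>d \<le> N\<close> is at most 1.\<close>

lemma T_asymp:
  assumes "L1 = 0" and N: "N \<ge> 1" shows "norm (T N + of_real (ln (real N))) \<le> 2 * real q"
proof -
  let ?c = "\<lambda>d. of_real (mu d * ln (real N / real d)) * chi d / of_nat d"
  have "T N + of_real (ln (real N)) = (\<Sum>n=1..N. \<Sum>d | d dvd n. ?c d * (chi (n div d) / of_nat (n div d)))"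
  proof -
    have "(\<Sum>n=1..N. \<Sum>d | d dvd n. ?c d * (chi (n div d) / of_nat (n div d))) =
        (\<Sum>n=1..N. chi n * of_real (vm n) / of_nat n + (if n = 1 then of_real (ln (real N)) else 0))"
    proof (intro sum.cong refl)
      fix n assume n: "n \<in> {1..N}"
      have "(\<Sum>d | d dvd n. ?c d * (chi (n div d) / of_nat (n div d))) =
          (\<Sum>d | d dvd n. chi n / of_nat n * of_real (mu d * ln (real (n div d)) + mu d * ln (real N / real n)))"
      proof (intro sum.cong refl)
        fix d assume "d \<in> {d. d dvd n}"
        then obtain k where k: "n = d * k" by auto
        then have dk: "d > 0" "k > 0" using n by (auto intro: Nat.gr0I)
        then have "ln (real (n div d)) + ln (real N / real n) = ln (real N / real d)"
          using k N n by (simp add: ln_div ln_mult)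
        then have "mu d * ln (real (n div d)) + mu d * ln (real N / real n) = mu d * ln (real N / real d)"
          by (simp flip: distrib_left)
        then show "?c d * (chi (n div d) / of_nat (n div d)) =
            chi n / of_nat n * of_real (mu d * ln (real (n div d)) + mu d * ln (real N / real n))"
          using k dk by (simp add: mult)
      qed
      also have "\<dots> = chi n / of_nat n * of_real ((\<Sum>d | d dvd n. mu d * ln (real (n div d)))
          + (\<Sum>d | d dvd n. mu d) * ln (real N / real n))"
        by (simp only: sum_distrib_left[symmetric] of_real_sum[symmetric] sum.distrib sum_distrib_right)
      also have "\<dots> = chi n / of_nat n * of_real (vm n + of_bool (n = 1) * ln (real N / real n))"
        using n by (simp only: sum_mu_ln_div sum_mu atLeastAtMost_iff)
      also have "\<dots> = chi n * of_real (vm n) / of_nat n + (if n = 1 then of_real (ln (real N)) else 0)"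
        using one by (simp add: algebra_simps)
      finally show "(\<Sum>d | d dvd n. ?c d * (chi (n div d) / of_nat (n div d))) = \<dots>" .
    qed
    then show ?thesis using N by (simp add: T_def sum.distrib)
  qed
  also have "\<dots> = (\<Sum>d=1..N. \<Sum>k=1..N div d. ?c d * (chi k / of_nat k))"
    by (rule sum_divisors_swap[where F = "\<lambda>d k. ?c d * (chi k / of_nat k)"])
  also have "\<dots> = (\<Sum>d=1..N. ?c d * S (N div d))"
    by (simp add: S_def sum_distrib_left)
  also have "norm \<dots> \<le> (\<Sum>d=1..N. 2 * real q / real N * ln (real N / real d))"
  proof (intro order_trans[OF norm_sum] sum_mono)
    fix d assume d: "d \<in> {1..N}"
    have ln0: "0 \<le> ln (real N / real d)" using d by (intro ln_ge_zero) (simp add: field_simps)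
    have "norm (?c d * S (N div d)) = \<bar>mu d\<bar> * norm (chi d) * (ln (real N / real d) / real d) * norm (S (N div d))"
      using ln0 by (simp add: norm_mult norm_divide abs_mult)
    also have "\<dots> \<le> 1 * 1 * (ln (real N / real d) / real d) * (2 * real q * real d / real N)"
      using d N S_bound_div[of d N] assms(1) ln0 by (intro mult_mono norm_le abs_mu_le) auto
    also have "\<dots> = 2 * real q / real N * ln (real N / real d)" using d by simp
    finally show "norm (?c d * S (N div d)) \<le> 2 * real q / real N * ln (real N / real d)" .
  qed
  also have "\<dots> = 2 * real q / real N * (\<Sum>d=1..N. ln (real N / real d))"
    by (simp add: sum_distrib_left)
  also have "(\<Sum>d=1..N. ln (real N / real d)) = (\<Sum>d=1..N. ln (real N) - ln (real d))"
    using N by (intro sum.cong refl) (simp add: ln_div)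
  also have "\<dots> = real N * ln (real N) - (\<Sum>d=1..N. ln (real d))" by (simp add: sum_subtractf)
  also have "(\<Sum>d=1..N. ln (real d)) = ln (fact N)"
    unfolding fact_prod of_nat_prod by (rule ln_prod[symmetric]) auto
  also have "2 * real q / real N * (real N * ln (real N) - ln (fact N)) \<le> 2 * real q / real N * real N"
    using ln_fact_bounds(1)[OF N] by (intro mult_left_mono) auto
  also have "\<dots> = 2 * real q" using N by simp
  finally show ?thesis .
qed

text \<open>If \<open>L(1, \<chi>) = 0\<close>, the hyperbola method bounds \<open>\<Sum> (1 * \<chi>)(n) / \<surd>n\<close>; but the summands are
  nonnegative and at least \<open>1 / m\<close> at \<open>n = m\<^sup>2\<close>.\<close>
lemma L1_nonzero:
  assumes real: "\<And>n. chi n \<in> {-1, 0, 1}" shows "L1 \<noteq> 0"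
proof
  assume L0: "L1 = 0"
  define c where "c = (\<lambda>n. Re (chi n))"
  have c_vals: "c n \<in> {-1, 0, 1}" for n using real[of n] by (auto simp: c_def)
  have chi_c: "chi n = of_real (c n)" for n using real[of n] by (auto simp: c_def)
  have c_mult: "c (m * n) = c m * c n" for m n using mult[of m n] unfolding chi_c by (simp flip: of_real_mult)
  have c_one: "c 1 = 1" using one by (simp add: c_def)
  have c_pow: "c (p ^ i) = c p ^ i" for p i by (induction i) (use c_one in \<open>simp_all add: c_mult\<close>)
  have c_abs: "\<bar>c n\<bar> \<le> 1" for n using c_vals[of n] by auto
  \<comment> \<open>The Dirichlet convolution of 1 and \<open>chi\<close>. Its local factors are
    geometric sums with ratio -1, 0 or 1, hence nonnegative, and at least 1 at even
    exponents.\<close>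
  define h where "h = (\<lambda>n. \<Sum>d | d dvd n. c d)"
  have h_split: "h (p ^ k * m) = (\<Sum>i\<le>k. c p ^ i) * h m" if p: "prime p" "\<not> p dvd m" "m > 0" for p k m
  proof -
    have cop: "coprime (p ^ k) m" using p by (simp add: prime_imp_coprime)
    have inj: "inj_on (\<lambda>(i, d). p ^ i * d) ({..k} \<times> {d. d dvd m})"
    proof (rule inj_onI, clarify)
      fix i d j e
      assume h: "d dvd m" "e dvd m" "p ^ i * d = p ^ j * e"
      have nd: "\<not> p dvd d" "\<not> p dvd e" using h p(2) dvd_trans by blast+
      have "multiplicity p (p ^ i * d) = i" "multiplicity p (p ^ j * e) = j"
        using p(1) nd by (auto intro!: multiplicity_eqI simp: prime_gt_0_nat dest!: prime_gt_0_nat)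
      then have "i = j" using h(3) by simp
      then show "i = j \<and> d = e" using h(3) p(1) by (simp add: prime_gt_0_nat)
    qed
    have img: "{d. d dvd p ^ k * m} = (\<lambda>(i, d). p ^ i * d) ` ({..k} \<times> {d. d dvd m})"
    proof (intro equalityI subsetI)
      fix x assume "x \<in> {d. d dvd p ^ k * m}"
      then obtain a b where ab: "x = a * b" "a dvd p ^ k" "b dvd m" using division_decomp by blast
      then obtain i where "i \<le> k" "a = p ^ i" using divides_primepow_nat[OF p(1)] by blast
      then show "x \<in> (\<lambda>(i, d). p ^ i * d) ` ({..k} \<times> {d. d dvd m})" using ab by auto
    qed (auto intro: mult_dvd_mono le_imp_power_dvd)
    have "h (p ^ k * m) = (\<Sum>(i, d)\<in>{..k} \<times> {d. d dvd m}. c (p ^ i * d))"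
      unfolding h_def img by (subst sum.reindex[OF inj]) (simp add: case_prod_unfold)
    also have "\<dots> = (\<Sum>i\<le>k. \<Sum>d | d dvd m. c p ^ i * c d)"
      by (simp add: sum.cartesian_product c_mult c_pow)
    finally show ?thesis by (simp add: h_def sum_product)
  qed
  have geo: "0 \<le> (\<Sum>i\<le>k. c p ^ i) \<and> (even k \<longrightarrow> 1 \<le> (\<Sum>i\<le>k. c p ^ i))" for p k
  proof -
    have "(\<Sum>i\<le>k. (-1) ^ i) = (of_bool (even k) :: real)" by (induction k) auto
    moreover have "(\<Sum>i\<le>k. 0 ^ i) = (1 :: real)" by (induction k) auto
    moreover have "(\<Sum>i\<le>k. 1 ^ i) = real k + 1" by simp
    ultimately show ?thesis using c_vals[of p] by auto
  qed
  have h_bounds: "0 \<le> h n \<and> 1 \<le> h (n\<^sup>2)" if "n > 0" for n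
    using that
  proof (induction n rule: less_induct)
    case (less n)
    show ?case
    proof (cases "n = 1")
      case True
      have "{d. d dvd Suc 0} = {Suc 0}" by auto
      then show ?thesis using True c_one by (simp add: h_def)
    next
      case False
      then obtain p where p: "prime p" "p dvd n" using prime_factor_nat by blast
      have "\<not> is_unit p" "n \<noteq> 0" using p(1) less.prems not_prime_unit by auto
      from multiplicity_decompose'[OF this(2) this(1)] obtain m where
        m: "n = p ^ multiplicity p n * m" "\<not> p dvd m" by metis
      define k where "k = multiplicity p n"
      have nk: "n = p ^ k * m" using m(1) by (simp add: k_def)
      have m0: "m > 0" using nk less.prems by (auto intro: Nat.gr0I)
      have "k > 0" using p m nk by (auto intro: Nat.gr0I)
      then have "p ^ k > 1" by (intro one_less_power prime_gt_1_nat p)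
      then have "m < n" using nk m0 by simp
      note IH = less.IH[OF this m0]
      have n2: "n\<^sup>2 = p ^ (2 * k) * m\<^sup>2" by (simp add: nk power_mult_distrib flip: power_mult power2_eq_square) (simp add: mult.commute power_mult)
      have "\<not> p dvd m\<^sup>2" using m(2) p(1) prime_dvd_power by blast
      then have "h (n\<^sup>2) = (\<Sum>i\<le>2 * k. c p ^ i) * h (m\<^sup>2)" unfolding n2 using p m0 by (intro h_split) auto
      moreover have "1 * 1 \<le> (\<Sum>i\<le>2 * k. c p ^ i) * h (m\<^sup>2)"
        using geo[of p "2 * k"] IH by (intro mult_mono) auto
      moreover have "h n = (\<Sum>i\<le>k. c p ^ i) * h m" using nk h_split[OF p(1) m(2) m0] by simp
      moreover have "0 \<le> (\<Sum>i\<le>k. c p ^ i) * h m" using geo[of p k] IH by simp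
      ultimately show ?thesis by simp
    qed
  qed
  define I where "I = (\<lambda>y::nat. \<Sum>k=1..y. 1 / sqrt (real k))"
  \<comment> \<open>\<open>a\<close> decreases while \<open>a k - 1 / sqrt k\<close> increases, so
    \<open>a y\<close> and \<open>a N\<close> differ by at most \<open>1 / sqrt y\<close>. Thus
    \<open>a N\<close> can stand for the limit constant in the asymptotics of \<open>I\<close>, with
    an explicit rate.\<close>
  define a where "a = (\<lambda>y. I y - 2 * sqrt (real y))"
  have sq: "2 * (sqrt (real (Suc k)) - sqrt (real k)) = 2 / (sqrt (real (Suc k)) + sqrt (real k))" for k
  proof -
    have "(sqrt (real (Suc k)) - sqrt (real k)) * (sqrt (real (Suc k)) + sqrt (real k)) = 1"
      by (simp add: algebra_simps)
    moreover have "sqrt (real (Suc k)) + sqrt (real k) > 0" by (simp add: add_pos_nonneg)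
    ultimately show ?thesis by (simp add: field_simps)
  qed
  have a_decr: "a (Suc k) \<le> a k" for k
  proof -
    have "1 / sqrt (real (Suc k)) = 2 / (sqrt (real (Suc k)) + sqrt (real (Suc k)))" by simp
    also have "\<dots> \<le> 2 / (sqrt (real (Suc k)) + sqrt (real k))"
      by (intro divide_left_mono add_left_mono) (auto intro!: mult_pos_pos add_pos_nonneg)
    finally show ?thesis unfolding a_def I_def using sq[of k] by simp
  qed
  have b_incr: "a k - 1 / sqrt (real k) \<le> a (Suc k) - 1 / sqrt (real (Suc k))" if "k \<ge> 1" for k
  proof -
    have "2 / (sqrt (real (Suc k)) + sqrt (real k)) \<le> 2 / (sqrt (real k) + sqrt (real k))"
      using that by (intro divide_left_mono add_right_mono) (auto intro!: mult_pos_pos add_pos_pos)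
    also have "\<dots> = 1 / sqrt (real k)" by simp
    finally show ?thesis unfolding a_def I_def using sq[of k] by simp
  qed
  have a_close: "\<bar>a y - a N\<bar> \<le> 1 / sqrt (real y)" if "1 \<le> y" "y \<le> N" for y N
  proof -
    have "a N \<le> a y" using that(2) a_decr by (rule lift_Suc_antimono_le[rotated])
    moreover have "a y - 1 / sqrt (real y) \<le> a N - 1 / sqrt (real N)"
      using that(2)
    proof (induction N rule: dec_induct)
      case (step n)
      then show ?case using b_incr[of n] that(1) by linarith
    qed simp
    ultimately show ?thesis by (smt (verit) divide_nonneg_nonneg of_nat_0_le_iff real_sqrt_ge_zero)
  qed
  have a_bound: "\<bar>a y\<bar> \<le> 2" if "1 \<le> y" for y
    using a_close[OF order_refl that] by (simp add: a_def I_def)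
  have I_le: "I y \<le> 2 * sqrt (real y)" for y
    using lift_Suc_antimono_le[of a, OF a_decr, of 0 y] by (simp add: a_def I_def)
  let ?w = "\<lambda>n. 1 / sqrt (real n)"
  have c_tail: "\<bar>\<Sum>n\<in>{M<..N}. c n * ?w n\<bar> \<le> 2 * real q / sqrt (real (Suc M))" for M N
  proof -
    have "(\<Sum>n\<in>{M<..N}. chi n / of_real (sqrt (real n))) = of_real (\<Sum>n\<in>{M<..N}. c n * ?w n)"
      by (simp add: chi_c)
    then show ?thesis using tail_sqrt_bound[of M N] by (simp only: norm_of_real)
  qed
  have c_sum: "\<bar>\<Sum>n=1..Q. c n / real n\<bar> \<le> 2 * real q / real (Suc Q)" for Q
  proof -
    have "S Q = of_real (\<Sum>n=1..Q. c n / real n)" by (simp add: S_def chi_c)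
    then show ?thesis using S_bound[of Q] L0 by (simp only: diff_zero norm_of_real)
  qed
  \<comment> \<open>A square end point puts the corner of the hyperbola at the integer
    \<open>Q\<close>. Pairs with \<open>d \<le> Q\<close> keep the long sum over \<open>k\<close>;
    for \<open>d > Q\<close> necessarily \<open>k \<le> Q\<close>, so there the long sum is over
    \<open>d\<close>, where \<open>chi\<close> oscillates.\<close>
  have upper: "(\<Sum>n=1..Q\<^sup>2. ?w n * h n) \<le> 12 * real q + 6" if Q: "Q \<ge> 1" for Q
  proof -
    define N where "N = Q\<^sup>2"
    have QN: "Q \<le> N" "1 \<le> N" using Q by (auto simp: N_def power2_eq_square)
    have sN: "sqrt (real N) = real Q" by (simp add: N_def)
    have sQ: "sqrt (real Q) * sqrt (real Q) = real Q" "sqrt (real Q) > 0" using Q by auto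
    have IQ: "(\<Sum>d=1..Q. ?w d) \<le> 2 * sqrt (real Q)" using I_le[of Q] by (simp add: I_def)
    have "(\<Sum>n=1..N. ?w n * h n) = (\<Sum>n=1..N. \<Sum>d | d dvd n. (c d * ?w d) * ?w (n div d))"
    proof (intro sum.cong refl)
      fix n assume n: "n \<in> {1..N}"
      have "?w n * h n = (\<Sum>d | d dvd n. ?w n * c d)" by (simp add: h_def sum_distrib_left)
      also have "\<dots> = (\<Sum>d | d dvd n. (c d * ?w d) * ?w (n div d))"
      proof (intro sum.cong refl)
        fix d assume "d \<in> {d. d dvd n}"
        then obtain k where "n = d * k" by auto
        moreover from this have "d > 0" using n by (auto intro: Nat.gr0I)
        ultimately show "?w n * c d = (c d * ?w d) * ?w (n div d)" by (simp add: real_sqrt_mult)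
      qed
      finally show "?w n * h n = \<dots>" .
    qed
    also have "\<dots> = (\<Sum>d=1..N. \<Sum>k=1..N div d. (c d * ?w d) * ?w k)"
      by (rule sum_divisors_swap[where F = "\<lambda>d k. (c d * ?w d) * ?w k"])
    also have "\<dots> = (\<Sum>d=1..Q. \<Sum>k=1..N div d. (c d * ?w d) * ?w k)
        + (\<Sum>d\<in>{Q<..N}. \<Sum>k=1..N div d. (c d * ?w d) * ?w k)"
    proof -
      have "{1..Q} \<union> {Q<..N} = {1..N}" using QN by auto
      then show ?thesis by (subst sum.union_disjoint[symmetric]) auto
    qed
    also have "(\<Sum>d\<in>{Q<..N}. \<Sum>k=1..N div d. (c d * ?w d) * ?w k)
        = (\<Sum>(d, k)\<in>Sigma {Q<..N} (\<lambda>d. {1..N div d}). (c d * ?w d) * ?w k)"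
      by (rule sum.Sigma) auto
    also have "\<dots> = (\<Sum>(k, d)\<in>Sigma {1..Q} (\<lambda>k. {Q<..N div k}). (c d * ?w d) * ?w k)"
    proof (rule sum.reindex_bij_witness[of _ "\<lambda>(k, d). (d, k)" "\<lambda>(d, k). (k, d)"])
      fix x assume x: "x \<in> Sigma {Q<..N} (\<lambda>d. {1..N div d})"
      obtain d k where dk: "x = (d, k)" by (cases x)
      have h: "Q < d" "d \<le> N" "1 \<le> k" "k \<le> N div d" using x dk by auto
      have kd: "k * d \<le> N" using h by (simp add: less_eq_div_iff_mult_less_eq)
      have "k \<le> Q"
      proof (rule ccontr)
        assume "\<not> k \<le> Q"
        then have "Q * Q < k * d" using h(1) by (intro mult_strict_mono) auto
        then show False using kd by (simp add: N_def power2_eq_square)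
      qed
      moreover have "d \<le> N div k" using kd h by (simp add: less_eq_div_iff_mult_less_eq mult.commute)
      ultimately show "(case x of (d, k) \<Rightarrow> (k, d)) \<in> Sigma {1..Q} (\<lambda>k. {Q<..N div k})" using h dk by auto
    next
      fix x assume x: "x \<in> Sigma {1..Q} (\<lambda>k. {Q<..N div k})"
      obtain k d where dk: "x = (k, d)" by (cases x)
      have h: "1 \<le> k" "k \<le> Q" "Q < d" "d \<le> N div k" using x dk by auto
      have kd: "k * d \<le> N" using h by (simp add: less_eq_div_iff_mult_less_eq mult.commute)
      then have "k \<le> N div d" using h by (simp add: less_eq_div_iff_mult_less_eq)
      moreover have "d \<le> N" using h div_le_dividend order_trans by blast
      ultimately show "(case x of (k, d) \<Rightarrow> (d, k)) \<in> Sigma {Q<..N} (\<lambda>d. {1..N div d})" using h dk by auto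
    qed auto
    also have "\<dots> = (\<Sum>k=1..Q. \<Sum>d\<in>{Q<..N div k}. (c d * ?w d) * ?w k)"
      by (rule sum.Sigma[symmetric]) auto
    also have "\<dots> \<le> (\<Sum>k=1..Q. (2 * real q / sqrt (real Q)) * ?w k)"
    proof (intro sum_mono)
      fix k assume "k \<in> {1..Q}"
      have "(\<Sum>d\<in>{Q<..N div k}. c d * ?w d) \<le> 2 * real q / sqrt (real (Suc Q))"
        using c_tail[of Q "N div k"] by linarith
      also have "\<dots> \<le> 2 * real q / sqrt (real Q)" using Q by (intro divide_left_mono) auto
      finally show "(\<Sum>d\<in>{Q<..N div k}. (c d * ?w d) * ?w k) \<le> (2 * real q / sqrt (real Q)) * ?w k"
        unfolding sum_distrib_right[symmetric] by (rule mult_right_mono) simp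
    qed
    also have "\<dots> \<le> (2 * real q / sqrt (real Q)) * (2 * sqrt (real Q))"
      unfolding sum_distrib_left[symmetric] by (intro mult_left_mono IQ) auto
    also have "\<dots> = 4 * real q" using sQ by simp
    finally have "(\<Sum>n=1..N. ?w n * h n) \<le> (\<Sum>d=1..Q. \<Sum>k=1..N div d. (c d * ?w d) * ?w k) + 4 * real q"
      by simp
    moreover have "(\<Sum>d=1..Q. \<Sum>k=1..N div d. (c d * ?w d) * ?w k) \<le> 8 * real q + 6"
    proof -
      \<comment> \<open>The leading part of \<open>I (N div d)\<close> contributes
        \<open>2 * Q\<close> times a partial sum of the L-series at 1. That product stays bounded
        because \<open>L1 = 0\<close> makes the partial sum of order \<open>1 / Q\<close>; the other
        two parts are bounded in any case.\<close>
      define E where "E = (\<lambda>d. I (N div d) - 2 * real Q / sqrt (real d) - a N)"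
      have E: "\<bar>E d\<bar> \<le> 3 / sqrt (real Q)" if d: "d \<in> {1..Q}" for d
      proof -
        define y where "y = N div d"
        have y: "Q \<le> y"
          using d by (simp add: y_def N_def power2_eq_square less_eq_div_iff_mult_less_eq)
        have y1: "1 \<le> y" "y \<le> N" using y Q by (auto simp: y_def)
        have le: "real y \<le> real N / real d" unfolding y_def by (rule of_nat_div_le_of_nat)
        have ge: "real N / real d \<le> real y + 1"
          using floor_divide_of_nat_eq[of N d, where ?'a = real] unfolding y_def by linarith
        have sqd: "sqrt (real N / real d) = real Q / sqrt (real d)" by (simp add: real_sqrt_divide sN)
        have "sqrt (real N / real d) \<le> sqrt (real y) + 1 / sqrt (real y)"
        proof (rule real_le_lsqrt)
          show "0 \<le> sqrt (real y) + 1 / sqrt (real y)" by simp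
          have "(sqrt (real y) + 1 / sqrt (real y))\<^sup>2 = real y + 2 + 1 / real y"
            using y1 by (simp add: power2_sum power_divide)
          moreover have "0 \<le> 1 / real y" by simp
          ultimately show "real N / real d \<le> (sqrt (real y) + 1 / sqrt (real y))\<^sup>2" using ge by linarith
        qed
        moreover have "sqrt (real y) \<le> sqrt (real N / real d)" using le by simp
        ultimately have s: "\<bar>sqrt (real y) - real Q / sqrt (real d)\<bar> \<le> 1 / sqrt (real y)"
          unfolding sqd by linarith
        have "E d = 2 * (sqrt (real y) - real Q / sqrt (real d)) + (a y - a N)"
          by (simp add: E_def a_def y_def algebra_simps)
        moreover have "\<bar>2 * s + t\<bar> \<le> 2 * e + e" if "\<bar>s\<bar> \<le> e" "\<bar>t\<bar> \<le> e" for s t e :: real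
          using that by linarith
        ultimately have "\<bar>E d\<bar> \<le> 2 * (1 / sqrt (real y)) + 1 / sqrt (real y)"
          using s a_close[OF y1] by metis
        also have "\<dots> = 3 / sqrt (real y)" by simp
        also have "\<dots> \<le> 3 / sqrt (real Q)" using y Q by (intro divide_left_mono) auto
        finally show ?thesis .
      qed
      have "(\<Sum>d=1..Q. \<Sum>k=1..N div d. (c d * ?w d) * ?w k) = (\<Sum>d=1..Q. (c d * ?w d) * I (N div d))"
        by (simp add: I_def sum_distrib_left)
      also have "\<dots> = (\<Sum>d=1..Q. 2 * real Q * (c d / real d) + a N * (c d * ?w d) + c d * ?w d * E d)"
      proof (intro sum.cong refl)
        fix d assume d: "d \<in> {1..Q}"
        have "I (N div d) = 2 * real Q * ?w d + a N + E d" by (simp add: E_def)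
        moreover have "?w d * ?w d = 1 / real d" using d by (simp flip: real_sqrt_mult)
        ultimately show "(c d * ?w d) * I (N div d) = 2 * real Q * (c d / real d) + a N * (c d * ?w d) + c d * ?w d * E d"
          by (simp add: algebra_simps)
      qed
      also have "\<dots> = 2 * real Q * (\<Sum>d=1..Q. c d / real d) + a N * (\<Sum>d=1..Q. c d * ?w d) + (\<Sum>d=1..Q. c d * ?w d * E d)"
        by (simp only: sum.distrib sum_distrib_left)
      also have "\<dots> \<le> 4 * real q + 4 * real q + 6"
      proof (intro add_mono)
        have "2 * real Q * (\<Sum>d=1..Q. c d / real d) \<le> 2 * real Q * (2 * real q / real (Suc Q))"
          using c_sum[of Q] by (intro mult_left_mono) auto
        also have "\<dots> = 4 * real q * (real Q / real (Suc Q))" by simp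
        also have "\<dots> \<le> 4 * real q * 1" by (intro mult_left_mono) auto
        finally show "2 * real Q * (\<Sum>d=1..Q. c d / real d) \<le> 4 * real q" by simp
        have "{1..Q} = {0<..Q}" by auto
        then have "\<bar>\<Sum>d=1..Q. c d * ?w d\<bar> \<le> 2 * real q" using c_tail[of 0 Q] by simp
        then have "\<bar>a N\<bar> * \<bar>\<Sum>d=1..Q. c d * ?w d\<bar> \<le> 2 * (2 * real q)"
          by (intro mult_mono a_bound QN) auto
        then show "a N * (\<Sum>d=1..Q. c d * ?w d) \<le> 4 * real q" by (simp add: abs_mult[symmetric])
        have "(\<Sum>d=1..Q. c d * ?w d * E d) \<le> (\<Sum>d=1..Q. ?w d * (3 / sqrt (real Q)))"
        proof (intro sum_mono)
          fix d assume d: "d \<in> {1..Q}"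
          have "\<bar>c d\<bar> * ?w d * \<bar>E d\<bar> \<le> 1 * ?w d * (3 / sqrt (real Q))"
            by (intro mult_mono c_abs E d) auto
          then show "c d * ?w d * E d \<le> ?w d * (3 / sqrt (real Q))"
            using abs_ge_self[of "c d * ?w d * E d"] by (simp add: abs_mult)
        qed
        also have "\<dots> \<le> (2 * sqrt (real Q)) * (3 / sqrt (real Q))"
          unfolding sum_distrib_right[symmetric] by (intro mult_right_mono IQ) auto
        also have "\<dots> = 6" using sQ by simp
        finally show "(\<Sum>d=1..Q. c d * ?w d * E d) \<le> 6" .
      qed
      finally show ?thesis by simp
    qed
    ultimately show ?thesis unfolding N_def by linarith
  qed
  have lower: "(\<Sum>m=1..Q. 1 / real m) \<le> (\<Sum>n=1..Q\<^sup>2. ?w n * h n)" for Q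
  proof -
    have "(\<Sum>m=1..Q. 1 / real m) \<le> (\<Sum>m=1..Q. ?w (m\<^sup>2) * h (m\<^sup>2))"
    proof (intro sum_mono)
      fix m assume "m \<in> {1..Q}"
      then have "1 / real m * 1 \<le> 1 / real m * h (m\<^sup>2)"
        using h_bounds[of m] by (intro mult_left_mono) auto
      then show "1 / real m \<le> ?w (m\<^sup>2) * h (m\<^sup>2)" by simp
    qed
    also have "\<dots> = (\<Sum>n\<in>(\<lambda>m. m\<^sup>2) ` {1..Q}. ?w n * h n)"
      by (subst sum.reindex) (auto simp: inj_on_def)
    also have "\<dots> \<le> (\<Sum>n=1..Q\<^sup>2. ?w n * h n)"
    proof (rule sum_mono2)
      show "(\<lambda>m. m\<^sup>2) ` {1..Q} \<subseteq> {1..Q\<^sup>2}" by (auto simp: power_mono Suc_le_eq)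
      show "0 \<le> ?w n * h n" if "n \<in> {1..Q\<^sup>2} - (\<lambda>m. m\<^sup>2) ` {1..Q}" for n
        using that h_bounds[of n] by auto
    qed simp
    finally show ?thesis .
  qed
  have "filterlim (harm :: nat \<Rightarrow> real) at_top sequentially" by (rule harm_at_top)
  then have "eventually (\<lambda>Q. harm Q > 12 * real q + 6) sequentially" by (simp add: filterlim_at_top_dense)
  then have "eventually (\<lambda>Q. harm Q > 12 * real q + 6 \<and> Q \<ge> 1) sequentially"
    using eventually_ge_at_top[of 1] by (rule eventually_conj)
  then obtain Q where Q: "harm Q > 12 * real q + 6" "Q \<ge> 1"
    using eventually_happens'[OF sequentially_bot] by blast
  then show False using upper[of Q] lower[of Q] by (simp add: harm_def inverse_eq_divide)
qed

text \<open>If \<open>chi\<close> equals \<open>\<zeta>\<close> on primes off a sparse set,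
  \<open>T N\<close> is \<open>\<zeta> * ln N\<close> up to an arbitrarily small multiple of
  \<open>ln N\<close>. But \<open>T N\<close> is bounded if \<open>L1 \<noteq> 0\<close>, and is
  \<open>- ln N\<close> up to a constant if \<open>L1 = 0\<close>. Only \<open>\<zeta> = -1\<close>
  with \<open>L1 = 0\<close> is left; there \<open>chi\<close> is real by assumption, and
  \<open>L1_nonzero\<close> applies.\<close>

lemma not_almost_constant:
  assumes zeta: "norm \<zeta> = 1" and real: "\<zeta> = -1 \<Longrightarrow> (\<And>n. chi n \<in> {-1, 0, 1})"
    and sparse: "\<And>Z. finite Z \<Longrightarrow> Z \<subseteq> {p. prime p \<and> chi p \<noteq> \<zeta>} \<Longrightarrow> (\<Sum>p\<in>Z. 1 / real p) \<le> B"
  shows False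
proof -
  \<comment> \<open>The exceptional set also takes in the proper prime powers, where nothing is
    assumed of \<open>chi\<close> but the reciprocals sum to at most 1.\<close>
  define Y where "Y = {n. primepow n \<and> \<not> (prime n \<and> chi n = \<zeta>)}"
  have "(\<Sum>n\<in>Z. 1 / real n) \<le> B + 1" if Z: "finite Z" "Z \<subseteq> Y" for Z
  proof -
    have "(\<Sum>n\<in>Z. 1 / real n) = (\<Sum>n\<in>{n\<in>Z. prime n}. 1 / real n) + (\<Sum>n\<in>{n\<in>Z. \<not> prime n}. 1 / real n)"
      using Z(1) by (subst sum.union_disjoint[symmetric]) (auto intro!: sum.cong)
    also have "\<dots> \<le> B + 1"
      using Z by (intro add_mono sparse sum_nontrivial_prime_powers) (auto simp: Y_def)
    finally show ?thesis .
  qed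
  note Y = mangoldt_sum_sparse[OF this]
  have close: "\<exists>C. \<forall>N\<ge>1. norm (T N - \<zeta> * of_real (ln (real N))) \<le> e * ln (real N) + C" if e: "e > 0" for e
  proof -
    obtain C where C: "\<And>N. N \<ge> 1 \<Longrightarrow> (\<Sum>n\<in>{1..N} \<inter> Y. vm n / real n) \<le> e / 2 * ln (real N) + C"
      using Y[where e = "e / 2"] e by auto
    have "norm (T N - \<zeta> * of_real (ln (real N))) \<le> e * ln (real N) + (2 * C + 4)" if N: "N \<ge> 1" for N
    proof -
      define U where "U = (\<Sum>n=1..N. vm n / real n)"
      have "T N - \<zeta> * of_real U = (\<Sum>n=1..N. (chi n - \<zeta>) * of_real (vm n / real n))"
        unfolding T_def U_def of_real_sum sum_distrib_left sum_subtractf[symmetric]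
        by (intro sum.cong refl) (simp add: left_diff_distrib diff_divide_distrib del: of_real_mangoldt)
      also have "\<dots> = (\<Sum>n\<in>{1..N} \<inter> Y. (chi n - \<zeta>) * of_real (vm n / real n))"
        by (rule sum.mono_neutral_right) (auto simp: Y_def mangoldt_def)
      also have "norm \<dots> \<le> (\<Sum>n\<in>{1..N} \<inter> Y. 2 * (vm n / real n))"
      proof (intro order_trans[OF norm_sum] sum_mono)
        fix n
        have "norm (chi n - \<zeta>) \<le> 2" using norm_triangle_ineq4[of "chi n" \<zeta>] norm_le[of n] zeta by simp
        then have "norm (chi n - \<zeta>) * (vm n / real n) \<le> 2 * (vm n / real n)"
          by (intro mult_right_mono) (auto simp: mangoldt_nonneg)
        then show "norm ((chi n - \<zeta>) * of_real (vm n / real n)) \<le> 2 * (vm n / real n)"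
          by (simp only: norm_mult norm_of_real) (simp add: mangoldt_nonneg)
      qed
      also have "\<dots> \<le> e * ln (real N) + 2 * C"
        using C[OF N] unfolding sum_distrib_left[symmetric] by simp
      finally have 1: "norm (T N - \<zeta> * of_real U) \<le> e * ln (real N) + 2 * C" .
      have "norm (\<zeta> * of_real U - \<zeta> * of_real (ln (real N))) = \<bar>U - ln (real N)\<bar>"
        using zeta by (simp add: norm_mult flip: right_diff_distrib of_real_diff)
      then have 2: "norm (\<zeta> * of_real U - \<zeta> * of_real (ln (real N))) \<le> 4" using mertens[OF N] by (simp add: U_def)
      from norm_triangle_mono[OF 1 2] show ?thesis by simp
    qed
    then show ?thesis by blast
  qed
  have unb: False if "\<And>N. N \<ge> 1 \<Longrightarrow> k * ln (real N) \<le> k / 2 * ln (real N) + C" "k > 0" for k C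
  proof -
    obtain N where N: "N \<ge> 1" "2 * C / k < ln (real N)" using ln_unbounded by blast
    then have "2 * C < k * ln (real N)" using that(2) by (simp add: field_simps)
    then show False using that(1)[OF N(1)] by simp
  qed
  show False
  proof (cases "L1 = 0")
    case True
    then have "\<zeta> \<noteq> -1" using real L1_nonzero by blast
    define k where "k = norm (\<zeta> + 1)"
    have k: "k > 0" using \<open>\<zeta> \<noteq> -1\<close> by (simp add: k_def add_eq_0_iff2)
    obtain C where C: "\<And>N. N \<ge> 1 \<Longrightarrow> norm (T N - \<zeta> * of_real (ln (real N))) \<le> k / 2 * ln (real N) + C"
      using close[of "k / 2"] k by auto
    have "k * ln (real N) \<le> k / 2 * ln (real N) + (2 * real q + C)" if N: "N \<ge> 1" for N
    proof -
      have "k * ln (real N) = norm ((T N + of_real (ln (real N))) - (T N - \<zeta> * of_real (ln (real N))))"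
      proof -
        have "(T N + of_real (ln (real N))) - (T N - \<zeta> * of_real (ln (real N))) = (\<zeta> + 1) * of_real (ln (real N))"
          by (simp add: algebra_simps)
        then show ?thesis using N by (simp add: norm_mult k_def)
      qed
      also have "\<dots> \<le> 2 * real q + (k / 2 * ln (real N) + C)"
        by (intro norm_triangle_le_diff add_mono T_asymp[OF True N] C N)
      finally show ?thesis by simp
    qed
    from unb[OF this k] show False .
  next
    case False
    obtain D where D: "\<And>N. N \<ge> 1 \<Longrightarrow> norm (T N) \<le> D" using T_bounded[OF False] by blast
    obtain C where C: "\<And>N. N \<ge> 1 \<Longrightarrow> norm (T N - \<zeta> * of_real (ln (real N))) \<le> 1 / 2 * ln (real N) + C"
      using close[of "1 / 2"] by auto
    have "1 * ln (real N) \<le> 1 / 2 * ln (real N) + (D + C)" if N: "N \<ge> 1" for N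
    proof -
      have "1 * ln (real N) = norm (T N - (T N - \<zeta> * of_real (ln (real N))))"
        using N zeta by (simp add: norm_mult)
      also have "\<dots> \<le> D + (1 / 2 * ln (real N) + C)"
        by (intro norm_triangle_le_diff add_mono D C N)
      finally show ?thesis by simp
    qed
    from unb[OF this] show False by simp
  qed
qed

end

section \<open>Independence of residues and number of prime factors\<close>

lemma num_prime_factors_mult:
  assumes "m \<ge> 1" "n \<ge> 1" shows "num_prime_factors (m * n) = num_prime_factors m + num_prime_factors n"
  using assms by (simp add: num_prime_factors_def prime_factorization_mult)

lemma num_prime_factors_mult_prime:
  assumes "prime p" "n \<ge> 1" shows "num_prime_factors (p * n) = Suc (num_prime_factors n)"
  using assms prime_ge_1_nat[OF assms(1)]
  by (simp add: num_prime_factors_mult) (simp add: num_prime_factors_def prime_factorization_prime)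

definition divergent_primes :: "nat set \<Rightarrow> bool" where
  "divergent_primes D \<longleftrightarrow> (\<forall>p\<in>D. prime p) \<and> (\<forall>B. \<exists>P. finite P \<and> P \<subseteq> D \<and> B \<le> (\<Sum>p\<in>P. 1 / real p))"

text \<open>All dilates of \<open>a\<close> by primes in \<open>D\<close> have the same mean
  \<open>logmean b\<close>. So for \<open>a\<close> scaled to be bounded by 1, Turan-Kubilius bounds
  the difference of the means by \<open>1 / sqrt S\<close>, and \<open>D\<close> allows
  \<open>S\<close> to be arbitrarily large.\<close>

lemma prime_dilation:
  assumes D: "divergent_primes D" and a: "bdd a" and ab: "\<And>p n. p \<in> D \<Longrightarrow> n \<ge> 1 \<Longrightarrow> a (p * n) = b n"
  shows "logmean a = logmean b"
proof -
  obtain A0 where A0: "\<And>n. \<bar>a n\<bar> \<le> A0" using a by (auto simp: bdd_def)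
  \<comment> \<open>The extra 1 keeps the normalising divisor positive even if
    \<open>A0 = 0\<close>.\<close>
  define A where "A = A0 + 1"
  have A: "A > 0" "\<And>n. \<bar>a n / A\<bar> \<le> 1"
  proof -
    show "A > 0" unfolding A_def using A0[of 0] by simp
    then show "\<bar>a n / A\<bar> \<le> 1" for n using A0[of n] by (simp add: abs_divide A_def)
  qed
  define x where "x = \<bar>logmean a / A - logmean b / A\<bar>"
  have "x \<le> e" if e: "e > 0" for e
  proof -
    obtain P where P: "finite P" "P \<subseteq> D" and PS: "(1 / e)\<^sup>2 \<le> (\<Sum>p\<in>P. 1 / real p)"
      using D unfolding divergent_primes_def by blast
    define S where "S = (\<Sum>p\<in>P. 1 / real p)"
    have "0 < (1 / e)\<^sup>2" using e by simp
    then have S0: "S > 0" using PS by (simp only: S_def)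
    have sqS: "1 / e \<le> sqrt S" using PS by (intro real_le_rsqrt) (simp add: S_def)
    have pr: "prime p" if "p \<in> P" for p using that P D by (auto simp: divergent_primes_def)
    have "\<bar>S * logmean (\<lambda>n. a n / A) - (\<Sum>p\<in>P. logmean (\<lambda>n. a (p * n) / A) / real p)\<bar> \<le> sqrt S"
      unfolding S_def by (rule logmean.turan_kubilius[OF P(1)]) (use pr A(2) in auto)
    also have "(\<Sum>p\<in>P. logmean (\<lambda>n. a (p * n) / A) / real p) = (\<Sum>p\<in>P. logmean b / A / real p)"
    proof (intro sum.cong refl)
      fix p assume p: "p \<in> P"
      have "logmean (\<lambda>n. a (p * n) / A) = logmean (\<lambda>n. a (p * n)) / A"
        by (rule logmean.divide[OF bdd_comp[OF a]])
      also have "logmean (\<lambda>n. a (p * n)) = logmean b"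
        using ab p P by (intro logmean.pos_cong) auto
      finally show "logmean (\<lambda>n. a (p * n) / A) / real p = logmean b / A / real p" by simp
    qed
    also have "\<dots> = S * (logmean b / A)" unfolding S_def sum_distrib_right by (intro sum.cong) auto
    also have "logmean (\<lambda>n. a n / A) = logmean a / A" by (rule logmean.divide[OF a])
    also have "\<bar>S * (logmean a / A) - S * (logmean b / A)\<bar> = S * x"
      unfolding x_def right_diff_distrib[symmetric] abs_mult using S0 by simp
    finally have "sqrt S * (sqrt S * x) \<le> sqrt S * 1"
      using S0 by (simp add: mult.assoc[symmetric])
    then have le1: "sqrt S * x \<le> 1" by (rule mult_left_le_imp_le) (simp add: S0)
    have "0 \<le> x" by (simp add: x_def)
    then have "(1 / e) * x \<le> sqrt S * x" by (rule mult_right_mono[OF sqS])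
    also note le1
    finally show "x \<le> e" using e by (simp add: divide_le_eq)
  qed
  then have "x \<le> 0 + e" if "e > 0" for e using that by simp
  then have "x \<le> 0" by (rule field_le_epsilon)
  then show ?thesis using A(1) by (simp add: x_def)
qed

text \<open>Dilation by any prime raises \<open>num_prime_factors\<close> by one, and the primes
  together have divergent reciprocal sum.\<close>

lemma logmean_num_prime_factors_add:
  assumes "bdd G"
  shows "logmean (\<lambda>n. G (num_prime_factors n + k)) = logmean (\<lambda>n. G (num_prime_factors n))"
proof (induction k)
  case (Suc k)
  have "divergent_primes {p. prime p}"
    unfolding divergent_primes_def
  proof (intro conjI allI)
    fix B
    show "\<exists>P. finite P \<and> P \<subseteq> {p. prime p} \<and> B \<le> (\<Sum>p\<in>P. 1 / real p)"
      using primes_reciprocal_unbounded[of B] by blast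
  qed simp
  then have "logmean (\<lambda>n. G (num_prime_factors n + k)) = logmean (\<lambda>n. G (num_prime_factors n + Suc k))"
    by (rule prime_dilation) (auto simp: num_prime_factors_mult_prime intro: bdd_comp[OF assms])
  then show ?case using Suc by simp
qed simp

text \<open>Subgroups of the units modulo \<open>q\<close>, encoded as unions of residue classes in
  \<open>nat\<close>. Closure under inverses comes from Euler's theorem, see
  \<open>cancel\<close>.\<close>

locale mult_subgroup =
  fixes q :: nat and M :: "nat set"
  assumes q: "q \<ge> 1" and coprime: "\<And>x. x \<in> M \<Longrightarrow> coprime x q" and one: "1 \<in> M"
    and mult: "\<And>x y. x \<in> M \<Longrightarrow> y \<in> M \<Longrightarrow> x * y \<in> M"
    and cong: "\<And>x y. x \<in> M \<Longrightarrow> [x = y] (mod q) \<Longrightarrow> y \<in> M"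
begin

lemma power: "x \<in> M \<Longrightarrow> x ^ k \<in> M"
  by (induction k) (use one mult in auto)

lemma totient_pos: "totient q > 0" using q by simp

lemma power_totient: "coprime x q \<Longrightarrow> x ^ totient q \<in> M"
  using cong[OF one cong_sym[OF euler_theorem]] by blast

lemma cancel:
  assumes "x \<in> M" "x * y \<in> M" shows "y \<in> M"
proof -
  have "x ^ (totient q - 1) * (x * y) \<in> M" by (intro mult power assms)
  also have "x ^ (totient q - 1) * (x * y) = x ^ totient q * y"
    using totient_pos by (simp add: power_eq_if[of x "totient q"] mult.assoc mult.left_commute)
  finally show ?thesis
    using cong[of "x ^ totient q * y" y] cong_scalar_right[OF euler_theorem[OF coprime[OF assms(1)]], of y] by simp
qed

end

lemma cis_nontrivial:
  assumes "l \<ge> 2" shows "cis (2 * pi / real l) \<noteq> 1" "cis (2 * pi / real l) = -1 \<Longrightarrow> l = 2"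
proof -
  have "l = 2 \<or> l \<ge> 3" using assms by auto
  moreover have "Im (cis (2 * pi / real l)) > 0" if "l \<ge> 3"
  proof -
    have "2 * pi / real l < pi" using that pi_gt_zero by (simp add: divide_less_eq)
    then show ?thesis using that pi_gt_zero by (simp add: sin_gt_zero)
  qed
  ultimately show "cis (2 * pi / real l) \<noteq> 1" "cis (2 * pi / real l) = -1 \<Longrightarrow> l = 2"
    by (auto simp: complex_eq_iff)
qed

text \<open>A maximal proper subgroup is the kernel of a character, because together with any further
  element it generates everything.\<close>
lemma exists_character:
  assumes M: "mult_subgroup q M"
    and max: "\<And>M'. mult_subgroup q M' \<Longrightarrow> M \<subset> M' \<Longrightarrow> M' = {n. coprime n q}"
    and b: "coprime b q" "b \<notin> M"
  shows "\<exists>chi. dchar chi q \<and> (\<forall>n\<in>M. chi n = 1) \<and> (chi b = -1 \<longrightarrow> (\<forall>n. chi n \<in> {-1, 0, 1})) \<and>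
    norm (chi b) = 1 \<and> (\<forall>m n. [m = n] (mod q) \<longrightarrow> chi m = chi n)"
proof -
  interpret mult_subgroup q M by (rule M)
  \<comment> \<open>The subgroup generated by \<open>M\<close> and \<open>b\<close>. Since
    \<open>b\<close> has finite order modulo \<open>q\<close>, multiplying by powers of
    \<open>b\<close> can replace dividing by them.\<close>
  define M' where "M' = {n. coprime n q \<and> (\<exists>j. n * b ^ j \<in> M)}"
  have "M' = {n. coprime n q}"
  proof (rule max)
    show "mult_subgroup q M'"
    proof
      show "1 \<le> q" by (rule q)
      show "1 \<in> M'" using one by (auto simp: M'_def intro: exI[of _ 0])
      show "coprime x q" if "x \<in> M'" for x using that by (simp add: M'_def)
      show "x * y \<in> M'" if xy: "x \<in> M'" "y \<in> M'" for x y
      proof -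
        obtain i j where ij: "x * b ^ i \<in> M" "y * b ^ j \<in> M" using xy by (auto simp: M'_def)
        have "(x * y) * b ^ (i + j) = (x * b ^ i) * (y * b ^ j)" by (simp add: power_add)
        then have "(x * y) * b ^ (i + j) \<in> M" using mult[OF ij] by (simp only:)
        then show ?thesis using xy by (auto simp: M'_def)
      qed
      show "y \<in> M'" if xy: "x \<in> M'" "[x = y] (mod q)" for x y
      proof -
        obtain i where "x * b ^ i \<in> M" using xy by (auto simp: M'_def)
        then have "y * b ^ i \<in> M" using cong cong_scalar_right[OF xy(2)] by blast
        moreover have "coprime y q" using xy by (auto simp: M'_def cong_imp_coprime)
        ultimately show ?thesis by (auto simp: M'_def)
      qed
    qed
    have "b \<in> M'"
    proof -
      have "b * b ^ (totient q - 1) = b ^ totient q"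
        using totient_pos by (simp add: power_eq_if[of b "totient q"])
      then show ?thesis using b(1) power_totient[OF b(1)] by (auto simp: M'_def intro!: exI[of _ "totient q - 1"])
    qed
    moreover have "M \<subseteq> M'" using coprime by (auto simp: M'_def intro: exI[of _ 0])
    ultimately show "M \<subset> M'" using b(2) by auto
  qed
  then have ex: "\<exists>j. n * b ^ j \<in> M" if "coprime n q" for n using that by (auto simp: M'_def)
  \<comment> \<open>The order of \<open>b\<close> in the quotient by \<open>M\<close>.\<close>
  define l where "l = (LEAST j. j > 0 \<and> b ^ j \<in> M)"
  have l: "l > 0" "b ^ l \<in> M"
    using LeastI[of "\<lambda>j. j > 0 \<and> b ^ j \<in> M" "totient q"] totient_pos power_totient[OF b(1)] by (auto simp: l_def)
  have l_min: "j = 0" if "j < l" "b ^ j \<in> M" for j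
    using that not_less_Least[of j "\<lambda>j. j > 0 \<and> b ^ j \<in> M"] by (auto simp: l_def)
  have "l \<noteq> 1" using l b(2) by auto
  with l(1) have l2: "l \<ge> 2" by simp
  have l_dvd: "l dvd j" if "b ^ j \<in> M" for j
  proof -
    have "(b ^ l) ^ (j div l) * b ^ (j mod l) = b ^ j"
      unfolding power_mult[symmetric] power_add[symmetric] mult_div_mod_eq ..
    then have "b ^ (j mod l) \<in> M"
      using that cancel[OF power[OF l(2), of "j div l"], of "b ^ (j mod l)"] by simp
    then have "j mod l = 0" using l(1) by (intro l_min) auto
    then show ?thesis by (rule mod_0_imp_dvd)
  qed
  define v where "v = cis (2 * pi / real l)"
  \<comment> \<open>\<open>n * b ^ j \<in> M\<close> says that \<open>n\<close> is the inverse of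
    \<open>b ^ j\<close> modulo \<open>M\<close>, so a character trivial on \<open>M\<close> with
    value \<open>v\<close> at \<open>b\<close> takes the value \<open>u ^ j\<close> at
    \<open>n\<close>.\<close>
  define u where "u = inverse v"
  have v: "v \<noteq> 1" "v = -1 \<Longrightarrow> l = 2" using cis_nontrivial[OF l2] by (auto simp: v_def)
  have "v ^ l = 1" unfolding v_def Complex.DeMoivre using l(1) by (simp add: cis_2pi)
  then have ul: "u ^ l = 1" by (simp add: u_def power_inverse)
  have nu: "norm u = 1" by (simp add: u_def v_def norm_inverse)
  have u_le: "u ^ i = u ^ j" if ij: "n * b ^ i \<in> M" "n * b ^ j \<in> M" "i \<le> j" for n i j
  proof -
    have "n * b ^ j = (n * b ^ i) * b ^ (j - i)" 
      using ij(3) power_add[of b i "j - i"] by (simp add: mult.assoc)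
    with ij(2) have "(n * b ^ i) * b ^ (j - i) \<in> M" by (simp only:)
    then have "b ^ (j - i) \<in> M" by (rule cancel[OF ij(1)])
    then obtain k where "j - i = l * k" using l_dvd by (auto elim: dvdE)
    then have "j = i + l * k" using ij(3) by simp
    then show ?thesis using ul by (simp add: power_add power_mult)
  qed
  have u_eq: "u ^ i = u ^ j" if "n * b ^ i \<in> M" "n * b ^ j \<in> M" for n i j
  proof (cases "i \<le> j")
    case True
    then show ?thesis by (rule u_le[OF that])
  next
    case False
    then show ?thesis by (intro u_le[OF that(2,1), symmetric]) simp
  qed
  define chi where "chi = (\<lambda>n. if coprime n q then u ^ (SOME j. n * b ^ j \<in> M) else 0)"
  have chi: "chi n = u ^ j" if "coprime n q" "n * b ^ j \<in> M" for n j
    using u_eq[OF someI[of "\<lambda>j. n * b ^ j \<in> M", OF that(2)] that(2)] that(1) by (simp add: chi_def)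
  have chi_M: "chi n = 1" if "n \<in> M" for n
    using chi[of n 0] that coprime by simp
  have chi_cong: "chi m = chi n" if mn: "[m = n] (mod q)" for m n
  proof (cases "coprime m q")
    case True
    then obtain j where j: "m * b ^ j \<in> M" using ex by blast
    have "n * b ^ j \<in> M" using cong[OF j cong_scalar_right[OF mn]] .
    moreover have "coprime n q" using True mn cong_imp_coprime by blast
    ultimately show ?thesis using chi[OF True j] chi by simp
  next
    case False
    then have "\<not> coprime n q" using mn cong_imp_coprime cong_sym by blast
    with False show ?thesis by (simp add: chi_def)
  qed
  have chi_mult: "chi (m * n) = chi m * chi n" for m n
  proof (cases "coprime m q \<and> coprime n q")
    case True
    then obtain i j where ij: "m * b ^ i \<in> M" "n * b ^ j \<in> M" using ex by blast
    have "(m * n) * b ^ (i + j) = (m * b ^ i) * (n * b ^ j)" by (simp add: power_add)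
    then have "(m * n) * b ^ (i + j) \<in> M" using mult[OF ij] by (simp only:)
    then have "chi (m * n) = u ^ (i + j)" using True by (intro chi) auto
    then show ?thesis using chi ij True by (simp add: power_add)
  qed (auto simp: chi_def)
  have chi_b: "chi b = v"
  proof -
    have "b * b ^ (l - 1) = b ^ l" using l(1) by (simp add: power_eq_if[of b l])
    then have "chi b = u ^ (l - 1)" using l(2) b(1) by (intro chi) auto
    moreover have "u * u ^ (l - 1) = 1" using ul l(1) by (simp add: power_eq_if[of u l])
    moreover have "u * v = 1" unfolding u_def by (rule left_inverse) (simp add: v_def)
    ultimately show ?thesis by (metis mult_left_cancel mult_zero_left zero_neq_one)
  qed
  have "dchar chi q"
  proof
    show "1 \<le> q" by (rule q)
    show "chi (m * n) = chi m * chi n" for m n by (rule chi_mult)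
    show "chi (n + q) = chi n" for n by (rule chi_cong) (simp add: cong_def)
    show "norm (chi n) \<le> 1" for n using nu by (simp add: chi_def norm_power)
    show "chi 1 = 1" by (rule chi_M[OF one])
    \<comment> \<open>Multiplication by \<open>b\<close> permutes the residues and multiplies
      \<open>chi\<close> by \<open>v \<noteq> 1\<close>, so the sum over a period vanishes.\<close>
    have inj: "inj_on (\<lambda>n. (b * n) mod q) {..<q}"
    proof (rule inj_onI)
      fix x y assume xy: "x \<in> {..<q}" "y \<in> {..<q}" "(b * x) mod q = (b * y) mod q"
      then have "[x = y] (mod q)"
        using cong_mult_lcancel_nat[OF b(1), of x y] by (simp add: cong_def)
      then show "x = y" using xy by (simp add: cong_def)
    qed
    have "(\<Sum>n<q. chi n) = (\<Sum>n\<in>(\<lambda>n. (b * n) mod q) ` {..<q}. chi n)"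
    proof -
      have "(\<lambda>n. (b * n) mod q) ` {..<q} \<subseteq> {..<q}" using q by auto
      then have "(\<lambda>n. (b * n) mod q) ` {..<q} = {..<q}"
        by (intro endo_inj_surj inj) auto
      then show ?thesis by simp
    qed
    also have "\<dots> = (\<Sum>n<q. chi ((b * n) mod q))"
      by (rule sum.reindex_cong[OF inj refl refl])
    also have "\<dots> = (\<Sum>n<q. v * chi n)"
    proof (intro sum.cong refl)
      fix n
      have "chi ((b * n) mod q) = chi (b * n)" by (rule chi_cong) (simp add: cong_def)
      then show "chi ((b * n) mod q) = v * chi n" by (simp add: chi_mult chi_b)
    qed
    also have "\<dots> = v * (\<Sum>n<q. chi n)" by (simp add: sum_distrib_left)
    finally show "(\<Sum>n<q. chi n) = 0" using v(1) by simp
  qed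
  moreover have "chi n \<in> {-1, 0, 1}" if "chi b = -1" for n
  proof -
    have "u = -1" using that by (simp add: chi_b u_def)
    then have "u ^ j \<in> {-1, 1}" for j by (cases "even j") auto
    then show ?thesis by (auto simp: chi_def)
  qed
  moreover have "norm (chi b) = 1" by (simp add: chi_b v_def)
  ultimately show ?thesis using chi_M chi_cong by blast
qed

text \<open>A union of residue classes is determined by its representatives below \<open>q\<close>,
  of which there are at most \<open>q\<close>. A proper subgroup above \<open>K\<close> with as many
  representatives as possible is therefore maximal.\<close>

lemma proper_subgroup_extend:
  assumes "mult_subgroup q K" "K \<noteq> {n. coprime n q}"
  obtains M where "mult_subgroup q M" "K \<subseteq> M" "M \<noteq> {n. coprime n q}"
    "\<And>M'. mult_subgroup q M' \<Longrightarrow> M \<subset> M' \<Longrightarrow> M' = {n. coprime n q}"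
proof -
  define Q where "Q = (\<lambda>M. mult_subgroup q M \<and> K \<subseteq> M \<and> M \<noteq> {n. coprime n q})"
  have "card (M \<inter> {..<q}) \<le> q" for M :: "nat set"
    using card_mono[of "{..<q}" "M \<inter> {..<q}"] by simp
  then obtain M where M: "Q M" "\<And>M'. Q M' \<Longrightarrow> card (M' \<inter> {..<q}) \<le> card (M \<inter> {..<q})"
    using ex_has_greatest_nat[of Q K "\<lambda>M. card (M \<inter> {..<q})" "Suc q"] assms by (auto simp: Q_def less_Suc_eq_le)
  show thesis
  proof (rule that[of M])
    fix M' assume M': "mult_subgroup q M'" "M \<subset> M'"
    show "M' = {n. coprime n q}"
    proof (rule ccontr)
      assume "M' \<noteq> {n. coprime n q}"
      then have "Q M'" using M M' by (auto simp: Q_def)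
      then have le: "card (M' \<inter> {..<q}) \<le> card (M \<inter> {..<q})" by (rule M)
      have "M \<inter> {..<q} = M' \<inter> {..<q}"
        using M'(2) le by (intro card_seteq) auto
      moreover obtain x where x: "x \<in> M'" "x \<notin> M" using M'(2) by auto
      have "x mod q \<in> M'" using x mult_subgroup.cong[OF M'(1), of x "x mod q"] by (simp add: cong_def)
      moreover have "x mod q < q" using mult_subgroup.q[OF M'(1)] by simp
      ultimately have "x mod q \<in> M" by auto
      moreover have "mult_subgroup q M" using M by (simp add: Q_def)
      ultimately have "x \<in> M" using mult_subgroup.cong[of q M "x mod q" x] by (simp add: cong_def)
      then show False using x by simp
    qed
  qed (use M in \<open>auto simp: Q_def\<close>)
qed

definition residue_primes :: "nat \<Rightarrow> nat \<Rightarrow> nat set" where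
  "residue_primes q b = {p. prime p \<and> [p = b] (mod q)}"

text \<open>There are finitely many classes to add up. Primes in a class not coprime to
  \<open>q\<close> divide \<open>q\<close>, and a coprime class that is not
  \<open>divergent_primes\<close> has bounded reciprocal sums by definition.\<close>

lemma nondivergent_bound:
  assumes q: "q \<ge> 1"
  obtains B where "\<And>Z. finite Z \<Longrightarrow> (\<And>p. p \<in> Z \<Longrightarrow> prime p \<and> \<not> (coprime p q \<and> divergent_primes (residue_primes q p)))
    \<Longrightarrow> (\<Sum>p\<in>Z. 1 / real p) \<le> B"
proof -
  define bad where "bad = (\<lambda>b. {p \<in> residue_primes q b. \<not> (coprime p q \<and> divergent_primes (residue_primes q p))})"
  have "\<exists>B\<ge>0. \<forall>Z. finite Z \<longrightarrow> Z \<subseteq> bad b \<longrightarrow> (\<Sum>p\<in>Z. 1 / real p) \<le> B" for b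
  proof (cases "coprime b q")
    case True
    show ?thesis
    proof (cases "divergent_primes (residue_primes q b)")
      case div: True
      have "bad b = {}"
      proof -
        have "coprime p q \<and> divergent_primes (residue_primes q p)" if "p \<in> residue_primes q b" for p
        proof -
          have c: "[p = b] (mod q)" using that by (simp add: residue_primes_def)
          then have "residue_primes q p = residue_primes q b"
            by (auto simp: residue_primes_def cong_def)
          moreover have "coprime p q" using True c cong_imp_coprime cong_sym by blast
          ultimately show ?thesis using div by simp
        qed
        then show ?thesis by (auto simp: bad_def)
      qed
      then show ?thesis by (intro exI[of _ 0]) auto
    next
      case False
      then obtain B where B: "\<And>P. finite P \<Longrightarrow> P \<subseteq> residue_primes q b \<Longrightarrow> \<not> B \<le> (\<Sum>p\<in>P. 1 / real p)"
        by (auto simp: divergent_primes_def residue_primes_def)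
      have "0 \<le> B" using B[of "{}"] by simp
      moreover have "(\<Sum>p\<in>Z. 1 / real p) \<le> B" if "finite Z" "Z \<subseteq> bad b" for Z
        using B[of Z] that by (force simp: bad_def)
      ultimately show ?thesis by blast
    qed
  next
    case False
    have "(\<Sum>p\<in>Z. 1 / real p) \<le> (\<Sum>p | p dvd q. 1 / real p)" if Z: "finite Z" "Z \<subseteq> bad b" for Z
    proof (rule sum_mono2)
      show "finite {p. p dvd q}" using q by simp
      show "Z \<subseteq> {p. p dvd q}"
      proof
        fix p assume "p \<in> Z"
        then have p: "prime p" "[p = b] (mod q)" using Z by (auto simp: bad_def residue_primes_def)
        then have "\<not> coprime p q" using False cong_imp_coprime by blast
        then show "p \<in> {p. p dvd q}" using p(1) prime_imp_coprime by blast
      qed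
    qed simp
    moreover have "0 \<le> (\<Sum>p | p dvd q. 1 / real p)" by (simp add: sum_nonneg)
    ultimately show ?thesis by blast
  qed
  then obtain B where B: "\<And>b. 0 \<le> B b" "\<And>b Z. finite Z \<Longrightarrow> Z \<subseteq> bad b \<Longrightarrow> (\<Sum>p\<in>Z. 1 / real p) \<le> B b"
    by metis
  show thesis
  proof (rule that)
    fix Z assume Z: "finite Z" "\<And>p. p \<in> Z \<Longrightarrow> prime p \<and> \<not> (coprime p q \<and> divergent_primes (residue_primes q p))"
    have "(\<Sum>p\<in>Z. 1 / real p) = (\<Sum>b<q. \<Sum>p\<in>{p\<in>Z. p mod q = b}. 1 / real p)"
      using Z(1) q by (intro sum.group[symmetric]) auto
    also have "\<dots> \<le> (\<Sum>b<q. B b)"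
      using Z by (intro sum_mono B) (auto simp: bad_def residue_primes_def cong_def)
    finally show "(\<Sum>p\<in>Z. 1 / real p) \<le> (\<Sum>b<q. B b)" .
  qed
qed

text \<open>Dilating by primes \<open>p \<equiv> b\<close> shows that translating the residue class by \<open>b\<close> has the same effect
  for all classes \<open>b\<close> rich in primes; hence the invariance group contains all quotients of such classes.
  Were it a proper subgroup, some character would be constant on almost all primes.\<close>
lemma coprime_classes_equal:
  assumes q: "q \<ge> 1" and G: "bdd G" and c: "coprime c q"
  shows "logmean (\<lambda>n. of_bool ([n = c] (mod q)) * G (num_prime_factors n)) =
         logmean (\<lambda>n. of_bool ([n = 1] (mod q)) * G (num_prime_factors n))"
proof -
  define \<nu> where "\<nu> = (\<lambda>c. logmean (\<lambda>n. of_bool ([n = c] (mod q)) * G (num_prime_factors n)))"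
  define \<nu>' where "\<nu>' = (\<lambda>c. logmean (\<lambda>n. of_bool ([n = c] (mod q)) * G (Suc (num_prime_factors n))))"
  define good where "good = (\<lambda>b. coprime b q \<and> divergent_primes (residue_primes q b))"
  have \<nu>_cong: "\<nu> x = \<nu> y" if "[x = y] (mod q)" for x y
  proof -
    have "[n = x] (mod q) \<longleftrightarrow> [n = y] (mod q)" for n using that by (simp add: cong_def)
    then show ?thesis by (simp add: \<nu>_def)
  qed
  have step: "\<nu> (b * c) = \<nu>' c" if "good b" for b c
    unfolding \<nu>_def \<nu>'_def
  proof (rule prime_dilation)
    show "divergent_primes (residue_primes q b)" using that by (simp add: good_def)
    show "bdd (\<lambda>n. of_bool ([n = b * c] (mod q)) * G (num_prime_factors n))"
      using bdd_comp[OF G, of num_prime_factors] by simp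
    fix p n :: nat assume p: "p \<in> residue_primes q b" and n: "1 \<le> n"
    have "[p * n = b * c] (mod q) \<longleftrightarrow> [b * n = b * c] (mod q)"
      using cong_scalar_right[of p b q n] p by (auto simp: residue_primes_def cong_def)
    also have "\<dots> \<longleftrightarrow> [n = c] (mod q)" using that by (intro cong_mult_lcancel_nat) (simp add: good_def)
    finally show "of_bool ([p * n = b * c] (mod q)) * G (num_prime_factors (p * n)) =
        of_bool ([n = c] (mod q)) * G (Suc (num_prime_factors n))"
      using p n by (simp add: num_prime_factors_mult_prime residue_primes_def)
  qed
  define K where "K = {h. coprime h q \<and> (\<forall>c. coprime c q \<longrightarrow> \<nu> (h * c) = \<nu> c)}"
  have K: "mult_subgroup q K"
  proof
    show "y \<in> K" if "x \<in> K" "[x = y] (mod q)" for x y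
    proof -
      have "\<nu> (y * c) = \<nu> (x * c)" for c by (rule \<nu>_cong[OF cong_scalar_right[OF cong_sym[OF that(2)]]])
      then show ?thesis using that by (auto simp: K_def cong_imp_coprime)
    qed
    show "x * y \<in> K" if "x \<in> K" "y \<in> K" for x y
      using that by (auto simp: K_def mult.assoc)
  qed (use q in \<open>auto simp: K_def\<close>)
  obtain B where B: "\<And>Z. finite Z \<Longrightarrow> (\<And>p. p \<in> Z \<Longrightarrow> prime p \<and> \<not> good p) \<Longrightarrow> (\<Sum>p\<in>Z. 1 / real p) \<le> B"
    using nondivergent_bound[OF q] unfolding good_def by metis
  obtain b0 where b0: "good b0"
  proof -
    obtain P where P: "finite P" "\<forall>p\<in>P. prime p" "B + 1 \<le> (\<Sum>p\<in>P. 1 / real p)"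
      using primes_reciprocal_unbounded[of "B + 1"] by blast
    then show thesis using B[OF P(1)] that by force
  qed
  have "K = {n. coprime n q}"
  proof (rule ccontr)
    assume "K \<noteq> {n. coprime n q}"
    then obtain M where M: "mult_subgroup q M" "K \<subseteq> M" "M \<noteq> {n. coprime n q}"
      and max: "\<And>M'. mult_subgroup q M' \<Longrightarrow> M \<subset> M' \<Longrightarrow> M' = {n. coprime n q}"
      using proper_subgroup_extend[OF K] by metis
    interpret M: mult_subgroup q M by (rule M)
    obtain b1 where b1: "coprime b1 q" "b1 \<notin> M" using M(3) M.coprime by auto
    \<comment> \<open>Either way \<open>chi b0\<close> is under control: it is 1 if
      \<open>b0 \<in> M\<close> and equals \<open>chi b\<close> otherwise. So it has norm 1, and it
      is -1 only if \<open>chi\<close> is real.\<close>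
    define b where "b = (if b0 \<in> M then b1 else b0)"
    have b: "coprime b q" "b \<notin> M" using b1 b0 by (auto simp: b_def good_def)
    obtain chi where chi: "dchar chi q" "\<forall>n\<in>M. chi n = 1" "chi b = -1 \<longrightarrow> (\<forall>n. chi n \<in> {-1, 0, 1})"
      "norm (chi b) = 1" "\<forall>m n. [m = n] (mod q) \<longrightarrow> chi m = chi n"
      using exists_character[OF M(1) max b] by blast
    interpret dchar chi q by (rule chi(1))
    have good_const: "chi p = chi b0" if p: "good p" for p
    proof -
      \<comment> \<open>With \<open>e\<close> an inverse of \<open>b0\<close>, the product
        \<open>p * e\<close> represents the quotient of two good classes, and \<open>step\<close>
        puts it into \<open>K\<close>.\<close>
      obtain e where e: "[b0 * e = 1] (mod q)" using b0 cong_solve_coprime_nat by (auto simp: good_def)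
      have ce: "coprime e q" using e by (metis cong_imp_coprime cong_sym coprime_1_left coprime_mult_left_iff)
      have "p * e \<in> K"
      proof -
        have "\<nu> (p * e * c) = \<nu> c" for c
        proof -
          have "\<nu> (p * (e * c)) = \<nu> (b0 * (e * c))" by (simp only: step[OF p] step[OF b0])
          also have "\<dots> = \<nu> (1 * c)" by (rule \<nu>_cong) (use cong_scalar_right[OF e, of c] in \<open>simp add: mult.assoc\<close>)
          finally show ?thesis by (simp add: mult.assoc)
        qed
        then show ?thesis using p ce by (auto simp: K_def good_def)
      qed
      then have "chi (p * e) = 1" using M(2) chi(2) by auto
      moreover have "[p * e * b0 = p] (mod q)"
        using cong_scalar_left[OF e, of p] by (simp add: mult_ac)
      then have "chi (p * e * b0) = chi p" using chi(5) by blast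
      ultimately show ?thesis by (simp add: mult)
    qed
    show False
    proof (rule not_almost_constant[of "chi b0" B])
      show "norm (chi b0) = 1" using chi(2,4) by (cases "b0 \<in> M") (auto simp: b_def)
      show "chi n \<in> {-1, 0, 1}" if "chi b0 = -1" for n
        using that chi(2,3) by (cases "b0 \<in> M") (auto simp: b_def)
      fix Z assume Z: "finite Z" "Z \<subseteq> {p. prime p \<and> chi p \<noteq> chi b0}"
      then show "(\<Sum>p\<in>Z. 1 / real p) \<le> B" using good_const by (intro B) auto
    qed
  qed
  then have "c \<in> K" using c by simp
  then have "\<nu> (c * 1) = \<nu> 1" unfolding K_def by (metis (mono_tags, lifting) coprime_1_left mem_Collect_eq)
  then show ?thesis by (simp add: \<nu>_def)
qed

text \<open>Induction on the modulus. A class \<open>a\<close> with \<open>d = gcd a r > 1\<close>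
  is the dilate by \<open>d\<close> of a class modulo \<open>r div d\<close>, and the resulting
  shift by \<open>num_prime_factors d\<close> leaves the mean unchanged. The coprime classes share
  one value by \<open>coprime_classes_equal\<close>, and the total over all classes determines
  it.\<close>

lemma residue_independent:
  assumes "bdd G" "a < r"
  shows "logmean (\<lambda>n. of_bool (n mod r = a) * G (num_prime_factors n)) = logmean (\<lambda>n. G (num_prime_factors n)) / real r"
  using assms
proof (induction r arbitrary: G a rule: less_induct)
  case (less r G a)
  define J where "J = logmean (\<lambda>n. G (num_prime_factors n))"
  define \<nu> where "\<nu> = (\<lambda>a. logmean (\<lambda>n. of_bool (n mod r = a) * G (num_prime_factors n)))"
  have r: "r \<ge> 1" using less.prems(2) by linarith
  note bG [simp] = bdd_comp[OF less.prems(1)]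
  have noncop: "\<nu> a = J / real r" if a: "a < r" "\<not> coprime a r" for a
  proof -
    define d where "d = gcd a r"
    have d1: "d \<noteq> 1" using a(2) unfolding d_def coprime_iff_gcd_eq_1 .
    have d0: "d > 0" using r by (simp add: d_def)
    obtain a' where a': "a = d * a'" by (metis d_def dvdE gcd_dvd1)
    obtain r' where r': "r = d * r'" by (metis d_def dvdE gcd_dvd2)
    have "r' > 0" using r r' by (auto intro: Nat.gr0I)
    then have rr: "r' < r" using d0 d1 r' by simp
    have aa: "a' < r'" using a(1) a' r' d0 by simp
    define x where "x = (\<lambda>n. of_bool (n mod r = a) * G (num_prime_factors n))"
    have "\<nu> a = logmean (\<lambda>n. of_bool (d dvd n) * x n)"
    proof -
      have "d dvd n" if "n mod r = a" for n
        using that a' r' by (metis dvd_mod_iff dvd_triv_left)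
      then have "(\<lambda>n. of_bool (d dvd n) * x n) = x" by (auto simp: x_def fun_eq_iff)
      then show ?thesis by (simp only: \<nu>_def x_def)
    qed
    also have "\<dots> = logmean (\<lambda>n. x (d * n)) / real d"
      using d0 by (intro logmean.dilate) (simp_all add: x_def)
    also have "logmean (\<lambda>n. x (d * n)) = logmean (\<lambda>n. of_bool (n mod r' = a') * G (num_prime_factors n + num_prime_factors d))"
    proof (rule logmean.pos_cong)
      fix n :: nat assume "n \<ge> 1"
      then have "num_prime_factors (d * n) = num_prime_factors n + num_prime_factors d"
        using d0 by (simp add: num_prime_factors_mult)
      moreover have "(d * n) mod r = a \<longleftrightarrow> n mod r' = a'" using d0 by (simp add: a' r' mult_mod_right[symmetric])
      ultimately show "x (d * n) = of_bool (n mod r' = a') * G (num_prime_factors n + num_prime_factors d)"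
        by (simp add: x_def)
    qed
    also have "\<dots> = logmean (\<lambda>n. G (num_prime_factors n + num_prime_factors d)) / real r'"
      by (rule less.IH[OF rr bG aa])
    also have "\<dots> = J / real r'" unfolding J_def by (simp only: logmean_num_prime_factors_add[OF less.prems(1)])
    finally show ?thesis by (simp add: r' mult.commute)
  qed
  define v where "v = logmean (\<lambda>n. of_bool ([n = 1] (mod r)) * G (num_prime_factors n))"
  have cop: "\<nu> a = v" if "a < r" "coprime a r" for a
    using coprime_classes_equal[OF r less.prems(1) that(2)] that(1) by (simp add: \<nu>_def v_def cong_def)
  define C where "C = {a. a < r \<and> coprime a r}"
  have "J = logmean (\<lambda>n. \<Sum>a<r. of_bool (n mod r = a) * G (num_prime_factors n))"
  proof -
    have "(\<Sum>a<r. of_bool (n mod r = a) * G (num_prime_factors n)) = G (num_prime_factors n)" for n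
    proof -
      have "(\<Sum>a<r. of_bool (n mod r = a) * G (num_prime_factors n)) =
          (\<Sum>a<r. if n mod r = a then G (num_prime_factors n) else 0)"
        by (intro sum.cong) auto
      then show ?thesis using r by simp
    qed
    then show ?thesis by (simp only: J_def)
  qed
  also have "\<dots> = (\<Sum>a<r. \<nu> a)" unfolding \<nu>_def by (rule logmean.sum) simp
  also have "\<dots> = (\<Sum>a<r. J / real r + of_bool (a \<in> C) * (v - J / real r))"
    using noncop cop by (intro sum.cong refl) (auto simp: C_def)
  also have "\<dots> = J + real (card C) * (v - J / real r)"
  proof -
    have "(\<Sum>a<r. of_bool (a \<in> C)) = (\<Sum>a\<in>C. 1 :: real)"
      by (rule sum.mono_neutral_cong_right) (auto simp: C_def)
    then show ?thesis using r by (simp add: sum.distrib flip: sum_distrib_right)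
  qed
  finally have "real (card C) * (v - J / real r) = 0" by simp
  moreover have "card C \<noteq> 0" if "coprime a r"
  proof -
    have "finite C" "a \<in> C" using less.prems(2) that by (auto simp: C_def)
    then show ?thesis by auto
  qed
  ultimately have "\<nu> a = J / real r"
    using noncop[OF less.prems(2)] cop[OF less.prems(2)] by (cases "coprime a r") auto
  then show ?case by (simp add: \<nu>_def J_def)
qed

section \<open>Triple correlations\<close>

text \<open>The convex hull of the shifts of \<open>f\<close> by multiples of \<open>r\<close>,
  without closure. What survives shifts and convex combinations passes from \<open>f\<close> to all
  members by induction.\<close>

inductive shift_hull :: "nat \<Rightarrow> (nat \<Rightarrow> real) \<Rightarrow> (nat \<Rightarrow> real) \<Rightarrow> bool" for r f where
  base: "shift_hull r f f"
| shift: "shift_hull r f \<phi> \<Longrightarrow> shift_hull r f (\<lambda>m. \<phi> (m + r))"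
| conv: "shift_hull r f \<phi> \<Longrightarrow> shift_hull r f \<psi> \<Longrightarrow> 0 \<le> t \<Longrightarrow> t \<le> 1 \<Longrightarrow> shift_hull r f (\<lambda>m. t * \<phi> m + (1 - t) * \<psi> m)"

lemma hull_shifts: "shift_hull d f \<phi> \<Longrightarrow> shift_hull d f (\<lambda>m. \<phi> (m + d * j))"
proof (induction j)
  case (Suc j)
  then show ?case using shift_hull.shift[of d f "\<lambda>m. \<phi> (m + d * j)"] by (simp add: algebra_simps)
qed simp

lemma hull_one: "shift_hull r f \<phi> \<Longrightarrow> shift_hull 1 f \<phi>"
  by (induction rule: shift_hull.induct) (use hull_shifts[of 1 f _ r] in \<open>auto intro: shift_hull.intros\<close>)

lemma hull_average:
  assumes "shift_hull d f \<phi>" "k \<ge> 1"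
  shows "shift_hull d f (\<lambda>m. (\<Sum>a<k. \<phi> (m + d * a)) / real k)"
  using assms(2)
proof (induction k rule: dec_induct)
  case base
  then show ?case using assms(1) by simp
next
  case (step k)
  let ?t = "real k / real (Suc k)"
  have "shift_hull d f (\<lambda>m. ?t * ((\<Sum>a<k. \<phi> (m + d * a)) / real k) + (1 - ?t) * \<phi> (m + d * k))"
    by (intro shift_hull.conv step.IH hull_shifts assms) auto
  moreover have "?t * (s / real k) + (1 - ?t) * y = (s + y) / real (Suc k)" for s y
  proof -
    have "?t * (s / real k) = s / real (Suc k)" using step.hyps by simp
    moreover have "1 - ?t = 1 / real (Suc k)" by (simp add: field_simps)
    ultimately show ?thesis by (simp add: add_divide_distrib)
  qed
  then have "(\<lambda>m. ?t * ((\<Sum>a<k. \<phi> (m + d * a)) / real k) + (1 - ?t) * \<phi> (m + d * k))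
      = (\<lambda>m. (\<Sum>a<Suc k. \<phi> (m + d * a)) / real (Suc k))"
    by simp
  ultimately show ?case by metis
qed

lemma hull_bounds:
  assumes "shift_hull r f \<phi>" "\<And>m. 0 \<le> f m" "\<And>m. f m \<le> 1"
  shows "0 \<le> \<phi> m \<and> \<phi> m \<le> 1"
  using assms(1)
proof (induction arbitrary: m rule: shift_hull.induct)
  case (conv \<phi> \<psi> t)
  have "t * \<phi> m \<le> t * 1" "(1 - t) * \<psi> m \<le> (1 - t) * 1"
    by (intro mult_left_mono; use conv in simp)+
  then show ?case using conv by (smt (verit) mult_nonneg_nonneg)
qed (use assms in auto)

lemma abs_mult_le_one: "\<bar>x\<bar> \<le> 1 \<Longrightarrow> \<bar>y\<bar> \<le> 1 \<Longrightarrow> \<bar>x * y\<bar> \<le> (1::real)"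
  by (simp add: abs_mult mult_le_one)

context mean
begin

lemma square_add_le:
  assumes "bdd x" "bdd y"
  shows "L (\<lambda>n. (x n + y n)\<^sup>2) \<le> 2 * L (\<lambda>n. (x n)\<^sup>2) + 2 * L (\<lambda>n. (y n)\<^sup>2)"
proof -
  have "L (\<lambda>n. (x n + y n)\<^sup>2) \<le> L (\<lambda>n. 2 * (x n)\<^sup>2 + 2 * (y n)\<^sup>2)"
  proof (rule mono)
    fix n
    have "0 \<le> (x n - y n)\<^sup>2" by simp
    then show "(x n + y n)\<^sup>2 \<le> 2 * (x n)\<^sup>2 + 2 * (y n)\<^sup>2" by (simp add: power2_eq_square algebra_simps)
  qed (use assms in simp_all)
  also have "\<dots> = 2 * L (\<lambda>n. (x n)\<^sup>2) + 2 * L (\<lambda>n. (y n)\<^sup>2)"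
    using assms by (simp add: add cmult)
  finally show ?thesis .
qed

lemma square_sum_le:
  assumes "finite I" "\<And>i. i \<in> I \<Longrightarrow> bdd (x i)" "\<And>i. i \<in> I \<Longrightarrow> L (\<lambda>n. (x i n)\<^sup>2) \<le> e"
  shows "L (\<lambda>n. (\<Sum>i\<in>I. x i n)\<^sup>2) \<le> (real (card I))\<^sup>2 * e"
proof -
  have "L (\<lambda>n. (\<Sum>i\<in>I. x i n)\<^sup>2) \<le> L (\<lambda>n. real (card I) * (\<Sum>i\<in>I. (x i n)\<^sup>2))"
    using assms sum_squared_le_sum_of_squares[of _ I] by (intro mono) (auto simp: mult.commute)
  also have "\<dots> = real (card I) * (\<Sum>i\<in>I. L (\<lambda>n. (x i n)\<^sup>2))"
    using assms by (simp add: cmult sum)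
  also have "\<dots> \<le> real (card I) * (\<Sum>i\<in>I. e)"
    using assms by (intro mult_left_mono sum_mono) auto
  finally show ?thesis by (simp add: power2_eq_square mult.assoc)
qed

end

section \<open>Correlations of a function with values between 0 and 1\<close>

locale mean_fun = mean +
  fixes f :: "nat \<Rightarrow> real"
  assumes f_nonneg: "\<And>m. 0 \<le> f m" and f_le: "\<And>m. f m \<le> 1"
begin

lemma f_abs: "\<bar>f m\<bar> \<le> 1"
  using f_nonneg[of m] f_le[of m] by simp

lemma hull_nonneg: "shift_hull r f \<phi> \<Longrightarrow> 0 \<le> \<phi> m"
  and hull_le: "shift_hull r f \<phi> \<Longrightarrow> \<phi> m \<le> 1"
  and hull_abs: "shift_hull r f \<phi> \<Longrightarrow> \<bar>\<phi> m\<bar> \<le> 1"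
  using hull_bounds[of r f \<phi> m] f_nonneg f_le by auto

lemma bdd_f [simp]: "bdd (\<lambda>m. f (g m))"
  using f_abs by (rule bddI)

lemma bdd_hull: "shift_hull r f \<phi> \<Longrightarrow> bdd (\<lambda>m. \<phi> (g m))"
  using hull_abs by (rule bddI)

lemma hull_mean: "shift_hull r f \<phi> \<Longrightarrow> L \<phi> = L f"
proof (induction rule: shift_hull.induct)
  case (shift \<phi>)
  then show ?case using mean.shift[OF mean_axioms, of \<phi> r] bdd_hull[of r \<phi> "\<lambda>m. m"] by simp
next
  case (conv \<phi> \<psi> t)
  then have "L (\<lambda>m. t * \<phi> m + (1 - t) * \<psi> m) = t * L f + (1 - t) * L f"
    using bdd_hull[of r \<phi> "\<lambda>m. m"] bdd_hull[of r \<psi> "\<lambda>m. m"] by (simp add: add cmult)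
  then show ?case by (simp add: algebra_simps)
qed simp

text \<open>Von Neumann's argument with a near minimiser of the norm: the midpoint of
  \<open>\<phi>\<close> and its shift lies in the hull, so its squared norm is at least
  \<open>Inf Q\<close>, and the parallelogram law makes the two close, uniformly in
  \<open>j\<close>. That law carries a factor 4, whence \<open>\<eta> / 4\<close>.\<close>

lemma near_invariant:
  assumes "\<eta> > 0"
  obtains \<phi> where "shift_hull r f \<phi>" "\<And>j. L (\<lambda>m. (\<phi> (m + r * j) - \<phi> m)\<^sup>2) \<le> \<eta>"
proof -
  define Q where "Q = (\<lambda>\<phi>. L (\<lambda>m. (\<phi> m)\<^sup>2)) ` {\<phi>. shift_hull r f \<phi>}"
  have Q: "Q \<noteq> {}" "bdd_below Q"
  proof -
    show "Q \<noteq> {}" unfolding Q_def using shift_hull.base[of r f] by blast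
    have "0 \<le> L (\<lambda>m. (\<phi> m)\<^sup>2)" if "shift_hull r f \<phi>" for \<phi>
      using bdd_hull[OF that, of "\<lambda>m. m"] by (intro ge_const) simp_all
    then show "bdd_below Q" unfolding Q_def by (intro bdd_belowI2[where m = 0]) simp
  qed
  obtain \<phi> where \<phi>: "shift_hull r f \<phi>" "L (\<lambda>m. (\<phi> m)\<^sup>2) < Inf Q + \<eta> / 4"
    using cInf_lessD[OF Q(1), of "Inf Q + \<eta> / 4"] assms by (auto simp: Q_def)
  have "L (\<lambda>m. (\<phi> (m + r * j) - \<phi> m)\<^sup>2) \<le> \<eta>" for j
  proof -
    define \<theta> where "\<theta> = (\<lambda>m. \<phi> (m + r * j))"
    define \<mu> where "\<mu> = (\<lambda>m. 1 / 2 * \<phi> m + (1 - 1 / 2) * \<theta> m)"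
    have \<theta>: "shift_hull r f \<theta>" unfolding \<theta>_def by (rule hull_shifts[OF \<phi>(1)])
    have \<mu>: "shift_hull r f \<mu>" unfolding \<mu>_def by (intro shift_hull.conv \<phi> \<theta>) auto
    have b: "bdd \<phi>" "bdd \<theta>" "bdd \<mu>" using bdd_hull[of r _ "\<lambda>m. m"] \<phi> \<theta> \<mu> by auto
    have e: "L (\<lambda>m. (\<theta> m)\<^sup>2) = L (\<lambda>m. (\<phi> m)\<^sup>2)"
      unfolding \<theta>_def using shift[of "\<lambda>m. (\<phi> m)\<^sup>2"] b by simp
    have eq: "(\<lambda>m. (\<theta> m - \<phi> m)\<^sup>2) = (\<lambda>m. 2 * (\<theta> m)\<^sup>2 + 2 * (\<phi> m)\<^sup>2 - 4 * (\<mu> m)\<^sup>2)"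
      by (simp add: \<mu>_def fun_eq_iff power2_eq_square field_simps)
    have "L (\<lambda>m. (\<theta> m - \<phi> m)\<^sup>2) = 4 * L (\<lambda>m. (\<phi> m)\<^sup>2) - 4 * L (\<lambda>m. (\<mu> m)\<^sup>2)"
      unfolding eq using b by (simp add: add diff cmult e)
    moreover have "Inf Q \<le> L (\<lambda>m. (\<mu> m)\<^sup>2)"
      using Q(2) \<mu> by (intro cInf_lower) (auto simp: Q_def)
    ultimately show ?thesis using \<phi>(2) by (simp add: \<theta>_def)
  qed
  with \<phi>(1) show thesis by (rule that)
qed

text \<open>A shift by \<open>r = d * k\<close> is absorbed by replacing \<open>n\<close> with
  \<open>n + k\<close>, which the mean over \<open>n\<close> does not notice.\<close>

lemma hull_correlation:
  assumes "shift_hull r f \<phi>" "d dvd r" "bdd g"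
  shows "logmean (\<lambda>n. L (\<lambda>m. \<phi> (m + d * n) * g m)) = logmean (\<lambda>n. L (\<lambda>m. f (m + d * n) * g m))"
proof -
  have bL: "bdd (\<lambda>n. L (\<lambda>m. \<psi> (m + d * n) * g m))" if "shift_hull r f \<psi>" for \<psi>
  proof -
    obtain B where B: "\<And>m. \<bar>g m\<bar> \<le> B" using assms(3) by (auto simp: bdd_def)
    have "0 \<le> B" using B[of 0] by simp
    then have "\<bar>\<psi> (m + d * n) * g m\<bar> \<le> 1 * B" for m n
      unfolding abs_mult by (intro mult_mono hull_abs[OF that] B) auto
    then show ?thesis by (intro bddI[where B = "1 * B"] abs_le)
  qed
  show ?thesis
    using assms(1)
  proof (induction rule: shift_hull.induct)
    case (shift \<phi>)
    obtain k where "r = d * k" using assms(2) by (elim dvdE)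
    then have "logmean (\<lambda>n. L (\<lambda>m. \<phi> (m + d * n + r) * g m)) = logmean (\<lambda>n. L (\<lambda>m. \<phi> (m + d * (n + k)) * g m))"
      by (simp add: algebra_simps)
    also have "\<dots> = logmean (\<lambda>n. L (\<lambda>m. \<phi> (m + d * n) * g m))"
      by (rule logmean.shift[OF bL[OF shift.hyps]])
    finally show ?case using shift.IH by simp
  next
    case (conv \<phi> \<psi> t)
    have "L (\<lambda>m. (t * \<phi> (m + d * n) + (1 - t) * \<psi> (m + d * n)) * g m) =
        t * L (\<lambda>m. \<phi> (m + d * n) * g m) + (1 - t) * L (\<lambda>m. \<psi> (m + d * n) * g m)" for n
    proof -
      have "(\<lambda>m. (t * \<phi> (m + d * n) + (1 - t) * \<psi> (m + d * n)) * g m) =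
          (\<lambda>m. t * (\<phi> (m + d * n) * g m) + (1 - t) * (\<psi> (m + d * n) * g m))"
        by (simp add: algebra_simps)
      then show ?thesis
        using assms(3) bdd_hull[OF conv.hyps(1)] bdd_hull[OF conv.hyps(2)] by (simp add: add cmult)
    qed
    then have "logmean (\<lambda>n. L (\<lambda>m. (t * \<phi> (m + d * n) + (1 - t) * \<psi> (m + d * n)) * g m)) =
        t * logmean (\<lambda>n. L (\<lambda>m. \<phi> (m + d * n) * g m)) + (1 - t) * logmean (\<lambda>n. L (\<lambda>m. \<psi> (m + d * n) * g m))"
      using bL[OF conv.hyps(1)] bL[OF conv.hyps(2)] by (simp add: logmean.add logmean.cmult)
    then show ?case using conv.IH by (simp add: algebra_simps)
  qed simp
qed

text \<open>Katai's orthogonality argument for \<open>g = f - \<phi>\<close>. Turan-Kubilius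
  replaces \<open>n\<close> by \<open>p * n\<close> for \<open>p \<in> P\<close>; the factors
  without \<open>g\<close> are then common to all \<open>p\<close>, and Cauchy-Schwarz removes them.
  The correlations of \<open>g\<close> at \<open>p * n\<close> and \<open>q * n\<close> that remain
  vanish on average for \<open>p \<noteq> q\<close>.\<close>

lemma decorrelation:
  assumes P: "finite P" "\<And>p. p \<in> P \<Longrightarrow> prime p"
    and r: "\<And>p q. p \<in> P \<Longrightarrow> q \<in> P \<Longrightarrow> q < p \<Longrightarrow> (p - q) dvd r"
    and \<phi>: "shift_hull r f \<phi>"
  defines "S \<equiv> (\<Sum>p\<in>P. 1 / real p)"
  assumes S: "S > 0"
  shows "\<bar>logmean (\<lambda>n. L (\<lambda>m. f m * f (m + n) * f (m + num_prime_factors n)))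
        - logmean (\<lambda>n. L (\<lambda>m. f m * \<phi> (m + n) * f (m + num_prime_factors n)))\<bar> \<le> 2 / sqrt S"
proof -
  define g where "g = (\<lambda>m. f m - \<phi> m)"
  have g_abs: "\<bar>g m\<bar> \<le> 1" for m
    using f_nonneg[of m] f_le[of m] hull_nonneg[OF \<phi>, of m] hull_le[OF \<phi>, of m] by (auto simp: g_def abs_le_iff)
  have bg [simp]: "bdd (\<lambda>m. g (h m))" for h using g_abs by (rule bddI)
  have b\<phi> [simp]: "bdd (\<lambda>m. \<phi> (h m))" for h by (rule bdd_hull[OF \<phi>])
  define u where "u = (\<lambda>n. L (\<lambda>m. f m * g (m + n) * f (m + num_prime_factors n)))"
  define G where "G = (\<lambda>n m. \<Sum>p\<in>P. g (m + p * n) / real p)"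
  define v where "v = (\<lambda>n. L (\<lambda>m. (f m * f (m + Suc (num_prime_factors n))) * G n m))"
  have bG [simp]: "bdd (\<lambda>m. G n m)" for n unfolding G_def by simp
  have u_abs: "\<bar>u n\<bar> \<le> 1" for n unfolding u_def
    by (intro abs_le abs_mult_le_one f_abs g_abs)
  have bu: "bdd (\<lambda>n. u (h n))" for h using u_abs by (rule bddI)
  have "logmean (\<lambda>n. L (\<lambda>m. f m * f (m + n) * f (m + num_prime_factors n)))
        - logmean (\<lambda>n. L (\<lambda>m. f m * \<phi> (m + n) * f (m + num_prime_factors n))) =
        logmean (\<lambda>n. L (\<lambda>m. f m * f (m + n) * f (m + num_prime_factors n)) -
          L (\<lambda>m. f m * \<phi> (m + n) * f (m + num_prime_factors n)))"
    by (rule logmean.diff[symmetric]; rule bddI[of _ 1])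
      (intro abs_le abs_mult_le_one f_abs hull_abs[OF \<phi>])+
  also have "\<dots> = logmean u"
    unfolding u_def g_def by (simp add: diff[symmetric] algebra_simps)
  finally have eq: "logmean (\<lambda>n. L (\<lambda>m. f m * f (m + n) * f (m + num_prime_factors n)))
        - logmean (\<lambda>n. L (\<lambda>m. f m * \<phi> (m + n) * f (m + num_prime_factors n))) = logmean u" .
  have "(\<Sum>p\<in>P. logmean (\<lambda>n. u (p * n)) / real p) = logmean (\<lambda>n. \<Sum>p\<in>P. u (p * n) / real p)"
    using bu by (simp add: logmean.sum logmean.divide)
  also have "\<dots> = logmean v"
  proof (rule logmean.pos_cong)
    fix n :: nat assume n: "n \<ge> 1"
    have "v n = L (\<lambda>m. \<Sum>p\<in>P. (f m * g (m + p * n) * f (m + num_prime_factors (p * n))) / real p)"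
      unfolding v_def G_def using P n
      by (simp add: sum_distrib_left num_prime_factors_mult_prime mult_ac)
    also have "\<dots> = (\<Sum>p\<in>P. u (p * n) / real p)"
      unfolding u_def by (simp add: sum divide)
    finally show "(\<Sum>p\<in>P. u (p * n) / real p) = v n" by simp
  qed
  finally have sum_eq: "(\<Sum>p\<in>P. logmean (\<lambda>n. u (p * n)) / real p) = logmean v" .
  define c where "c = (\<lambda>p q n. L (\<lambda>m. g (m + p * n) * g (m + q * n)))"
  have c_abs: "\<bar>c p q n\<bar> \<le> 1" for p q n unfolding c_def
    by (intro abs_le abs_mult_le_one g_abs)
  have bc [simp]: "bdd (\<lambda>n. c p q n)" for p q using c_abs by (rule bddI)
  \<comment> \<open>Shifting \<open>m\<close> by \<open>q * n\<close> leaves only the difference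
    \<open>(p - q) * n\<close>. As \<open>p - q\<close> divides \<open>r\<close>, \<open>f\<close>
    and \<open>\<phi>\<close> have the same mean correlation with \<open>g\<close> along it.\<close>
  have c0: "logmean (c p q) = 0" if "p \<in> P" "q \<in> P" "q < p" for p q
  proof -
    have "c p q n = L (\<lambda>m. f (m + (p - q) * n) * g m) - L (\<lambda>m. \<phi> (m + (p - q) * n) * g m)" for n
    proof -
      have "p * n = q * n + (p - q) * n" using that(3) by (simp add: algebra_simps diff_mult_distrib)
      then have "c p q n = L (\<lambda>m. g ((m + q * n) + (p - q) * n) * g (m + q * n))"
        by (simp add: c_def add.assoc)
      also have "\<dots> = L (\<lambda>m. g (m + (p - q) * n) * g m)"
        by (rule shift[of "\<lambda>m. g (m + (p - q) * n) * g m"]) (use bg[of "\<lambda>m. m"] in simp)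
      also have "\<dots> = L (\<lambda>m. f (m + (p - q) * n) * g m - \<phi> (m + (p - q) * n) * g m)"
        by (simp add: g_def algebra_simps)
      also have "\<dots> = L (\<lambda>m. f (m + (p - q) * n) * g m) - L (\<lambda>m. \<phi> (m + (p - q) * n) * g m)"
        using bg[of "\<lambda>m. m"] by (intro diff) simp_all
      finally show ?thesis .
    qed
    then have "logmean (c p q) = logmean (\<lambda>n. L (\<lambda>m. f (m + (p - q) * n) * g m) - L (\<lambda>m. \<phi> (m + (p - q) * n) * g m))"
      by presburger
    also have "\<dots> = logmean (\<lambda>n. L (\<lambda>m. f (m + (p - q) * n) * g m)) - logmean (\<lambda>n. L (\<lambda>m. \<phi> (m + (p - q) * n) * g m))"
      by (rule logmean.diff; rule bddI[of _ 1])
        (intro abs_le abs_mult_le_one f_abs g_abs hull_abs[OF \<phi>])+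
    also have "\<dots> = 0"
      using hull_correlation[OF \<phi> r[OF that], of g] bg[of "\<lambda>m. m"] by simp
    finally show ?thesis .
  qed
  have c_sym: "c p q = c q p" for p q by (simp add: c_def mult.commute)
  have v_abs: "\<bar>v n\<bar> \<le> S" for n unfolding v_def
  proof (rule abs_le)
    fix m
    have "\<bar>G n m\<bar> \<le> S" unfolding G_def S_def
      by (intro order_trans[OF sum_abs] sum_mono) (use g_abs in \<open>simp add: divide_right_mono\<close>)
    then have "\<bar>f m * f (m + Suc (num_prime_factors n))\<bar> * \<bar>G n m\<bar> \<le> 1 * S"
      by (intro mult_mono abs_mult_le_one f_abs) auto
    then show "\<bar>f m * f (m + Suc (num_prime_factors n)) * G n m\<bar> \<le> S" by (simp add: abs_mult)
  qed
  then have bv: "bdd v" by (rule bddI)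
  have "(logmean v)\<^sup>2 \<le> logmean (\<lambda>n. (v n)\<^sup>2)"
    by (rule logmean.square_le[OF bv])
  also have "\<dots> \<le> logmean (\<lambda>n. \<Sum>p\<in>P. \<Sum>q\<in>P. c p q n / (real p * real q))"
  proof (rule logmean.mono)
    fix n
    have le: "(v n)\<^sup>2 \<le> L (\<lambda>m. (G n m)\<^sup>2)"
      unfolding v_def by (intro square_mult_le bG abs_mult_le_one f_abs)
    have "L (\<lambda>m. (G n m)\<^sup>2) = L (\<lambda>m. \<Sum>p\<in>P. \<Sum>q\<in>P. g (m + p * n) * g (m + q * n) / (real p * real q))"
      by (simp add: G_def power2_eq_square sum_product)
    also have "\<dots> = (\<Sum>p\<in>P. \<Sum>q\<in>P. c p q n / (real p * real q))"
      by (simp add: c_def sum divide)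
    finally show "(v n)\<^sup>2 \<le> (\<Sum>p\<in>P. \<Sum>q\<in>P. c p q n / (real p * real q))" using le by simp
  qed (use bv in simp_all)
  also have "\<dots> = (\<Sum>p\<in>P. \<Sum>q\<in>P. logmean (c p q) / (real p * real q))"
    by (simp add: logmean.sum logmean.divide)
  also have "\<dots> \<le> (\<Sum>p\<in>P. \<Sum>q\<in>P. if p = q then 1 / real p else 0)"
  proof (intro sum_mono)
    fix p q assume pq: "p \<in> P" "q \<in> P"
    have "logmean (c p p) \<le> 1" using logmean.abs_le[OF c_abs[of p p]] by (simp add: abs_le_iff)
    moreover have "real p \<ge> 1" using P(2)[OF pq(1)] prime_ge_1_nat by simp
    ultimately have "logmean (c p p) / (real p * real p) \<le> 1 / real p"
      by (simp add: field_simps)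
    moreover have "logmean (c p q) = 0" if "p \<noteq> q"
      using c0[of p q] c0[of q p] c_sym[of p q] pq that by (cases "q < p") auto
    ultimately show "logmean (c p q) / (real p * real q) \<le> (if p = q then 1 / real p else 0)"
      by auto
  qed
  also have "\<dots> = S" using P(1) by (simp add: S_def)
  finally have "\<bar>logmean v\<bar> \<le> sqrt S" by (simp add: real_le_rsqrt)
  moreover have "\<bar>S * logmean u - logmean v\<bar> \<le> sqrt S"
    unfolding S_def sum_eq[symmetric]
    by (rule logmean.turan_kubilius[OF P(1)]) (use P(2) u_abs in auto)
  \<comment> \<open>One \<open>sqrt S\<close> comes from the diagonal terms \<open>p = q\<close>,
    the other is the Turan-Kubilius error.\<close>
  ultimately have "\<bar>S * logmean u\<bar> \<le> 2 * sqrt S" by linarith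
  then have "sqrt S * (sqrt S * \<bar>logmean u\<bar>) \<le> sqrt S * 2"
    using S by (simp add: abs_mult mult.assoc[symmetric] mult.commute)
  then have "sqrt S * \<bar>logmean u\<bar> \<le> 2"
    by (rule mult_left_le_imp_le) (simp add: S)
  then show ?thesis unfolding eq using S by (simp add: field_simps)
qed

text \<open>\<open>n\<close> and \<open>n mod r\<close> differ by a multiple of \<open>r\<close>,
  under which \<open>\<phi>\<close> is nearly invariant uniformly in the multiple. Cauchy-Schwarz
  turns \<open>\<eta>\<close> into \<open>sqrt \<eta>\<close>.\<close>

lemma freeze_residue:
  assumes \<phi>: "shift_hull r f \<phi>" and inv: "\<And>j. L (\<lambda>m. (\<phi> (m + r * j) - \<phi> m)\<^sup>2) \<le> \<eta>"
  shows "\<bar>logmean (\<lambda>n. L (\<lambda>m. f m * \<phi> (m + n) * f (m + num_prime_factors n)))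
        - logmean (\<lambda>n. L (\<lambda>m. f m * \<phi> (m + n mod r) * f (m + num_prime_factors n)))\<bar> \<le> sqrt \<eta>"
proof -
  have b\<phi> [simp]: "bdd (\<lambda>m. \<phi> (h m))" for h by (rule bdd_hull[OF \<phi>])
  have "logmean (\<lambda>n. L (\<lambda>m. f m * \<phi> (m + n) * f (m + num_prime_factors n)))
        - logmean (\<lambda>n. L (\<lambda>m. f m * \<phi> (m + n mod r) * f (m + num_prime_factors n))) =
    logmean (\<lambda>n. L (\<lambda>m. f m * \<phi> (m + n) * f (m + num_prime_factors n))
        - L (\<lambda>m. f m * \<phi> (m + n mod r) * f (m + num_prime_factors n)))"
    by (rule logmean.diff[symmetric]; rule bddI[of _ 1])
      (intro abs_le abs_mult_le_one f_abs hull_abs[OF \<phi>])+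
  also have "\<bar>\<dots>\<bar> \<le> sqrt \<eta>"
  proof (rule logmean.abs_le)
    fix n
    have "L (\<lambda>m. f m * \<phi> (m + n) * f (m + num_prime_factors n))
        - L (\<lambda>m. f m * \<phi> (m + n mod r) * f (m + num_prime_factors n)) =
      L (\<lambda>m. (f m * f (m + num_prime_factors n)) * (\<phi> (m + n) - \<phi> (m + n mod r)))"
      by (simp add: diff[symmetric] algebra_simps)
    also have "\<bar>\<dots>\<bar> \<le> sqrt (L (\<lambda>m. (\<phi> (m + n) - \<phi> (m + n mod r))\<^sup>2))"
      by (intro abs_mult_le abs_mult_le_one f_abs) simp
    also have "L (\<lambda>m. (\<phi> (m + n) - \<phi> (m + n mod r))\<^sup>2) =
        L (\<lambda>m. (\<phi> (m + n mod r + r * (n div r)) - \<phi> (m + n mod r))\<^sup>2)"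
      by (simp add: add.assoc)
    also have "\<dots> = L (\<lambda>m. (\<phi> (m + r * (n div r)) - \<phi> m)\<^sup>2)"
      using b\<phi>[of "\<lambda>m. m"] by (intro shift[of "\<lambda>m. (\<phi> (m + r * (n div r)) - \<phi> m)\<^sup>2"]) simp
    also have "sqrt \<dots> \<le> sqrt \<eta>" using inv by simp
    finally show "\<bar>L (\<lambda>m. f m * \<phi> (m + n) * f (m + num_prime_factors n))
        - L (\<lambda>m. f m * \<phi> (m + n mod r) * f (m + num_prime_factors n))\<bar> \<le> sqrt \<eta>" by simp
  qed
  finally show ?thesis .
qed

text \<open>For a fixed residue the correlation depends on \<open>n\<close> through
  \<open>num_prime_factors n\<close> alone, so \<open>residue_independent\<close> replaces the
  indicator of the residue by \<open>1 / r\<close>.\<close>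

lemma average_residues:
  assumes \<phi>: "shift_hull r f \<phi>" and "r > 0"
  shows "logmean (\<lambda>n. L (\<lambda>m. f m * \<phi> (m + n mod r) * f (m + num_prime_factors n))) =
    logmean (\<lambda>n. L (\<lambda>m. f m * ((\<Sum>a<r. \<phi> (m + a)) / real r) * f (m + num_prime_factors n)))"
proof -
  have b\<phi> [simp]: "bdd (\<lambda>m. \<phi> (h m))" for h by (rule bdd_hull[OF \<phi>])
  define G where "G = (\<lambda>a k. L (\<lambda>m. f m * \<phi> (m + a) * f (m + k)))"
  have "\<bar>G a k\<bar> \<le> 1" for a k unfolding G_def
    by (intro abs_le abs_mult_le_one f_abs hull_abs[OF \<phi>])
  then have bG [simp]: "bdd (\<lambda>n. G a (h n))" for a h by (rule bddI)
  have "L (\<lambda>m. f m * \<phi> (m + n mod r) * f (m + num_prime_factors n)) =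
    (\<Sum>a<r. of_bool (n mod r = a) * G a (num_prime_factors n))" for n
  proof -
    have "(\<Sum>a<r. of_bool (n mod r = a) * G a (num_prime_factors n)) =
        (\<Sum>a<r. if n mod r = a then G a (num_prime_factors n) else 0)"
      by (intro sum.cong) auto
    then show ?thesis using \<open>r > 0\<close> by (simp add: G_def)
  qed
  then have "logmean (\<lambda>n. L (\<lambda>m. f m * \<phi> (m + n mod r) * f (m + num_prime_factors n))) =
      logmean (\<lambda>n. \<Sum>a<r. of_bool (n mod r = a) * G a (num_prime_factors n))" by presburger
  also have "\<dots> = (\<Sum>a<r. logmean (\<lambda>n. of_bool (n mod r = a) * G a (num_prime_factors n)))"
    by (rule logmean.sum) simp
  also have "\<dots> = (\<Sum>a<r. logmean (\<lambda>n. G a (num_prime_factors n)) / real r)"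
    using bG[of _ "\<lambda>n. n"] by (intro sum.cong refl residue_independent) auto
  also have "\<dots> = logmean (\<lambda>n. \<Sum>a<r. G a (num_prime_factors n) / real r)"
    by (simp add: logmean.sum logmean.divide)
  also have "(\<lambda>n. \<Sum>a<r. G a (num_prime_factors n) / real r) =
      (\<lambda>n. L (\<lambda>m. \<Sum>a<r. f m * \<phi> (m + a) * f (m + num_prime_factors n) / real r))"
    unfolding G_def by (simp add: sum divide)
  also have "\<dots> = (\<lambda>n. L (\<lambda>m. f m * ((\<Sum>a<r. \<phi> (m + a)) / real r) * f (m + num_prime_factors n)))"
    by (simp add: sum_distrib_left sum_distrib_right sum_divide_distrib)
  finally show ?thesis .
qed

text \<open>Split \<open>j = b + r * k\<close> with \<open>b < r\<close>. Shifting by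
  \<open>r * k\<close> moves each summand by a multiple of \<open>r\<close>; shifting by
  \<open>b\<close> only trades the first \<open>b\<close> summands for those a distance
  \<open>r\<close> further on. Each part costs at most \<open>\<eta>\<close>, and
  \<open>square_add_le\<close> doubles both.\<close>

lemma average_near_invariant:
  assumes \<phi>: "shift_hull r f \<phi>" and inv: "\<And>j. L (\<lambda>m. (\<phi> (m + r * j) - \<phi> m)\<^sup>2) \<le> \<eta>" and "r > 0"
  defines "\<Phi> \<equiv> (\<lambda>m. (\<Sum>a<r. \<phi> (m + a)) / real r)"
  shows "L (\<lambda>m. (\<Phi> (m + j) - \<Phi> m)\<^sup>2) \<le> 4 * \<eta>"
proof -
  have b\<phi> [simp]: "bdd (\<lambda>m. \<phi> (h m))" for h by (rule bdd_hull[OF \<phi>])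
  have b\<Phi> [simp]: "bdd (\<lambda>m. \<Phi> (h m))" for h unfolding \<Phi>_def by simp
  have \<eta>: "0 \<le> \<eta>" using inv[of 0] by simp
  define D where "D = (\<lambda>k m. \<phi> (m + r * k) - \<phi> m)"
  have bD [simp]: "bdd (\<lambda>m. D k (h m))" for k h unfolding D_def by simp
  have D: "L (\<lambda>m. (D k (m + a) / real r)\<^sup>2) \<le> \<eta> / (real r)\<^sup>2" for k a
  proof -
    have "L (\<lambda>m. (D k (m + a) / real r)\<^sup>2) = L (\<lambda>m. (D k (m + a))\<^sup>2) / (real r)\<^sup>2"
      by (simp add: power_divide divide)
    also have "L (\<lambda>m. (D k (m + a))\<^sup>2) = L (\<lambda>m. (D k m)\<^sup>2)"
      using bD[of k "\<lambda>m. m"] by (intro shift[of "\<lambda>m. (D k m)\<^sup>2"]) simp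
    also have "\<dots> \<le> \<eta>" using inv unfolding D_def .
    finally show ?thesis by (simp add: divide_right_mono)
  qed
  have sq: "L (\<lambda>m. (\<Sum>a<b. D k (m + a) / real r)\<^sup>2) \<le> \<eta>" if "b \<le> r" for b k
  proof -
    have "L (\<lambda>m. (\<Sum>a<b. D k (m + a) / real r)\<^sup>2) \<le> (real (card {..<b}))\<^sup>2 * (\<eta> / (real r)\<^sup>2)"
      by (rule square_sum_le) (use D in auto)
    also have "\<dots> = (real b / real r)\<^sup>2 * \<eta>" by (simp add: power_divide)
    also have "\<dots> \<le> 1 * \<eta>"
      using that \<eta> \<open>r > 0\<close> by (intro mult_right_mono) (auto simp: power_le_one)
    finally show ?thesis by simp
  qed
  define b k where "b = j mod r" and "k = j div r"
  have j: "j = b + r * k" and b: "b \<le> r" using \<open>r > 0\<close> by (auto simp: b_def k_def less_imp_le)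
  have one: "\<Phi> (m + r * k) - \<Phi> m = (\<Sum>a<r. D k (m + a) / real r)" for m
    by (simp add: \<Phi>_def D_def sum_subtractf diff_divide_distrib sum_divide_distrib add_ac)
  have two: "\<Phi> (m + b) - \<Phi> m = (\<Sum>a<b. D 1 (m + a) / real r)" for m
  proof -
    have "(\<Sum>a<r. \<phi> (m + c + a)) - (\<Sum>a<r. \<phi> (m + a)) = (\<Sum>a<c. D 1 (m + a))" for c
    proof (induction c)
      case (Suc c)
      have "(\<Sum>a<r. \<phi> (m + Suc c + a)) = (\<Sum>a<r. \<phi> (m + c + a)) + D 1 (m + c)"
        using sum.lessThan_Suc_shift[of "\<lambda>a. \<phi> (m + c + a)" r]
          sum.lessThan_Suc[of "\<lambda>a. \<phi> (m + c + a)" r] by (simp add: D_def)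
      then show ?case using Suc by simp
    qed simp
    then show ?thesis by (simp add: \<Phi>_def sum_divide_distrib[symmetric] diff_divide_distrib[symmetric])
  qed
  have "L (\<lambda>m. (\<Phi> (m + j) - \<Phi> m)\<^sup>2) =
      L (\<lambda>m. ((\<Phi> (m + b + r * k) - \<Phi> (m + b)) + (\<Phi> (m + b) - \<Phi> m))\<^sup>2)"
    by (simp add: j add.assoc)
  also have "\<dots> \<le> 2 * L (\<lambda>m. (\<Phi> (m + b + r * k) - \<Phi> (m + b))\<^sup>2) + 2 * L (\<lambda>m. (\<Phi> (m + b) - \<Phi> m)\<^sup>2)"
    by (rule square_add_le) simp_all
  also have "L (\<lambda>m. (\<Phi> (m + b + r * k) - \<Phi> (m + b))\<^sup>2) = L (\<lambda>m. (\<Phi> (m + r * k) - \<Phi> m)\<^sup>2)"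
    using b\<Phi>[of "\<lambda>m. m"] by (intro shift[of "\<lambda>m. (\<Phi> (m + r * k) - \<Phi> m)\<^sup>2"]) simp
  finally show ?thesis
    unfolding one two using sq[OF order_refl, of k] sq[OF b, of 1] by linarith
qed

text \<open>A shift of the last factor by 1 amounts to adding 1 to
  \<open>num_prime_factors n\<close>, which leaves the logarithmic mean unchanged.\<close>

lemma replace_prime_factor_shift:
  assumes "shift_hull 1 f \<psi>" "bdd h"
  shows "logmean (\<lambda>n. L (\<lambda>m. h m * \<psi> (m + num_prime_factors n))) = logmean (\<lambda>n. L (\<lambda>m. h m * f (m + num_prime_factors n)))"
proof -
  obtain B where B: "\<And>m. \<bar>h m\<bar> \<le> B" using assms(2) by (auto simp: bdd_def)
  have B0: "0 \<le> B" using B[of 0] by simp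
  have bL: "bdd (\<lambda>n. L (\<lambda>m. h m * \<theta> (m + g n)))" if "shift_hull 1 f \<theta>" for \<theta> and g :: "nat \<Rightarrow> nat"
  proof -
    have "\<bar>h m * \<theta> (m + g n)\<bar> \<le> B * 1" for m n
      unfolding abs_mult using B0 by (intro mult_mono hull_abs[OF that] B) auto
    then show ?thesis by (intro bddI[where B = "B * 1"] abs_le)
  qed
  show ?thesis using assms(1)
  proof (induction rule: shift_hull.induct)
    case (shift \<phi>)
    then show ?case
      using logmean_num_prime_factors_add[of "\<lambda>k. L (\<lambda>m. h m * \<phi> (m + k))" 1] bL[of \<phi> "\<lambda>n. n"]
      by simp
  next
    case (conv \<phi> \<psi> t)
    have "L (\<lambda>m. h m * (t * \<phi> (m + k) + (1 - t) * \<psi> (m + k))) =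
        t * L (\<lambda>m. h m * \<phi> (m + k)) + (1 - t) * L (\<lambda>m. h m * \<psi> (m + k))" for k
    proof -
      have "(\<lambda>m. h m * (t * \<phi> (m + k) + (1 - t) * \<psi> (m + k))) =
          (\<lambda>m. t * (h m * \<phi> (m + k)) + (1 - t) * (h m * \<psi> (m + k)))"
        by (simp add: algebra_simps)
      then show ?thesis
        using assms(2) bdd_hull[OF conv.hyps(1)] bdd_hull[OF conv.hyps(2)] by (simp add: add cmult)
    qed
    then have "logmean (\<lambda>n. L (\<lambda>m. h m * (t * \<phi> (m + num_prime_factors n) + (1 - t) * \<psi> (m + num_prime_factors n))))
       = t * logmean (\<lambda>n. L (\<lambda>m. h m * \<phi> (m + num_prime_factors n))) +
         (1 - t) * logmean (\<lambda>n. L (\<lambda>m. h m * \<psi> (m + num_prime_factors n)))"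
      using bL[OF conv.hyps(1)] bL[OF conv.hyps(2)] by (simp add: logmean.add logmean.cmult)
    then show ?case using conv.IH by (simp add: algebra_simps)
  qed simp
qed

text \<open>A shift of \<open>f\<close> is undone by translating \<open>m\<close>, which moves it
  onto the nearly invariant factors \<open>A\<close> and \<open>B\<close>. Quantifying over
  \<open>j\<close> carries the induction through the shift rule of the hull.\<close>

lemma replace_in_product:
  assumes \<theta>: "shift_hull 1 f \<theta>" and A: "\<And>m. \<bar>A m\<bar> \<le> 1" and B: "\<And>m. \<bar>B m\<bar> \<le> 1"
    and A_inv: "\<And>j. L (\<lambda>m. (A (m + j) - A m)\<^sup>2) \<le> \<alpha>"
    and B_inv: "\<And>j. L (\<lambda>m. (B (m + j) - B m)\<^sup>2) \<le> \<beta>"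
  shows "\<bar>L (\<lambda>m. \<theta> m * A m * B m) - L (\<lambda>m. f m * A m * B m)\<bar> \<le> sqrt \<alpha> + sqrt \<beta>"
proof -
  have bA [simp]: "bdd (\<lambda>m. A (g m))" and bB [simp]: "bdd (\<lambda>m. B (g m))" for g
    using A B by (auto intro: bddI)
  have bA' [simp]: "bdd A" and bB' [simp]: "bdd B" using A B by (auto intro: bddI)
  have "\<bar>L (\<lambda>m. \<theta> (m + j) * A m * B m) - L (\<lambda>m. f m * A m * B m)\<bar> \<le> sqrt \<alpha> + sqrt \<beta>" for j
    using \<theta>
  proof (induction arbitrary: j rule: shift_hull.induct)
    case base
    have "L (\<lambda>m. f m * A m * B m) = L (\<lambda>m. f (m + j) * A (m + j) * B (m + j))"
      by (rule shift[symmetric, of "\<lambda>m. f m * A m * B m"]) (use bdd_f[of "\<lambda>m. m"] in simp)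
    also have "\<dots> - L (\<lambda>m. f (m + j) * A m * B m) =
        L (\<lambda>m. f (m + j) * A (m + j) * B (m + j) - f (m + j) * A m * B m)"
      by (simp add: diff)
    also have "\<dots> = L (\<lambda>m. f (m + j) * B (m + j) * (A (m + j) - A m) + f (m + j) * A m * (B (m + j) - B m))"
      by (simp add: algebra_simps)
    also have "\<dots> = L (\<lambda>m. f (m + j) * B (m + j) * (A (m + j) - A m)) + L (\<lambda>m. f (m + j) * A m * (B (m + j) - B m))"
      by (simp add: add)
    finally have "\<bar>L (\<lambda>m. f (m + j) * A m * B m) - L (\<lambda>m. f m * A m * B m)\<bar> \<le>
        \<bar>L (\<lambda>m. f (m + j) * B (m + j) * (A (m + j) - A m))\<bar> + \<bar>L (\<lambda>m. f (m + j) * A m * (B (m + j) - B m))\<bar>"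
      by linarith
    also have "\<dots> \<le> sqrt (L (\<lambda>m. (A (m + j) - A m)\<^sup>2)) + sqrt (L (\<lambda>m. (B (m + j) - B m)\<^sup>2))"
      by (intro add_mono abs_mult_le abs_mult_le_one f_abs A B) simp_all
    also have "\<dots> \<le> sqrt \<alpha> + sqrt \<beta>"
      using A_inv B_inv by (intro add_mono) auto
    finally show ?case .
  next
    case (shift \<phi>)
    then show ?case using shift.IH[of "j + 1"] by (simp add: add_ac)
  next
    case (conv \<phi> \<psi> t)
    define x where "x = L (\<lambda>m. \<phi> (m + j) * A m * B m)"
    define y where "y = L (\<lambda>m. \<psi> (m + j) * A m * B m)"
    define z where "z = L (\<lambda>m. f m * A m * B m)"
    have "(\<lambda>m. (t * \<phi> (m + j) + (1 - t) * \<psi> (m + j)) * A m * B m) =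
        (\<lambda>m. t * (\<phi> (m + j) * A m * B m) + (1 - t) * (\<psi> (m + j) * A m * B m))"
      by (simp add: algebra_simps)
    then have "L (\<lambda>m. (t * \<phi> (m + j) + (1 - t) * \<psi> (m + j)) * A m * B m) = t * x + (1 - t) * y"
      using bdd_hull[OF conv.hyps(1)] bdd_hull[OF conv.hyps(2)] by (simp add: add cmult x_def y_def)
    moreover have "t * x + (1 - t) * y - z = t * (x - z) + (1 - t) * (y - z)" by (simp add: algebra_simps)
    moreover have "\<bar>t * (x - z) + (1 - t) * (y - z)\<bar> \<le> t * \<bar>x - z\<bar> + (1 - t) * \<bar>y - z\<bar>"
      using conv.hyps by (intro order_trans[OF abs_triangle_ineq]) (simp add: abs_mult)
    moreover have "t * \<bar>x - z\<bar> + (1 - t) * \<bar>y - z\<bar> \<le> t * (sqrt \<alpha> + sqrt \<beta>) + (1 - t) * (sqrt \<alpha> + sqrt \<beta>)"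
      using conv.hyps conv.IH[of j] by (intro add_mono mult_left_mono) (auto simp: x_def y_def z_def)
    moreover have "t * (sqrt \<alpha> + sqrt \<beta>) + (1 - t) * (sqrt \<alpha> + sqrt \<beta>) = sqrt \<alpha> + sqrt \<beta>"
      by (simp add: algebra_simps)
    ultimately show ?case unfolding z_def by linarith
  qed
  from this[of 0] show ?thesis by simp
qed

text \<open>Jensen's inequality through the tangent of the cube at \<open>d\<close>: the gap is
  \<open>(x - d)\<^sup>2 * (x + 2 * d)\<close>.\<close>

lemma cube_le:
  assumes "\<And>m. 0 \<le> x m" "bdd x"
  shows "(L x) ^ 3 \<le> L (\<lambda>m. x m * x m * x m)"
proof -
  define d where "d = L x"
  have d: "0 \<le> d" unfolding d_def using assms by (intro ge_const)
  have "d ^ 3 = L (\<lambda>m. 3 * d\<^sup>2 * x m - 2 * d ^ 3)"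
    using assms by (simp add: diff cmult d_def[symmetric] power2_eq_square power3_eq_cube)
  also have "\<dots> \<le> L (\<lambda>m. x m * x m * x m)"
  proof (rule mono)
    fix m
    have "0 \<le> (x m - d)\<^sup>2 * (x m + 2 * d)" using d assms(1)[of m] by simp
    then show "3 * d\<^sup>2 * x m - 2 * d ^ 3 \<le> x m * x m * x m"
      by (simp add: power2_eq_square power3_eq_cube algebra_simps)
  qed (use assms in simp_all)
  finally show ?thesis by (simp add: d_def)
qed

theorem triple_correlation:
  "(L f) ^ 3 \<le> logmean (\<lambda>n. L (\<lambda>m. f m * f (m + n) * f (m + num_prime_factors n)))" (is "_ \<le> ?I")
proof (rule field_le_epsilon)
  fix e :: real assume e: "e > 0"
  \<comment> \<open>Half of \<open>e\<close> pays for the decorrelation error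
    \<open>2 / sqrt S\<close>. The rest is \<open>9 * sqrt \<eta>\<close>: 1 for freezing the
    residue, 1 for dropping the shift of \<open>\<psi>\<close>, then 3, 2 and 2 for the three
    replacements in the product.\<close>
  define \<eta> where "\<eta> = (e / 18)\<^sup>2"
  have \<eta>: "\<eta> > 0" "sqrt \<eta> = e / 18" using e by (auto simp: \<eta>_def)
  obtain P where P: "finite P" "\<And>p. p \<in> P \<Longrightarrow> prime p" and S: "(4 / e)\<^sup>2 \<le> (\<Sum>p\<in>P. 1 / real p)"
    using primes_reciprocal_unbounded by metis
  define S where "S = (\<Sum>p\<in>P. 1 / real p)"
  have "0 < (4 / e)\<^sup>2" using e by simp
  then have S0: "S > 0" unfolding S_def using S by (rule less_le_trans)
  have "4 / e \<le> sqrt S" using S by (intro real_le_rsqrt) (simp add: S_def)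
  then have err: "2 / sqrt S \<le> e / 2" using e S0 by (simp add: field_simps)
  \<comment> \<open>The factorial is divisible by every positive integer up to \<open>Max P\<close>,
    in particular by all differences of elements of \<open>P\<close>.\<close>
  define r where "r = (fact (Max P) :: nat)"
  have r0: "r > 0" by (simp add: r_def)
  have r: "(p - q) dvd r" if "p \<in> P" "q \<in> P" "q < p" for p q
    unfolding r_def using that P(1) by (intro dvd_fact) (auto intro: order_trans[OF diff_le_self])
  obtain \<phi> where \<phi>: "shift_hull r f \<phi>" "\<And>j. L (\<lambda>m. (\<phi> (m + r * j) - \<phi> m)\<^sup>2) \<le> \<eta>"
    using near_invariant[OF \<eta>(1)] by metis
  obtain \<psi> where \<psi>: "shift_hull 1 f \<psi>" "\<And>j. L (\<lambda>m. (\<psi> (m + 1 * j) - \<psi> m)\<^sup>2) \<le> \<eta>"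
    using near_invariant[OF \<eta>(1)] by metis
  define \<Phi> where "\<Phi> = (\<lambda>m. (\<Sum>a<r. \<phi> (m + a)) / real r)"
  have \<Phi>: "shift_hull 1 f \<Phi>"
    using hull_average[OF hull_one[OF \<phi>(1)], of r] r0 by (simp add: \<Phi>_def)
  have \<Phi>_inv: "L (\<lambda>m. (\<Phi> (m + j) - \<Phi> m)\<^sup>2) \<le> 4 * \<eta>" for j
    using average_near_invariant[OF \<phi> r0] unfolding \<Phi>_def .
  have \<psi>_inv: "L (\<lambda>m. (\<psi> (m + j) - \<psi> m)\<^sup>2) \<le> \<eta>" for j using \<psi>(2)[of j] by simp
  note [simp] = bdd_hull[OF \<phi>(1)] bdd_hull[OF \<psi>(1)] bdd_hull[OF \<Phi>]
  have b: "bdd \<phi>" "bdd \<psi>" "bdd \<Phi>" "bdd f"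
    using bdd_hull[OF \<phi>(1), of "\<lambda>m. m"] bdd_hull[OF \<psi>(1), of "\<lambda>m. m"] bdd_hull[OF \<Phi>, of "\<lambda>m. m"]
      bdd_f[of "\<lambda>m. m"] by auto
  have 1: "\<bar>?I - logmean (\<lambda>n. L (\<lambda>m. f m * \<phi> (m + n) * f (m + num_prime_factors n)))\<bar> \<le> 2 / sqrt S"
    using decorrelation[OF P r \<phi>(1)] S0 by (simp add: S_def)
  have 2: "\<bar>logmean (\<lambda>n. L (\<lambda>m. f m * \<phi> (m + n) * f (m + num_prime_factors n)))
      - logmean (\<lambda>n. L (\<lambda>m. f m * \<Phi> m * f (m + num_prime_factors n)))\<bar> \<le> sqrt \<eta>"
    using freeze_residue[OF \<phi>] average_residues[OF \<phi>(1) r0] by (simp add: \<Phi>_def)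
  have 3: "logmean (\<lambda>n. L (\<lambda>m. f m * \<Phi> m * f (m + num_prime_factors n))) =
      logmean (\<lambda>n. L (\<lambda>m. f m * \<Phi> m * \<psi> (m + num_prime_factors n)))"
    using b by (intro replace_prime_factor_shift[symmetric] \<psi>) simp
  have 4: "L (\<lambda>m. f m * \<Phi> m * \<psi> m) - sqrt \<eta> \<le> logmean (\<lambda>n. L (\<lambda>m. f m * \<Phi> m * \<psi> (m + num_prime_factors n)))"
  proof (rule logmean.ge_const)
    show "bdd (\<lambda>n. L (\<lambda>m. f m * \<Phi> m * \<psi> (m + num_prime_factors n)))"
      by (rule bddI[of _ 1]) (intro abs_le abs_mult_le_one f_abs hull_abs[OF \<Phi>] hull_abs[OF \<psi>(1)])
    fix n
    have "L (\<lambda>m. f m * \<Phi> m * \<psi> (m + num_prime_factors n)) - L (\<lambda>m. f m * \<Phi> m * \<psi> m) =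
        L (\<lambda>m. f m * \<Phi> m * (\<psi> (m + num_prime_factors n) - \<psi> m))"
      using b by (simp add: diff[symmetric] algebra_simps)
    moreover have "\<bar>\<dots>\<bar> \<le> sqrt (L (\<lambda>m. (\<psi> (m + num_prime_factors n) - \<psi> m)\<^sup>2))"
      using b by (intro abs_mult_le abs_mult_le_one f_abs hull_abs[OF \<Phi>]) simp
    moreover have "\<dots> \<le> sqrt \<eta>" using \<psi>_inv by simp
    ultimately show "L (\<lambda>m. f m * \<Phi> m * \<psi> m) - sqrt \<eta> \<le> L (\<lambda>m. f m * \<Phi> m * \<psi> (m + num_prime_factors n))"
      by linarith
  qed
  \<comment> \<open>Each replacement exchanges \<open>f\<close> with a member of its hull, so
    \<open>\<Phi>\<close> is turned into \<open>\<psi>\<close> by way of \<open>f\<close>.\<close>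
  have 5: "\<bar>L (\<lambda>m. \<psi> m * \<Phi> m * \<psi> m) - L (\<lambda>m. f m * \<Phi> m * \<psi> m)\<bar> \<le> sqrt (4 * \<eta>) + sqrt \<eta>"
    by (rule replace_in_product[OF \<psi>(1) hull_abs[OF \<Phi>] hull_abs[OF \<psi>(1)] \<Phi>_inv \<psi>_inv])
  have 6: "\<bar>L (\<lambda>m. \<Phi> m * \<psi> m * \<psi> m) - L (\<lambda>m. f m * \<psi> m * \<psi> m)\<bar> \<le> sqrt \<eta> + sqrt \<eta>"
    by (rule replace_in_product[OF \<Phi> hull_abs[OF \<psi>(1)] hull_abs[OF \<psi>(1)] \<psi>_inv \<psi>_inv])
  have 7: "\<bar>L (\<lambda>m. \<psi> m * \<psi> m * \<psi> m) - L (\<lambda>m. f m * \<psi> m * \<psi> m)\<bar> \<le> sqrt \<eta> + sqrt \<eta>"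
    by (rule replace_in_product[OF \<psi>(1) hull_abs[OF \<psi>(1)] hull_abs[OF \<psi>(1)] \<psi>_inv \<psi>_inv])
  have 8: "L (\<lambda>m. \<psi> m * \<Phi> m * \<psi> m) = L (\<lambda>m. \<Phi> m * \<psi> m * \<psi> m)"
    by (simp add: mult_ac)
  have 9: "(L f) ^ 3 \<le> L (\<lambda>m. \<psi> m * \<psi> m * \<psi> m)"
    using cube_le[OF hull_nonneg[OF \<psi>(1)] b(2)] hull_mean[OF \<psi>(1)] by simp
  have "sqrt (4 * \<eta>) = 2 * sqrt \<eta>" by (simp add: real_sqrt_mult)
  with 1 2 3 4 5 6 7 8 9 err \<eta>(2) e show "(L f) ^ 3 \<le> ?I + e" by linarith
qed

end

section \<open>Transfer to upper densities\<close>

theorem corollary1p37: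
  fixes E :: "nat set" and \<delta> :: real
  assumes "E \<subseteq> {1..}"
    and "upper_density E = ereal \<delta>"
    and "\<delta> > 0"
  shows "(\<forall>\<epsilon>::real. \<epsilon> > 0 \<longrightarrow>
            limsup (\<lambda>N::nat. limsup (\<lambda>M::nat.
              ereal (real (card {(n, m). n \<in> {1..N} \<and> m \<in> {1..M} \<and>
                                   m \<in> E \<and> m + n \<in> E \<and> m + num_prime_factors n \<in> E})
                     / (real N * real M))))
            \<ge> ereal (\<delta> ^ 3 - \<epsilon>))
       \<and> (\<exists>n::nat. n \<ge> 1 \<and>
            (\<exists>A :: nat set. A \<subseteq> {1..} \<and> upper_density A > 0 \<and>
               (\<forall>m\<in>A. {m, m + n, m + num_prime_factors n} \<subseteq> E)))"
proof -
  define f :: "nat \<Rightarrow> real" where "f = (\<lambda>m. of_bool (m \<in> E))"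
  define w :: "nat \<Rightarrow> real" where "w = (\<lambda>_. 1)"
  have avg: "wavg w N (\<lambda>m. of_bool (m \<in> A)) = real (card (A \<inter> {1..N})) / real N" for A N
    by (simp add: wavg_def w_def Int_commute)
  define d where "d = (\<lambda>N. real (card (E \<inter> {1..N})) / real N)"
  \<comment> \<open>End points along which the density of \<open>E\<close> converges to its limit
    superior, so that the mean of \<open>f\<close> is exactly \<open>\<delta>\<close>.\<close>
  obtain M where M: "strict_mono M" "((\<lambda>N. ereal (d N)) \<circ> M) \<longlonglongrightarrow> limsup (\<lambda>N. ereal (d N))"
    using limsup_subseq_lim[of "\<lambda>N. ereal (d N)"] by blast
  have dM: "(\<lambda>j. d (M j)) \<longlonglongrightarrow> \<delta>"
    using M(2) assms(2) by (simp add: o_def upper_density_def d_def)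
  interpret W: weight w M
  proof
    show "filterlim (\<lambda>N. \<Sum>n=1..N. w n) at_top sequentially"
      using filterlim_real_sequentially by (simp add: w_def)
    show "filterlim M sequentially sequentially" using M(1) by (rule filterlim_subseq)
  qed (auto simp: w_def)
  interpret W: mean_fun "wmean w M" f
    by unfold_locales (auto simp: f_def)
  have "wmean w M f = \<delta>"
    unfolding wmean_def f_def avg using dM by (intro glim_tendsto) (simp add: d_def)
  then have cor: "\<delta> ^ 3 \<le> logmean (\<lambda>n. wmean w M (\<lambda>m. f m * f (m + n) * f (m + num_prime_factors n)))"
    using W.triple_correlation by simp
  define A where "A = (\<lambda>n. {m \<in> E. m + n \<in> E \<and> m + num_prime_factors n \<in> E})"
  define a where "a = (\<lambda>n. wmean w M (\<lambda>m. of_bool (m \<in> A n)))"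
  have a_eq: "wmean w M (\<lambda>m. f m * f (m + n) * f (m + num_prime_factors n)) = a n" for n
  proof -
    have "(\<lambda>m. f m * f (m + n) * f (m + num_prime_factors n)) = (\<lambda>m. of_bool (m \<in> A n))"
      by (auto simp: f_def A_def)
    then show ?thesis by (simp add: a_def)
  qed
  have LLa: "\<delta> ^ 3 \<le> logmean a" using cor by (simp add: a_eq)
  have a_abs: "\<bar>a n\<bar> \<le> 1" for n unfolding a_def by (rule W.abs_le) simp
  have ba: "bdd a" using a_abs by (rule bddI)
  have d3: "0 < \<delta> ^ 3" using assms(3) by simp
  define I where "I = (\<lambda>N. limsup (\<lambda>M::nat. ereal (real (card {(n, m). n \<in> {1..N} \<and> m \<in> {1..M} \<and>
      m \<in> E \<and> m + n \<in> E \<and> m + num_prime_factors n \<in> E}) / (real N * real M))))"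
  \<comment> \<open>For fixed \<open>N\<close> the normalised count is the uniform average over
    \<open>m\<close> of the finite combination \<open>z\<close> of indicators. Linearity evaluates
    the mean of \<open>z\<close>, and the limit superior over all end points dominates the mean
    along \<open>M\<close>.\<close>
  have I_ge: "ereal ((\<Sum>n=1..N. a n) / real N) \<le> I N" if N: "N \<ge> 1" for N
  proof -
    define z :: "nat \<Rightarrow> real" where "z = (\<lambda>m. (\<Sum>n=1..N. of_bool (m \<in> A n)) / real N)"
    have bz: "bdd z" unfolding z_def by (intro bdd_divide bdd_sum bdd_of_bool)
    have "wavg w K z = real (card {(n, m). n \<in> {1..N} \<and> m \<in> {1..K} \<and>
      m \<in> E \<and> m + n \<in> E \<and> m + num_prime_factors n \<in> E}) / (real N * real K)" for K
    proof -
      have "{(n, m). n \<in> {1..N} \<and> m \<in> {1..K} \<and> m \<in> E \<and> m + n \<in> E \<and> m + num_prime_factors n \<in> E}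
          = Sigma {1..N} (\<lambda>n. A n \<inter> {1..K})" by (auto simp: A_def)
      then have "card {(n, m). n \<in> {1..N} \<and> m \<in> {1..K} \<and> m \<in> E \<and> m + n \<in> E \<and> m + num_prime_factors n \<in> E}
          = (\<Sum>n=1..N. card (A n \<inter> {1..K}))" by simp
      moreover have "wavg w K z = (\<Sum>n=1..N. wavg w K (\<lambda>m. of_bool (m \<in> A n))) / real N"
      proof -
        have "(\<Sum>m=1..K. w m * z m) = (\<Sum>m=1..K. \<Sum>n=1..N. w m * of_bool (m \<in> A n) / real N)"
          unfolding z_def sum_divide_distrib sum_distrib_left by simp
        also have "\<dots> = (\<Sum>n=1..N. \<Sum>m=1..K. w m * of_bool (m \<in> A n) / real N)"
          by (rule sum.swap)
        finally show ?thesis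
          unfolding wavg_def by (simp only: sum_divide_distrib divide_divide_eq_left mult.commute)
      qed
      ultimately show ?thesis by (simp add: avg sum_divide_distrib mult.commute)
    qed
    then have I: "I N = limsup (\<lambda>K. ereal (wavg w K z))" by (simp add: I_def)
    have "wmean w M z = (\<Sum>n=1..N. a n) / real N"
      unfolding z_def a_def by (subst W.divide, intro bdd_sum bdd_of_bool) (subst W.sum, simp_all)
    moreover have "ereal (wmean w M z) \<le> I N"
    proof (rule ccontr)
      assume "\<not> ?thesis"
      then have "I N < ereal (wmean w M z)" by simp
      then obtain c where c: "I N < ereal c" "ereal c < ereal (wmean w M z)"
        using ereal_dense2 by blast
      have "eventually (\<lambda>K. ereal (wavg w K z) < ereal c) sequentially"
        using c(1) unfolding I by (rule Limsup_lessD)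
      then have "eventually (\<lambda>K. wavg w K z \<le> c) sequentially"
        by (rule eventually_mono) simp
      then have "wmean w M z \<le> c" using bz by (intro W.wmean_le)
      then show False using c(2) by simp
    qed
    ultimately show ?thesis by simp
  qed
  have "ereal (\<delta> ^ 3 - \<epsilon>) \<le> limsup I" if e: "\<epsilon> > 0" for \<epsilon>
  proof (rule ccontr)
    assume "\<not> ?thesis"
    then have "eventually (\<lambda>N. I N < ereal (\<delta> ^ 3 - \<epsilon>)) sequentially"
      by (intro Limsup_lessD) simp
    then have ev: "eventually (\<lambda>N. (\<Sum>n=1..N. a n) / real N \<le> \<delta> ^ 3 - \<epsilon>) sequentially"
      using eventually_ge_at_top[of 1]
    proof eventually_elim
      case (elim N)
      then show ?case using I_ge[of N] by (meson ereal_less_eq(3) less_imp_le order_trans)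
    qed
    have "logmean a \<le> \<delta> ^ 3 - \<epsilon>" by (rule logmean_le_cesaro[OF ba ev])
    then show False using LLa e by simp
  qed
  moreover have "\<exists>n\<ge>1. a n > 0"
  proof (rule ccontr)
    assume "\<not> ?thesis"
    \<comment> \<open>The negated claim says nothing about index 0; cutting it off is harmless
      because \<open>logmean\<close> ignores it.\<close>
    then have "logmean (\<lambda>n. a n * of_bool (n \<ge> 1)) \<le> 0"
      using ba by (intro logmean.le_const bdd_mult bdd_of_bool) (auto simp: not_less)
    moreover have "logmean (\<lambda>n. a n * of_bool (n \<ge> 1)) = logmean a" by (rule logmean.pos_cong) simp
    ultimately show False using LLa d3 by simp
  qed
  then obtain n where n: "n \<ge> 1" "a n > 0" by blast
  have "upper_density (A n) > 0"
  proof (rule ccontr)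
    assume "\<not> ?thesis"
    \<comment> \<open>The half leaves room below \<open>a n\<close> while giving the strict
      inequality that \<open>Limsup_lessD\<close> asks for.\<close>
    then have "upper_density (A n) < ereal (a n / 2)"
      using n(2) by (meson ereal_less(2) half_gt_zero le_less_trans not_le)
    then have "eventually (\<lambda>N. ereal (real (card (A n \<inter> {1..N})) / real N) < ereal (a n / 2)) sequentially"
      unfolding upper_density_def by (rule Limsup_lessD)
    then have "eventually (\<lambda>N. wavg w N (\<lambda>m. of_bool (m \<in> A n)) \<le> a n / 2) sequentially"
      by (rule eventually_mono) (simp add: avg)
    then have "a n \<le> a n / 2" unfolding a_def by (intro W.wmean_le) simp_all
    then show False using n(2) by simp
  qed
  moreover have "A n \<subseteq> {1..}" "\<forall>m\<in>A n. {m, m + n, m + num_prime_factors n} \<subseteq> E"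
    using assms(1) by (auto simp: A_def)
  ultimately show ?thesis using n(1) unfolding I_def by blast
qed

end
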